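(* Assume that $\mu>0$ and $V:(0,1)\to[0,+\infty)$ is a continuous function satisfying $$V(r)\geq\frac1{r^2(-\ln r)^2}\quad\text{in }(0,1).$$ Let $m_\mu=4\pi\sqrt{1+4\mu}$. Then the following conclusions hold: (i) For radially symmetric functions in $\mathcal H^1_{V,\mu,0}(B_1)$, $$\sup_{u\ \text{radial},\ \|u\|_{V,\mu}\leq1}\int_{B_1}e^{m_\mu|u|^2}dx<\infty,$$ and this result is optimal: if $\alpha>m_\mu$ and $\lim_{r\to0^+}V(r)r^2(-\ln r)^2=1$, then there exists a sequence $\{u_n\}$ of radially symmetric functions which concentrates at the origin such that $\|u_n\|_{V,\mu}\leq1$ and $\int_{B_1}e^{\alpha|u_n|^2}dx\to\infty$ as $n\to+\infty$. (ii) For general functions in $\mathcal H^1_{V,\mu,0}(B_1)$, $$\sup_{\|u\|_{V,\mu}\leq1}\int_{B_1}e^{4\pi|u|^2}dx<\infty,$$ and this result is optimal: if $\alpha>4\pi$ and $\lim_{r\to0^+}V(r)r^2(-\ln r)^2=1$, then there exists a sequence $\{u_n\}$ of functions concentrating at some point away from the origin, such that $\|u_n\|_{V,\mu}\leq1$ and $\int_{B_1}e^{\alpha|u_n|^2}dx\to+\infty$ as $n\to+\infty$.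
   Context: $B_1$ is the open unit ball centered at the origin in $\mathbb R^2$, and $B_r(x_0)$ is the open ball of radius $r$ centered at $x_0$. $\mathcal H^1_{V,\mu,0}(B_1)$ is the completion of $C_c^\infty(B_1\setminus\{0\})$ under the norm $$\|u\|_{V,\mu}=\Big(\int_{B_1}\big(|\nabla u|^2+\mu V(|x|)u^2\big)dx\Big)^{1/2}.$$ A sequence $\{u_n\}$ is said to be concentrating at a point $x_0$ if for any $r\in(0,1)$ and any $\epsilon>0$ there exists $n_0>0$ such that for all $n\ge n_0$, $$\int_{B_1\setminus B_r(x_0)}\big(|\nabla u_n|^2+\mu V(|x|)u_n^2\big)dx<\epsilon.$$ *)

theory Defs
  imports "HOL-Analysis.Analysis"
begin

text \<open>The plane is \<^typ>\<open>real^2\<close>. Elements of the function spaces below are represented by functions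
  on the whole plane; only their values almost everywhere in the unit disc matter. All energies
  are \<^typ>\<open>ennreal\<close>-valued Lebesgue integrals, so that a divergent integral has value
  \<^term>\<open>\<infinity> :: ennreal\<close>.\<close>

abbreviation unit_disc :: "(real^2) set" where
  "unit_disc \<equiv> ball 0 1"

primrec Ck :: "nat \<Rightarrow> (real^2 \<Rightarrow> real) \<Rightarrow> bool" where
  "Ck 0 f \<longleftrightarrow> continuous_on UNIV f"
| "Ck (Suc k) f \<longleftrightarrow> (\<exists>G. (\<forall>x. GDERIV f x :> G x) \<and> (\<forall>i. Ck k (\<lambda>x. G x $ i)))"

definition gradient :: "(real^2 \<Rightarrow> real) \<Rightarrow> real^2 \<Rightarrow> real^2" where
  "gradient f x = (THE D. GDERIV f x :> D)"

text \<open>\<open>C\<^sub>c\<^sup>\<infinity>(U)\<close>, each function being extended by zero to the plane.\<close>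

definition test_functions :: "(real^2) set \<Rightarrow> (real^2 \<Rightarrow> real) set" where
  "test_functions U =
     {\<phi>. (\<forall>k. Ck k \<phi>) \<and> compact (closure {x. \<phi> x \<noteq> 0}) \<and> closure {x. \<phi> x \<noteq> 0} \<subseteq> U}"

definition locally_integrable :: "(real^2) set \<Rightarrow> (real^2 \<Rightarrow> 'b::euclidean_space) \<Rightarrow> bool" where
  "locally_integrable U f \<longleftrightarrow> (\<forall>K. compact K \<and> K \<subseteq> U \<longrightarrow> set_integrable lebesgue K f)"

definition has_weak_gradient ::
    "(real^2 \<Rightarrow> real) \<Rightarrow> (real^2 \<Rightarrow> real^2) \<Rightarrow> (real^2) set \<Rightarrow> bool" where
  "has_weak_gradient u g U \<longleftrightarrow>
     locally_integrable U u \<and> locally_integrable U g \<and>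
     (\<forall>\<phi>\<in>test_functions U.
        (LINT x:U|lebesgue. u x *\<^sub>R gradient \<phi> x) = - (LINT x:U|lebesgue. \<phi> x *\<^sub>R g x))"

text \<open>Weak gradients are unique up to null sets, so the choice below does not affect any integral.\<close>

definition weak_gradient :: "(real^2) set \<Rightarrow> (real^2 \<Rightarrow> real) \<Rightarrow> real^2 \<Rightarrow> real^2" where
  "weak_gradient U u = (SOME g. has_weak_gradient u g U)"

definition energy ::
    "(real \<Rightarrow> real) \<Rightarrow> real \<Rightarrow> (real^2) set \<Rightarrow> (real^2 \<Rightarrow> real) \<Rightarrow> ennreal" where
  "energy V \<mu> A u =
     (\<integral>\<^sup>+x\<in>A. ennreal ((norm (weak_gradient unit_disc u x))\<^sup>2 + \<mu> * V (norm x) * (u x)\<^sup>2) \<partial>lebesgue)"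

text \<open>The completion of \<open>C\<^sub>c\<^sup>\<infinity>(B\<^sub>1 \ {0})\<close>, realised as a space of functions: the weakly differentiable
  functions on the disc that are limits, in the energy norm, of test functions. Under the
  hypothesis \<open>V(r) \<ge> 1/(r\<^sup>2 ln\<^sup>2 r)\<close> one has \<open>V \<ge> e\<^sup>2\<close>, so for \<open>\<mu> > 0\<close> the energy norm controls
  the \<open>L\<^sup>2\<close> norms of a function and of its gradient; hence every Cauchy sequence of test
  functions has such a limit, unique almost everywhere.
  The energy of the difference is used (rather than \<open>H_norm\<close> below) because its value is
  \<^term>\<open>\<infinity> :: ennreal\<close> when the integral diverges.\<close>

definition H_space :: "(real \<Rightarrow> real) \<Rightarrow> real \<Rightarrow> (real^2 \<Rightarrow> real) set" where
  "H_space V \<mu> =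
     {u. (\<exists>g. has_weak_gradient u g unit_disc) \<and>
         (\<exists>\<phi>. (\<forall>n::nat. \<phi> n \<in> test_functions (unit_disc - {0})) \<and>
              (\<lambda>n. energy V \<mu> unit_disc (\<lambda>x. \<phi> n x - u x)) \<longlonglongrightarrow> 0)}"

text \<open>Meaningful on \<open>H_space V \<mu>\<close>, where the energy is finite.\<close>

definition H_norm :: "(real \<Rightarrow> real) \<Rightarrow> real \<Rightarrow> (real^2 \<Rightarrow> real) \<Rightarrow> real" where
  "H_norm V \<mu> u = sqrt (enn2real (energy V \<mu> unit_disc u))"

definition radial :: "(real^2 \<Rightarrow> real) \<Rightarrow> bool" where
  "radial u \<longleftrightarrow> (\<exists>\<rho>::real \<Rightarrow> real. AE x in lebesgue. x \<in> unit_disc \<longrightarrow> u x = \<rho> (norm x))"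

definition concentrating ::
    "(real \<Rightarrow> real) \<Rightarrow> real \<Rightarrow> (nat \<Rightarrow> real^2 \<Rightarrow> real) \<Rightarrow> real^2 \<Rightarrow> bool" where
  "concentrating V \<mu> u x\<^sub>0 \<longleftrightarrow>
     (\<forall>r\<in>{0<..<1}. \<forall>\<epsilon>>0. \<exists>n\<^sub>0>0. \<forall>n\<ge>n\<^sub>0.
        energy V \<mu> (unit_disc - ball x\<^sub>0 r) (u n) < ennreal \<epsilon>)"

definition exp_integral :: "real \<Rightarrow> (real^2 \<Rightarrow> real) \<Rightarrow> ennreal" where
  "exp_integral \<alpha> u = (\<integral>\<^sup>+x\<in>unit_disc. ennreal (exp (\<alpha> * \<bar>u x\<bar>\<^sup>2)) \<partial>lebesgue)"

definition m_crit :: "real \<Rightarrow> real" where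
  "m_crit \<mu> = 4 * pi * sqrt (1 + 4 * \<mu>)"

end

theory Submission imports Defs begin

text \<open>Both upper bounds avoid symmetrisation. A test function \<open>\<phi>\<close> is dominated by \<open>\<integral> k x y f y dy\<close>, where
  \<open>f\<close> has \<open>L\<^sup>2\<close> norm at most \<open>1\<close>: in general \<open>f = \<bar>\<nabla>\<phi>\<bar>\<close> and \<open>k x y = 1 / (2 pi \<bar>x - y\<bar>)\<close>; after averaging
  over circles, one may instead factor the one-dimensional operator \<open>- w'' + \<mu> w / t\<^sup>2\<close> on the rays, where
  \<open>t = - ln \<bar>x\<bar>\<close>, which gains the factor \<open>sqrt (1 + 4 \<mu>)\<close>. The average of \<open>k\<close> over a set of measure
  \<open>pi exp (- 2 T)\<close> has squared norm \<open>(T + O(1)) / c\<close>, and its inner product with the average over a smaller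
  set is bounded by the same quantity. So if \<open>\<bar>u\<bar>\<close> almost attains the pointwise bound at two levels, the
  Cauchy-Schwarz inequality forces these levels to be close, and the critical exponential integral is
  bounded. For the optimality, the extremal \<open>sqrt t exp (- (\<kappa> / 2) \<bar>ln (t / T)\<bar>)\<close> of the one-dimensional
  problem, with \<open>\<kappa> = sqrt (1 + 4 \<nu>)\<close>, is smoothed and cut off, and \<open>T\<close> tends to infinity.\<close>

text \<open>A single test is not enough at critical growth. It bounds the measure of {|u|^2 > n / c}
  by a multiple of exp (- 2 n), so each layer contributes a bounded amount to the integral of exp (2
  c |u|^2), and the sum of these bounds over n diverges. Two tests at once show that layers with a
  small deficit are few. Here c = 2 pi in general and c = 2 pi sqrt (1 + 4 \<mu>) in the radial
  case. Elements of the space are limits of test functions that need not be radial even if the limit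
  is. Hence functions are tested against sets instead of being evaluated: L2 convergence passes
  through, and on a rotation invariant set a non-radial function is averaged over circles of its own
  accord. The extremal comes from the solutions t^((1 + \<kappa>) / 2) and t^((1 - \<kappa>) / 2) of
  - w'' + \<nu> w / t^2 = 0, glued at t = T and scaled to the value sqrt T there. Its energy is
  \<kappa> on the half line and 2 pi \<kappa> in the plane. After normalisation exp (\<alpha> u^2)
  reaches exp (\<alpha> T / (2 pi \<kappa>)) on an area of order exp (- 2 T), so the threshold is
  \<alpha> = 4 pi \<kappa>.\<close>

lemma ball_borel [measurable]: "ball (a :: 'a :: metric_space) r \<in> sets borel"
  by (rule borel_open) simp

lemma pred_ball [measurable (raw)]:
  fixes f :: "'b \<Rightarrow> 'a :: metric_space"
  assumes "f \<in> borel_measurable M"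
  shows "Measurable.pred M (\<lambda>x. f x \<in> ball a r)"
  using pred_sets2[OF ball_borel assms] .

section \<open>Changes of variables in Lebesgue measure and radial integrals in the plane\<close>

lemma nn_integral_lborel_cong_except:
  assumes "\<And>x. x \<noteq> a \<Longrightarrow> f x = g x"
  shows "(\<integral>\<^sup>+x. f x \<partial>lborel) = (\<integral>\<^sup>+x. g x \<partial>lborel)"
proof (rule nn_integral_cong_AE)
  show "AE x in lborel. f x = g x"
    using AE_lborel_singleton[of a] assms by (auto elim: eventually_mono)
qed

lemma nn_integral_lborel_scale:
  fixes F :: "'a::euclidean_space \<Rightarrow> ennreal"
  assumes [measurable]: "F \<in> borel_measurable borel" and c: "c > 0"
  shows "(\<integral>\<^sup>+y. F (c *\<^sub>R y) \<partial>lborel) * ennreal (c ^ DIM('a)) = (\<integral>\<^sup>+y. F y \<partial>lborel)"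
proof -
  have "(\<integral>\<^sup>+y. F y \<partial>lborel) =
      (\<integral>\<^sup>+y. F y \<partial>density (distr lborel borel (\<lambda>x. 0 + c *\<^sub>R x)) (\<lambda>_. ennreal (\<bar>c\<bar> ^ DIM('a))))"
    using lborel_affine[of c "0::'a"] c by simp
  also have "\<dots> = ennreal (c ^ DIM('a)) * (\<integral>\<^sup>+y. F (c *\<^sub>R y) \<partial>lborel)"
    using c by (simp add: nn_integral_density nn_integral_distr nn_integral_cmult)
  finally show ?thesis by (simp add: mult.commute)
qed

lemma nn_integral_lborel_translate:
  fixes F :: "'a::euclidean_space \<Rightarrow> ennreal"
  assumes [measurable]: "F \<in> borel_measurable borel"
  shows "(\<integral>\<^sup>+y. F (a + y) \<partial>lborel) = (\<integral>\<^sup>+y. F y \<partial>lborel)"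
proof -
  have "(\<integral>\<^sup>+y. F y \<partial>lborel) =
      (\<integral>\<^sup>+y. F y \<partial>density (distr lborel borel (\<lambda>x. a + 1 *\<^sub>R x)) (\<lambda>_. ennreal (\<bar>1\<bar> ^ DIM('a))))"
    using lborel_affine[of 1 "a::'a"] by simp
  also have "\<dots> = (\<integral>\<^sup>+y. F (a + y) \<partial>lborel)"
    by (simp add: nn_integral_density nn_integral_distr nn_integral_cmult)
  finally show ?thesis by simp
qed

lemma nn_integral_exp_greaterThan:
  assumes "c > 0"
  shows "(\<integral>\<^sup>+t. indicator {a<..} t * ennreal (exp (- (c * t))) \<partial>lborel) = ennreal (exp (- (c * a)) / c)"
proof -
  have "(\<integral>\<^sup>+t. indicator {a<..} t * ennreal (exp (- (c * t))) \<partial>lborel)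
      = (\<integral>\<^sup>+t. ennreal (exp (- (c * t))) * indicator {a..} t \<partial>lborel)"
    by (intro nn_integral_lborel_cong_except[where a = a])
       (auto split: split_indicator)
  also have "\<dots> = ennreal (0 - (- exp (- (c * a)) / c))"
  proof (rule nn_integral_FTC_atLeast)
    show "((\<lambda>t. - exp (- (c * t)) / c) \<longlongrightarrow> 0) at_top"
      using assms by real_asymp
  qed (use assms in \<open>auto intro!: derivative_eq_intros simp: field_simps\<close>)
  finally show ?thesis by simp
qed

lemma nn_integral_exp_lessThan:
  assumes "c > 0"
  shows "(\<integral>\<^sup>+t. indicator {..<a} t * ennreal (exp (c * t)) \<partial>lborel) = ennreal (exp (c * a) / c)"
proof -
  have "(\<integral>\<^sup>+t. indicator {..<a} t * ennreal (exp (c * t)) \<partial>lborel)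
     = (\<integral>\<^sup>+t. indicator {..<a} (0 + (-1) * t) * ennreal (exp (c * (0 + (-1) * t))) \<partial>lborel)"
    by (subst nn_integral_real_affine[where c = "-1" and t = 0]) auto
  also have "\<dots> = (\<integral>\<^sup>+t. indicator {-a<..} t * ennreal (exp (- (c * t))) \<partial>lborel)"
    by (intro nn_integral_cong) (auto split: split_indicator)
  finally show ?thesis using nn_integral_exp_greaterThan[OF assms, of "-a"] by simp
qed

text \<open>Polar coordinates with \<open>r = exp (- t)\<close>. Instead of an angle, the direction \<open>y / \<bar>y\<bar>\<close> of a
  uniformly distributed point \<open>y\<close> of the disc is used, so that the proof only needs Tonelli's theorem
  and the scaling of Lebesgue measure.\<close>

lemma log_polar:
  fixes F :: "real^2 \<Rightarrow> ennreal"
  assumes [measurable]: "F \<in> borel_measurable borel"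
  shows "(\<integral>\<^sup>+z. F z \<partial>lborel) = 2 * (\<integral>\<^sup>+y. indicator unit_disc y *
      (\<integral>\<^sup>+t. F (exp (-t) *\<^sub>R (y /\<^sub>R norm y)) * ennreal (exp (- (2 * t))) \<partial>lborel) \<partial>lborel)"
proof -
  \<comment> \<open>Translating \<open>t\<close> by \<open>ln (norm y)\<close> trades the unit
    direction for \<open>y\<close> itself; the density \<open>exp (- (2 * t))\<close> then produces
    the factor \<open>(norm y)\<^sup>2\<close>, and the integrand depends on \<open>y\<close> and
    \<open>t\<close> through a dilation of \<open>y\<close> only.\<close>
  have 1: "(\<integral>\<^sup>+t. F (exp (-t) *\<^sub>R (y /\<^sub>R norm y)) * ennreal (exp (- (2 * t))) \<partial>lborel)
     = (\<integral>\<^sup>+t. F (exp (-t) *\<^sub>R y) * ennreal (exp (- (2 * t)) * (norm y)\<^sup>2) \<partial>lborel)" if "y \<noteq> 0" for y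
  proof -
    have e: "exp (- (t - ln (norm y))) = norm y * exp (-t)" for t
      using that by (simp add: exp_diff exp_minus field_simps)
    have e2: "exp (- (2 * (t - ln (norm y)))) = (norm y)\<^sup>2 * exp (-(2 * t))" for t
    proof -
      have "exp (- (2 * (t - ln (norm y)))) = (exp (- (t - ln (norm y))))\<^sup>2"
        by (simp add: power2_eq_square flip: exp_add)
      also have "\<dots> = (norm y)\<^sup>2 * exp (-(2 * t))"
        unfolding e by (simp add: power2_eq_square flip: exp_add)
      finally show ?thesis .
    qed
    have "(\<integral>\<^sup>+t. F (exp (-t) *\<^sub>R (y /\<^sub>R norm y)) * ennreal (exp (- (2 * t))) \<partial>lborel)
      = (\<integral>\<^sup>+t. F (exp (- (t - ln (norm y))) *\<^sub>R (y /\<^sub>R norm y)) * ennreal (exp (- (2 * (t - ln (norm y))))) \<partial>lborel)"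
      using nn_integral_lborel_translate[of "\<lambda>t. F (exp (-t) *\<^sub>R (y /\<^sub>R norm y)) * ennreal (exp (- (2 * t)))" "- ln (norm y)"]
      by simp
    also have "\<dots> = (\<integral>\<^sup>+t. F (exp (-t) *\<^sub>R y) * ennreal (exp (- (2 * t)) * (norm y)\<^sup>2) \<partial>lborel)"
      unfolding e e2 using that by (intro nn_integral_cong) (simp add: mult.commute mult.assoc[symmetric])
    finally show ?thesis .
  qed
  have "2 * (\<integral>\<^sup>+y. indicator unit_disc y *
      (\<integral>\<^sup>+t. F (exp (-t) *\<^sub>R (y /\<^sub>R norm y)) * ennreal (exp (- (2 * t))) \<partial>lborel) \<partial>lborel)
     = 2 * (\<integral>\<^sup>+y. (\<integral>\<^sup>+t. indicator unit_disc y * (F (exp (-t) *\<^sub>R y) * ennreal (exp (- (2 * t)) * (norm y)\<^sup>2)) \<partial>lborel) \<partial>lborel)"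
    by (intro arg_cong[where f = "\<lambda>x. 2 * x"] nn_integral_lborel_cong_except[where a = 0])
       (simp add: 1[simplified] nn_integral_cmult)
  also have "\<dots> = 2 * (\<integral>\<^sup>+t. (\<integral>\<^sup>+y. indicator unit_disc y * (F (exp (-t) *\<^sub>R y) * ennreal (exp (- (2 * t)) * (norm y)\<^sup>2)) \<partial>lborel) \<partial>lborel)"
    by (subst lborel_pair.Fubini') auto
  \<comment> \<open>For fixed \<open>t\<close> the substitution z = exp (- t) y turns the disc into
    the ball of radius exp (- t). Undoing the Tonelli swap leaves, for fixed z, an elementary
    integral over t < - ln |z|.\<close>
  also have "\<dots> = 2 * (\<integral>\<^sup>+t. (\<integral>\<^sup>+z. indicator {z. norm z < exp (-t)} z * (F z * ennreal ((norm z)\<^sup>2)) * ennreal (exp (2 * t)) \<partial>lborel) \<partial>lborel)"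
  proof (rule arg_cong[where f = "\<lambda>x. 2 * x"], rule nn_integral_cong)
    fix t :: real
    have "(\<integral>\<^sup>+z. indicator {z. norm z < exp (-t)} z * (F z * ennreal ((norm z)\<^sup>2)) * ennreal (exp (2 * t)) \<partial>lborel)
      = (\<integral>\<^sup>+y. (indicator {z. norm z < exp (-t)} (exp (-t) *\<^sub>R y) * (F (exp (-t) *\<^sub>R y) * ennreal ((norm (exp (-t) *\<^sub>R y))\<^sup>2)) * ennreal (exp (2 * t))) * ennreal (exp (-t) ^ 2) \<partial>lborel)"
      by (subst nn_integral_lborel_scale[where c = "exp (-t)", symmetric]) (auto simp: nn_integral_multc)
    also have "\<dots> = (\<integral>\<^sup>+y. indicator unit_disc y * (F (exp (-t) *\<^sub>R y) * ennreal (exp (- (2 * t)) * (norm y)\<^sup>2)) \<partial>lborel)"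
    proof (intro nn_integral_cong)
      fix y :: "real^2"
      have a: "ennreal ((norm (exp (-t) *\<^sub>R y))\<^sup>2) * ennreal (exp (2 * t)) * ennreal (exp (-t) ^ 2) = ennreal (exp (- (2 * t)) * (norm y)\<^sup>2)"
        by (simp add: power_mult_distrib power2_eq_square flip: ennreal_mult exp_add)
      have "indicator {z. norm z < exp (-t)} (exp (-t) *\<^sub>R y) = (indicator unit_disc y :: ennreal)"
        by (auto split: split_indicator)
      then show "(indicator {z. norm z < exp (-t)} (exp (-t) *\<^sub>R y) * (F (exp (-t) *\<^sub>R y) * ennreal ((norm (exp (-t) *\<^sub>R y))\<^sup>2)) * ennreal (exp (2 * t))) * ennreal (exp (-t) ^ 2)
        = indicator unit_disc y * (F (exp (-t) *\<^sub>R y) * ennreal (exp (- (2 * t)) * (norm y)\<^sup>2))"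
        by (simp add: a[symmetric] mult.assoc del: norm_scaleR)
    qed
    finally show "(\<integral>\<^sup>+y. indicator unit_disc y * (F (exp (-t) *\<^sub>R y) * ennreal (exp (- (2 * t)) * (norm y)\<^sup>2)) \<partial>lborel)
      = (\<integral>\<^sup>+z. indicator {z. norm z < exp (-t)} z * (F z * ennreal ((norm z)\<^sup>2)) * ennreal (exp (2 * t)) \<partial>lborel)" ..
  qed
  also have "\<dots> = 2 * (\<integral>\<^sup>+z. (\<integral>\<^sup>+t. indicator {z. norm z < exp (-t)} z * (F z * ennreal ((norm z)\<^sup>2)) * ennreal (exp (2 * t)) \<partial>lborel) \<partial>lborel)"
    by (subst lborel_pair.Fubini') auto
  also have "\<dots> = 2 * (\<integral>\<^sup>+z. F z * ennreal (1/2) \<partial>lborel)"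
  proof (intro arg_cong[where f = "\<lambda>x. 2 * x"] nn_integral_lborel_cong_except[where a = 0])
    fix z :: "real^2" assume z: "z \<noteq> 0"
    have "norm z < exp (-t) \<longleftrightarrow> t < - ln (norm z)" for t
      using z by (metis exp_less_cancel_iff exp_ln less_minus_iff zero_less_norm_iff)
    then have "(\<integral>\<^sup>+t. indicator {z. norm z < exp (-t)} z * (F z * ennreal ((norm z)\<^sup>2)) * ennreal (exp (2 * t)) \<partial>lborel)
       = (\<integral>\<^sup>+t. F z * ennreal ((norm z)\<^sup>2) * (indicator {..< - ln (norm z)} t * ennreal (exp (2 * t))) \<partial>lborel)"
      by (intro nn_integral_cong) (auto split: split_indicator)
    also have "\<dots> = F z * (ennreal ((norm z)\<^sup>2) * ennreal (exp (2 * (- ln (norm z))) / 2))"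
      by (subst nn_integral_cmult) (auto simp: nn_integral_exp_lessThan mult.assoc)
    \<comment> \<open>The remaining integral equals 1/2 for every \<open>z\<close>, which is where
      the factor 2 of the statement comes from.\<close>
    also have "ennreal ((norm z)\<^sup>2) * ennreal (exp (2 * (- ln (norm z))) / 2) = ennreal (1/2)"
    proof -
      have "exp (2 * (- ln (norm z))) = (exp (- ln (norm z)))\<^sup>2"
        by (simp add: power2_eq_square flip: exp_add)
      also have "\<dots> = (inverse (norm z))\<^sup>2" using z by (simp add: exp_minus)
      finally show ?thesis using z by (simp add: field_simps flip: ennreal_mult)
    qed
    finally show "(\<integral>\<^sup>+t. indicator {z. norm z < exp (-t)} z * (F z * ennreal ((norm z)\<^sup>2)) * ennreal (exp (2 * t)) \<partial>lborel) = F z * ennreal (1/2)" .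
  qed
  also have "\<dots> = 2 * ennreal (1/2) * (\<integral>\<^sup>+z. F z \<partial>lborel)"
    by (subst nn_integral_multc) (auto simp: ac_simps)
  also have "2 * ennreal (1/2) = 1"
  proof -
    have "2 * ennreal (1/2) = ennreal 2 * ennreal (1/2)" by simp
    also have "\<dots> = ennreal (2 * (1/2))" by (rule ennreal_mult[symmetric]) auto
    finally show ?thesis by simp
  qed
  finally show ?thesis by simp
qed

lemma emeasure_ball_plane:
  "r \<ge> 0 \<Longrightarrow> emeasure lborel (ball (a::real^2) r) = ennreal (pi * r\<^sup>2)"
  by (simp add: emeasure_ball unit_ball_vol_2)

lemma nn_integral_radial:
  fixes h :: "real \<Rightarrow> ennreal"
  assumes [measurable]: "h \<in> borel_measurable borel"
  shows "(\<integral>\<^sup>+z. h (norm (z::real^2)) \<partial>lborel) = ennreal (2 * pi) * (\<integral>\<^sup>+t. h (exp (-t)) * ennreal (exp (- (2 * t))) \<partial>lborel)"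
proof -
  have "(\<integral>\<^sup>+z. h (norm (z::real^2)) \<partial>lborel) = 2 * (\<integral>\<^sup>+y. indicator unit_disc (y::real^2) *
      (\<integral>\<^sup>+t. h (exp (-t)) * ennreal (exp (- (2 * t))) \<partial>lborel) \<partial>lborel)"
    by (subst log_polar, measurable, intro arg_cong[where f = "\<lambda>x. 2 * x"] nn_integral_lborel_cong_except[where a = 0])
       (simp add: mult.assoc)
  also have "\<dots> = 2 * (emeasure lborel unit_disc * (\<integral>\<^sup>+t. h (exp (-t)) * ennreal (exp (- (2 * t))) \<partial>lborel))"
    by (subst nn_integral_multc) (simp_all add: ball_borel)
  also have "\<dots> = ennreal (2 * pi) * (\<integral>\<^sup>+t. h (exp (-t)) * ennreal (exp (- (2 * t))) \<partial>lborel)"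
    by (simp add: emeasure_ball_plane ennreal_mult mult.assoc)
  finally show ?thesis .
qed

lemma nn_integral_inverse_norm_ball:
  assumes "R > 0"
  shows "(\<integral>\<^sup>+z. indicator (ball x R) (z::real^2) * ennreal (1 / norm (z - x)) \<partial>lborel) = ennreal (2 * pi * R)"
proof -
  have "(\<integral>\<^sup>+z. indicator (ball x R) (z::real^2) * ennreal (1 / norm (z - x)) \<partial>lborel)
    = (\<integral>\<^sup>+z. indicator (ball x R) (x + z) * ennreal (1 / norm (x + z - x)) \<partial>lborel)"
    by (rule nn_integral_lborel_translate[symmetric]) measurable
  also have "\<dots> = (\<integral>\<^sup>+z. indicator {..<R} (norm z) * ennreal (1 / norm (z::real^2)) \<partial>lborel)"
    by (intro nn_integral_cong) (auto split: split_indicator simp: dist_norm)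
  also have "\<dots> = ennreal (2 * pi) * (\<integral>\<^sup>+t. indicator {..<R} (exp (-t)) * ennreal (1 / exp (-t)) * ennreal (exp (- (2 * t))) \<partial>lborel)"
    by (rule nn_integral_radial) simp
  also have "(\<integral>\<^sup>+t. indicator {..<R} (exp (-t)) * ennreal (1 / exp (-t)) * ennreal (exp (- (2 * t))) \<partial>lborel)
     = (\<integral>\<^sup>+t. indicator {- ln R<..} t * ennreal (exp (- (1 * t))) \<partial>lborel)"
  proof (intro nn_integral_cong)
    fix t :: real
    have "exp (-t) < R \<longleftrightarrow> - ln R < t"
      using assms by (metis exp_less_cancel_iff exp_ln minus_less_iff)
    moreover have "1 / exp (-t) * exp (- (2 * t)) = exp (-t)"
      by (simp add: exp_minus field_simps power2_eq_square flip: exp_add)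
    ultimately show "indicator {..<R} (exp (-t)) * ennreal (1 / exp (-t)) * ennreal (exp (- (2 * t))) =
        indicator {- ln R<..} t * ennreal (exp (- (1 * t)))"
      by (auto split: split_indicator simp flip: ennreal_mult)
  qed
  also have "\<dots> = ennreal R"
    using assms by (subst nn_integral_exp_greaterThan) auto
  finally show ?thesis using assms by (simp flip: ennreal_mult)
qed

text \<open>In the logarithmic variable the density 1 / |z|^2 becomes the constant one, so only the
  length of the interval from - ln b to - ln a is left.\<close>

lemma nn_integral_inverse_norm_square_annulus:
  assumes "0 < a" "a \<le> b"
  shows "(\<integral>\<^sup>+z. indicator (ball x b - ball x a) (z::real^2) * ennreal (1 / (norm (z - x))\<^sup>2) \<partial>lborel)
    = ennreal (2 * pi * ln (b / a))"
proof -
  have "(\<integral>\<^sup>+z. indicator (ball x b - ball x a) (z::real^2) * ennreal (1 / (norm (z - x))\<^sup>2) \<partial>lborel)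
    = (\<integral>\<^sup>+z. indicator (ball x b - ball x a) (x + z) * ennreal (1 / (norm (x + z - x))\<^sup>2) \<partial>lborel)"
    by (rule nn_integral_lborel_translate[symmetric]) measurable
  also have "\<dots> = (\<integral>\<^sup>+z. indicator {a..<b} (norm z) * ennreal (1 / (norm (z::real^2))\<^sup>2) \<partial>lborel)"
    by (intro nn_integral_cong) (auto split: split_indicator simp: dist_norm)
  also have "\<dots> = ennreal (2 * pi) * (\<integral>\<^sup>+t. indicator {a..<b} (exp (-t)) * ennreal (1 / (exp (-t))\<^sup>2) * ennreal (exp (- (2 * t))) \<partial>lborel)"
    by (rule nn_integral_radial) simp
  also have "(\<integral>\<^sup>+t. indicator {a..<b} (exp (-t)) * ennreal (1 / (exp (-t))\<^sup>2) * ennreal (exp (- (2 * t))) \<partial>lborel)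
     = (\<integral>\<^sup>+t. indicator {- ln b<..- ln a} t \<partial>lborel)"
  proof (intro nn_integral_cong)
    fix t :: real
    have "exp (-t) < b \<longleftrightarrow> - ln b < t"
      using assms by (metis exp_less_cancel_iff exp_ln minus_less_iff less_le_trans)
    moreover have "a \<le> exp (-t) \<longleftrightarrow> t \<le> - ln a"
      using assms by (metis exp_le_cancel_iff exp_ln le_minus_iff)
    moreover have "1 / (exp (-t))\<^sup>2 * exp (- (2 * t)) = 1"
      by (simp add: power2_eq_square flip: exp_add)
    ultimately show "indicator {a..<b} (exp (-t)) * ennreal (1 / (exp (-t))\<^sup>2) * ennreal (exp (- (2 * t))) =
        indicator {- ln b<..- ln a} t"
      by (auto split: split_indicator simp flip: ennreal_mult)
  qed
  also have "\<dots> = ennreal (ln (b / a))"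
    using assms by (simp add: ln_div)
  finally show ?thesis using assms by (simp flip: ennreal_mult)
qed

text \<open>A rearrangement inequality without rearrangement: R = exp (- T) is the radius of the
  disc with the area of \<open>E\<close>. At distance R or more from \<open>x\<close>, - ln |z - x|
  is at most T. Closer than that, ln s \<le> s bounds the excess by R / |z - x|, whose integral over
  the disc of radius R is 2 pi R^2, twice the measure of \<open>E\<close>. This is the 2 in the
  bound, which is uniform in the centre \<open>x\<close>.\<close>

lemma nn_integral_log_le:
  fixes E :: "(real^2) set"
  assumes [measurable]: "E \<in> sets borel" and E: "emeasure lborel E = ennreal (pi * exp (- (2 * T)))"
    and T: "T \<ge> 0" "c \<ge> 0"
  shows "(\<integral>\<^sup>+z. indicator E z * ennreal (- ln (norm (z - x)) + c) \<partial>lborel) \<le> emeasure lborel E * ennreal (T + c + 2)"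
proof -
  define R where "R = exp (-T)"
  have R: "R > 0" by (simp add: R_def)
  have "(\<integral>\<^sup>+z. indicator E z * ennreal (- ln (norm (z - x)) + c) \<partial>lborel)
    \<le> (\<integral>\<^sup>+z. indicator E z * ennreal (T + c) + ennreal R * (indicator (ball x R) z * ennreal (1 / norm (z - x))) \<partial>lborel)"
  proof (intro nn_integral_mono)
    fix z :: "real^2"
    define d where "d = norm (z - x)"
    have "- ln d + c \<le> T + c + indicator {..<R} d * (R * (1 / d))"
    proof (cases "d > 0")
      case True
      have "- ln d = T + ln (R / d)" using True R by (simp add: ln_div R_def)
      moreover have "ln (R / d) \<le> indicator {..<R} d * (R * (1 / d))"
      proof (cases "d < R")
        case True
        then show ?thesis using \<open>d > 0\<close> R ln_le_minus_one[of "R / d"] by simp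
      next
        case False
        then show ?thesis using \<open>d > 0\<close> R by simp
      qed
      ultimately show ?thesis by simp
    next
      case False
      then have "d = 0" by (simp add: d_def)
      then show ?thesis using T R by simp
    qed
    then have "ennreal (- ln d + c) \<le> ennreal (T + c + indicator {..<R} d * (R * (1 / d)))"
      by (rule ennreal_leI)
    also have "\<dots> = ennreal (T + c) + ennreal R * (indicator (ball x R) z * ennreal (1 / d))"
    proof -
      have "d \<ge> 0" by (simp add: d_def)
      then show ?thesis using T R
        by (auto simp: d_def dist_norm norm_minus_commute split: split_indicator simp flip: ennreal_mult ennreal_plus)
    qed
    finally show "indicator E z * ennreal (- ln (norm (z - x)) + c)
       \<le> indicator E z * ennreal (T + c) + ennreal R * (indicator (ball x R) z * ennreal (1 / norm (z - x)))"
      by (auto simp: d_def split: split_indicator)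
  qed
  also have "\<dots> = emeasure lborel E * ennreal (T + c) + ennreal R * ennreal (2 * pi * R)"
    by (subst nn_integral_add, measurable, subst nn_integral_cmult, measurable)
       (simp add: nn_integral_multc nn_integral_inverse_norm_ball R)
  also have "ennreal R * ennreal (2 * pi * R) = emeasure lborel E * 2"
  proof -
    have "R * (2 * pi * R) = pi * exp (- (2 * T)) * 2"
      by (simp add: R_def flip: exp_add)
    then show ?thesis using R by (simp add: E ennreal_mult'[symmetric] flip: ennreal_numeral)
  qed
  also have "emeasure lborel E * ennreal (T + c) + emeasure lborel E * 2 = emeasure lborel E * ennreal (T + c + 2)"
    using T by (simp add: distrib_left)
  finally show ?thesis .
qed

section \<open>An exponential bound from Gram matrices of kernels\<close>

text \<open>At most \<open>l\<close> elements lie below \<open>l\<close>. If m is the least of the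
  others and n is another, then sqrt n - sqrt m \<le> 2 sqrt l because m \<ge> l, so that n = m + 2
  sqrt m (sqrt n - sqrt m) + (sqrt n - sqrt m)^2 \<le> m + 8 l. This makes at most 9 l + 1
  elements.\<close>

lemma card_spread_out_le:
  fixes A :: "nat set" and l :: nat
  assumes fin: "finite A" and l: "l > 0"
    and A: "\<And>m n. m \<in> A \<Longrightarrow> n \<in> A \<Longrightarrow> sqrt m * (sqrt n - sqrt m) \<le> 2 * real l"
  shows "card A \<le> 10 * l"
proof -
  define A1 where "A1 = A \<inter> {l..}"
  have "card A1 \<le> 8 * l + 1"
  proof (cases "A1 = {}")
    case False
    have fin1: "finite A1" using fin by (simp add: A1_def)
    define m where "m = Min A1"
    have m: "m \<in> A1" unfolding m_def using fin1 False by (rule Min_in)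
    have "A1 \<subseteq> {m..m + 8 * l}"
    proof
      fix n assume n: "n \<in> A1"
      have mn: "m \<le> n" unfolding m_def using fin1 n by (rule Min_le)
      define r s where "r = sqrt m" and "s = sqrt n"
      have r: "r > 0" "r\<^sup>2 = m" "r\<^sup>2 \<ge> l" using m l by (auto simp: r_def A1_def)
      have s: "s \<ge> r" "s\<^sup>2 = n" using mn by (auto simp: r_def s_def)
      have 1: "r * (s - r) \<le> 2 * l" using A[of m n] m n by (auto simp: r_def s_def A1_def)
      have "l * (s - r)\<^sup>2 \<le> r\<^sup>2 * (s - r)\<^sup>2" by (intro mult_right_mono r) auto
      also have "\<dots> = (r * (s - r))\<^sup>2" by (simp add: power_mult_distrib)
      also have "\<dots> \<le> (2 * real l)\<^sup>2" using 1 r s by (intro power_mono mult_nonneg_nonneg) auto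
      also have "\<dots> = l * (4 * l)" by (simp add: power2_eq_square)
      finally have 2: "(s - r)\<^sup>2 \<le> 4 * l" using l by simp
      have "real n = m + 2 * (r * (s - r)) + (s - r)\<^sup>2"
        unfolding r(2)[symmetric] s(2)[symmetric] by (simp add: power2_eq_square algebra_simps)
      also have "\<dots> \<le> m + 8 * l" using 1 2 by simp
      finally show "n \<in> {m..m + 8 * l}" using mn by simp
    qed
    then have "card A1 \<le> card {m..m + 8 * l}" by (rule card_mono[rotated]) simp
    then show ?thesis by simp
  qed simp
  moreover have "card A \<le> card ({..<l} \<union> A1)"
    using fin by (intro card_mono) (auto simp: A1_def)
  moreover have "card ({..<l} \<union> A1) \<le> card {..<l} + card A1" by (rule card_Un_le)
  ultimately show ?thesis using l by simp
qed

text \<open>With \<open>T n = - ln (e n / pi) / 2\<close>, the hypothesis says that the \<open>n\<close> with \<open>T n \<le> n + \<lambda>\<close> are spread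
  over a set of size linear in \<open>\<lambda>\<close>; summing over the integer part of \<open>T n - n\<close> gives the bound.\<close>

lemma sum_critical_levels_le:
  fixes e :: "nat \<Rightarrow> real"
  assumes e: "\<And>n. e n \<ge> 0"
    and ineq: "\<And>m n. e m > 0 \<Longrightarrow> e n > 0 \<Longrightarrow>
      (sqrt m + sqrt n)\<^sup>2 \<le> 3 * (- ln (e m / pi) / 2) - ln (e n / pi) / 2 + 4 * C"
  shows "(\<Sum>n<N. e n * exp (2 * real n)) \<le> pi * exp (2 * C) * 10 * (\<Sum>j. exp (-1) ^ j)"
proof -
  define a where "a n = - ln (e n / pi) / 2 - real n" for n
  define j where "j n = nat \<lfloor>a n + C\<rfloor>" for n
  define P where "P = {n. n < N \<and> e n > 0}"
  have fin: "finite P" by (simp add: P_def)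
  \<comment> \<open>The diagonal case m = n of the hypothesis says that no deficit is below - C, so
    \<open>j\<close> loses nothing in the conversion to a natural number.\<close>
  have a_ge: "a n + C \<ge> 0" if "n \<in> P" for n
  proof -
    have "(sqrt n + sqrt n)\<^sup>2 = 4 * real n" by (simp add: power_mult_distrib flip: mult_2)
    then show ?thesis using ineq[of n n] that by (simp add: a_def P_def)
  qed
  have j_le: "real (j n) \<le> a n + C" "a n + C < real (j n) + 1" if "n \<in> P" for n
    using a_ge[OF that] unfolding j_def by linarith+
  have bnd: "e n * exp (2 * real n) \<le> pi * exp (2 * C) * exp (- 2 * real (j n))" if n: "n \<in> P" for n
  proof -
    have "e n = pi * exp (ln (e n / pi))" using n by (simp add: P_def)
    also have "ln (e n / pi) = - 2 * a n - 2 * n" by (simp add: a_def)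
    finally have "e n * exp (2 * real n) = pi * exp (- 2 * a n)"
      by (simp add: exp_diff)
    also have "\<dots> \<le> pi * exp (2 * C - 2 * real (j n))" using j_le[OF n] by simp
    finally show ?thesis by (simp add: exp_diff exp_minus field_simps)
  qed
  \<comment> \<open>If m and n have the same value i of \<open>j\<close>, then \<open>a m\<close>
    and \<open>a n\<close> are below i + 1 - C. The constants C cancel, and what remains is the
    hypothesis of \<open>card_spread_out_le\<close> with l = i + 1.\<close>
  have card: "card {n \<in> P. j n = i} \<le> 10 * Suc i" for i
  proof (rule card_spread_out_le)
    fix m n assume m: "m \<in> {n \<in> P. j n = i}" and n: "n \<in> {n \<in> P. j n = i}"
    have "(sqrt m + sqrt n)\<^sup>2 \<le> 3 * (a m + m) + (a n + n) + 4 * C"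
      using ineq[of m n] m n by (simp add: a_def P_def)
    also have "\<dots> \<le> 3 * m + n + 4 * (1 + i)"
      using j_le[of m] j_le[of n] m n by simp
    finally show "sqrt m * (sqrt n - sqrt m) \<le> 2 * real (Suc i)"
      by (simp add: power2_eq_square algebra_simps)
  qed (use fin in auto)
  have sm: "summable (\<lambda>j. exp (-1::real) ^ j)" by (rule summable_geometric) simp
  have "(\<Sum>n<N. e n * exp (2 * real n)) = (\<Sum>n\<in>P. e n * exp (2 * real n))"
    using e by (intro sum.mono_neutral_right) (auto simp: P_def order.order_iff_strict)
  also have "\<dots> \<le> (\<Sum>n\<in>P. pi * exp (2 * C) * exp (- 2 * real (j n)))"
    by (intro sum_mono bnd)
  also have "\<dots> = (\<Sum>i\<in>j ` P. \<Sum>n\<in>{n \<in> P. j n = i}. pi * exp (2 * C) * exp (- 2 * real (j n)))"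
    by (rule sum.image_gen[OF fin])
  also have "\<dots> = (\<Sum>i\<in>j ` P. card {n \<in> P. j n = i} * (pi * exp (2 * C) * exp (- 2 * real i)))"
    by (intro sum.cong refl) simp
  also have "\<dots> \<le> (\<Sum>i\<in>j ` P. pi * exp (2 * C) * 10 * exp (-1) ^ i)"
  proof (intro sum_mono)
    fix i
    \<comment> \<open>The linear count is absorbed by the decay exp (- 2 i) of the terms: 1 + i
      \<le> exp i leaves a geometric series with ratio exp (- 1).\<close>
    have "real (card {n \<in> P. j n = i}) \<le> 10 * exp (real i)"
    proof -
      have "real (card {n \<in> P. j n = i}) \<le> real (10 * Suc i)"
        using card[of i] by (simp only: of_nat_le_iff)
      moreover have "10 * (1 + real i) \<le> 10 * exp (real i)" by (intro mult_left_mono exp_ge_add_one_self) auto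
      ultimately show ?thesis by simp
    qed
    then have "card {n \<in> P. j n = i} * (pi * exp (2 * C) * exp (- 2 * real i))
      \<le> 10 * exp (real i) * (pi * exp (2 * C) * exp (- 2 * real i))"
      by (intro mult_right_mono) auto
    also have "\<dots> = pi * exp (2 * C) * 10 * (exp (real i) * exp (- 2 * real i))" by simp
    also have "exp (real i) * exp (- 2 * real i) = exp (- 1) ^ i"
      by (simp flip: exp_add exp_of_nat_mult)
    finally show "card {n \<in> P. j n = i} * (pi * exp (2 * C) * exp (- 2 * real i)) \<le> pi * exp (2 * C) * 10 * exp (-1) ^ i" .
  qed
  also have "\<dots> = pi * exp (2 * C) * 10 * (\<Sum>i\<in>j ` P. exp (-1) ^ i)"
    by (simp add: sum_distrib_left)
  also have "\<dots> \<le> pi * exp (2 * C) * 10 * (\<Sum>j. exp (-1) ^ j)"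
    using fin by (intro mult_left_mono sum_le_suminf[OF sm]) auto
  finally show ?thesis .
qed

text \<open>The summand pi pays for the points where \<open>u\<close> vanishes and the factor exp 2
  for rounding \<open>c * (u x)\<^sup>2\<close> up to an integer; the rest is the bound of
  \<open>sum_critical_levels_le\<close>.\<close>

definition critical_const :: "real \<Rightarrow> real" where
  "critical_const C = pi + exp 2 * (pi * exp (2 * C) * 10 * (\<Sum>j. exp (-1) ^ j))"

text \<open>The averages of \<open>k\<close> over two superlevel sets \<open>E\<close> and \<open>F\<close> have inner products controlled by
  \<open>gram\<close>, and each has inner product at least its level with \<open>f\<close>. Testing the sum of the two averages
  against \<open>f\<close> yields the inequality between levels and measures required above.\<close>

lemma critical_exp_integral_le:
  fixes u :: "real^2 \<Rightarrow> real" and k :: "real^2 \<Rightarrow> real^2 \<Rightarrow> ennreal" and f :: "real^2 \<Rightarrow> ennreal"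
  assumes u [measurable]: "u \<in> borel_measurable borel" and u0: "\<And>x. u x \<ge> 0"
    and k [measurable]: "(\<lambda>(x, y). k x y) \<in> borel_measurable (borel \<Otimes>\<^sub>M borel)"
    and f [measurable]: "f \<in> borel_measurable borel" and f1: "(\<integral>\<^sup>+y. (f y)\<^sup>2 \<partial>lborel) \<le> 1"
    and c: "c > 0"
    and rep: "\<And>\<tau> E. \<tau> \<ge> 0 \<Longrightarrow> E = {x \<in> unit_disc. u x > \<tau>} \<Longrightarrow>
      (\<integral>\<^sup>+x. indicator E x * ennreal (u x) \<partial>lborel)
        \<le> (\<integral>\<^sup>+y. (\<integral>\<^sup>+x. indicator E x * k x y \<partial>lborel) * f y \<partial>lborel)"
    and gram: "\<And>E F T. E \<in> sets borel \<Longrightarrow> F \<in> sets borel \<Longrightarrow> E \<subseteq> unit_disc \<Longrightarrow> F \<subseteq> unit_disc \<Longrightarrow>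
      T \<ge> 0 \<Longrightarrow> emeasure lborel E = ennreal (pi * exp (- (2 * T))) \<Longrightarrow>
      (\<integral>\<^sup>+y. (\<integral>\<^sup>+x. indicator E x * k x y \<partial>lborel) * (\<integral>\<^sup>+x. indicator F x * k x y \<partial>lborel) \<partial>lborel)
        \<le> emeasure lborel E * emeasure lborel F * ennreal ((T + C) / c)"
    and C: "C \<ge> 0"
  shows "(\<integral>\<^sup>+x. indicator unit_disc x * ennreal (exp (2 * c * (u x)\<^sup>2)) \<partial>lborel) \<le> ennreal (critical_const C)"
proof -
  define E where "E n = {x \<in> unit_disc. u x > sqrt (real n / c)}" for n :: nat
  have E_sets [measurable]: "E n \<in> sets borel" for n unfolding E_def by measurable
  have E_sub: "E n \<subseteq> unit_disc" for n by (auto simp: E_def)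
  have E_le: "emeasure lborel (E n) \<le> ennreal pi" for n
    using emeasure_mono[OF E_sub[of n], of lborel] by (simp add: emeasure_ball_plane)
  define e where "e n = measure lborel (E n)" for n
  have e: "emeasure lborel (E n) = ennreal (e n)" for n
    unfolding e_def using E_le[of n] by (intro emeasure_eq_ennreal_measure) (auto simp: top_unique)
  have e0: "e n \<ge> 0" for n by (simp add: e_def)
  have epi: "e n \<le> pi" for n using E_le[of n] by (simp add: e)
  have ineq: "(sqrt m + sqrt n)\<^sup>2 \<le> 3 * (- ln (e m / pi) / 2) - ln (e n / pi) / 2 + 4 * C"
    if m: "e m > 0" and n: "e n > 0" for m n
  proof -
    define T where "T n = - ln (e n / pi) / 2" for n
    have T0: "T i \<ge> 0" if "e i > 0" for i using epi[of i] that by (simp add: T_def)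
    have eT: "emeasure lborel (E i) = ennreal (pi * exp (- (2 * T i)))" if "e i > 0" for i
      using that by (simp add: e T_def)
    \<comment> \<open>The average of the kernel over \<open>E i\<close>. Dividing by the measure
      turns \<open>gram\<close> into a bound by the logarithmic size \<open>T i\<close> alone and
      \<open>rep\<close> into a bound for the level.\<close>
    define K where "K i y = (\<integral>\<^sup>+x. indicator (E i) x * k x y \<partial>lborel) * ennreal (1 / e i)" for i y
    have K_meas [measurable]: "K i \<in> borel_measurable borel" for i
      unfolding K_def by measurable
    have G: "(\<integral>\<^sup>+y. K i y * K j y \<partial>lborel) \<le> ennreal ((T i + C) / c)" if "e i > 0" "e j > 0" for i j
    proof -
      have "(\<integral>\<^sup>+y. K i y * K j y \<partial>lborel) = (\<integral>\<^sup>+y. ((\<integral>\<^sup>+x. indicator (E i) x * k x y \<partial>lborel) * (\<integral>\<^sup>+x. indicator (E j) x * k x y \<partial>lborel)) * (ennreal (1 / e i) * ennreal (1 / e j)) \<partial>lborel)"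
        by (intro nn_integral_cong) (simp add: K_def ac_simps)
      also have "\<dots> = (\<integral>\<^sup>+y. (\<integral>\<^sup>+x. indicator (E i) x * k x y \<partial>lborel) * (\<integral>\<^sup>+x. indicator (E j) x * k x y \<partial>lborel) \<partial>lborel) * (ennreal (1 / e i) * ennreal (1 / e j))"
        by (intro nn_integral_multc) measurable
      also have "\<dots> \<le> (ennreal (e i) * ennreal (e j) * ennreal ((T i + C) / c)) * (ennreal (1 / e i) * ennreal (1 / e j))"
        using gram[of "E i" "E j" "T i", OF _ _ E_sub E_sub T0[OF that(1)] eT[OF that(1)]] unfolding e
        by (intro mult_right_mono) auto
      also have "\<dots> = ennreal ((T i + C) / c)"
        using that T0[of i] C c by (simp flip: ennreal_mult)
      finally show ?thesis .
    qed
    have lev: "ennreal (sqrt (real i / c)) \<le> (\<integral>\<^sup>+y. K i y * f y \<partial>lborel)" if "e i > 0" for i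
    proof -
      have "ennreal (e i) * ennreal (sqrt (real i / c)) = (\<integral>\<^sup>+x. indicator (E i) x * ennreal (sqrt (real i / c)) \<partial>lborel)"
        by (subst nn_integral_multc) (auto simp: e)
      also have "\<dots> \<le> (\<integral>\<^sup>+x. indicator (E i) x * ennreal (u x) \<partial>lborel)"
        by (intro nn_integral_mono) (auto simp: E_def split: split_indicator intro!: ennreal_leI)
      also have "\<dots> \<le> (\<integral>\<^sup>+y. (\<integral>\<^sup>+x. indicator (E i) x * k x y \<partial>lborel) * f y \<partial>lborel)"
        using c by (intro rep[of "sqrt (real i / c)"]) (auto simp: E_def)
      finally have "ennreal (1 / e i) * (ennreal (e i) * ennreal (sqrt (real i / c)))
         \<le> ennreal (1 / e i) * (\<integral>\<^sup>+y. (\<integral>\<^sup>+x. indicator (E i) x * k x y \<partial>lborel) * f y \<partial>lborel)"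
        by (intro mult_left_mono) auto
      also have "\<dots> = (\<integral>\<^sup>+y. K i y * f y \<partial>lborel)"
        by (subst nn_integral_cmult[symmetric], measurable, intro nn_integral_cong) (simp add: K_def ac_simps)
      also have "ennreal (1 / e i) * (ennreal (e i) * ennreal (sqrt (real i / c))) = ennreal (sqrt (real i / c))"
        using that c by (simp flip: ennreal_mult)
      finally show ?thesis .
    qed
    have "ennreal ((sqrt (real m / c) + sqrt (real n / c))\<^sup>2) = (ennreal (sqrt (real m / c)) + ennreal (sqrt (real n / c)))\<^sup>2"
      using c by (simp add: ennreal_power flip: ennreal_plus)
    also have "\<dots> \<le> (\<integral>\<^sup>+y. (K m y + K n y) * f y \<partial>lborel)\<^sup>2"
      using add_mono[OF lev[OF m] lev[OF n]]
      by (intro power_mono) (simp_all add: distrib_right nn_integral_add)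
    also have "\<dots> \<le> (\<integral>\<^sup>+y. (K m y + K n y)\<^sup>2 \<partial>lborel) * (\<integral>\<^sup>+y. (f y)\<^sup>2 \<partial>lborel)"
      by (rule Cauchy_Schwarz_nn_integral) measurable
    also have "\<dots> \<le> (\<integral>\<^sup>+y. (K m y + K n y)\<^sup>2 \<partial>lborel) * 1"
      by (intro mult_left_mono f1) auto
    also have "\<dots> = (\<integral>\<^sup>+y. K m y * K m y + K m y * K n y + K m y * K n y + K n y * K n y \<partial>lborel)"
      by (simp add: power2_eq_square algebra_simps)
    also have "\<dots> = (\<integral>\<^sup>+y. K m y * K m y \<partial>lborel) + (\<integral>\<^sup>+y. K m y * K n y \<partial>lborel)
        + (\<integral>\<^sup>+y. K m y * K n y \<partial>lborel) + (\<integral>\<^sup>+y. K n y * K n y \<partial>lborel)"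
      by (simp add: nn_integral_add)
    \<comment> \<open>Both mixed products are bounded through the same set \<open>E m\<close>, and
      the asymmetric sum 3 T m + T n is essential. With 2 T m + 2 T n the inequality would exclude
      no pair of levels, because 2 sqrt (m n) \<le> m + n anyway.\<close>
    also have "\<dots> \<le> ennreal ((T m + C) / c) + ennreal ((T m + C) / c) + ennreal ((T m + C) / c) + ennreal ((T n + C) / c)"
      using m n by (intro add_mono G)
    also have "\<dots> = ennreal ((3 * T m + T n + 4 * C) / c)"
      using T0[OF m] T0[OF n] C c by (simp add: field_simps flip: ennreal_plus)
    finally have "(sqrt (real m / c) + sqrt (real n / c))\<^sup>2 \<le> (3 * T m + T n + 4 * C) / c"
      using T0[OF m] T0[OF n] C c by (subst (asm) ennreal_le_iff) auto
    moreover have "(sqrt (real m / c) + sqrt (real n / c))\<^sup>2 = (sqrt m + sqrt n)\<^sup>2 / c"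
      using c by (simp add: real_sqrt_divide power_divide add_divide_distrib[symmetric])
    ultimately have "(sqrt m + sqrt n)\<^sup>2 \<le> 3 * T m + T n + 4 * C"
      using c by (simp add: divide_le_cancel)
    then show ?thesis by (simp add: T_def)
  qed
  have "(\<integral>\<^sup>+x. indicator unit_disc x * ennreal (exp (2 * c * (u x)\<^sup>2)) \<partial>lborel)
    \<le> (\<integral>\<^sup>+x. indicator unit_disc x + (\<Sum>n. indicator (E n) x * ennreal (exp (2 * real n + 2))) \<partial>lborel)"
  proof (intro nn_integral_mono)
    fix x
    show "indicator unit_disc x * ennreal (exp (2 * c * (u x)\<^sup>2))
      \<le> indicator unit_disc x + (\<Sum>n. indicator (E n) x * ennreal (exp (2 * real n + 2)))"
    proof (cases "x \<in> unit_disc")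
      case True
      define q where "q = c * (u x)\<^sup>2"
      show ?thesis
      proof (cases "q = 0")
        case True
        then show ?thesis using \<open>x \<in> unit_disc\<close> c by (simp add: q_def)
      next
        case False
        then have q: "q > 0" using c by (simp add: q_def)
        \<comment> \<open>The ceiling minus one rather than the floor, since \<open>E n\<close> is a
          strict superlevel set: n < q \<le> n + 1 holds also for integral q.\<close>
        define n where "n = nat (\<lceil>q\<rceil> - 1)"
        have n: "real n < q" "q \<le> real n + 1" unfolding n_def using q by linarith+
        have "real n / c < (u x)\<^sup>2" using n c by (simp add: q_def field_simps)
        then have "sqrt (real n / c) < u x" using u0[of x] real_less_lsqrt real_sqrt_less_iff
          by (metis real_sqrt_abs abs_of_nonneg)
        then have xE: "x \<in> E n" using True by (simp add: E_def)
        have "ennreal (exp (2 * q)) \<le> indicator (E n) x * ennreal (exp (2 * real n + 2))"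
          using xE n by (simp add: ennreal_leI)
        also have "\<dots> \<le> (\<Sum>n. indicator (E n) x * ennreal (exp (2 * real n + 2)))"
        proof -
          have "g n \<le> (\<Sum>n. g n)" for g :: "nat \<Rightarrow> ennreal"
            using sum_le_suminf[of g "{n}", OF summableI] by simp
          then show ?thesis by this
        qed
        finally show ?thesis using True by (simp add: q_def mult.assoc add_increasing)
      qed
    qed simp
  qed
  also have "\<dots> = ennreal pi + (\<Sum>n. ennreal (e n * exp (2 * real n + 2)))"
    using e0 by (simp add: nn_integral_add nn_integral_suminf nn_integral_multc emeasure_ball_plane e ennreal_mult)
  also have "(\<Sum>n. ennreal (e n * exp (2 * real n + 2))) \<le> ennreal (exp 2 * (pi * exp (2 * C) * 10 * (\<Sum>j. exp (-1) ^ j)))"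
  proof (rule suminf_le_const[OF summableI])
    fix N
    have "(\<Sum>n<N. ennreal (e n * exp (2 * real n + 2))) = ennreal (exp 2 * (\<Sum>n<N. e n * exp (2 * real n)))"
      using e0 by (simp add: sum_ennreal sum_distrib_left exp_add mult_ac)
    also have "\<dots> \<le> ennreal (exp 2 * (pi * exp (2 * C) * 10 * (\<Sum>j. exp (-1) ^ j)))"
      by (intro ennreal_leI mult_left_mono sum_critical_levels_le e0 ineq) auto
    finally show "(\<Sum>n<N. ennreal (e n * exp (2 * real n + 2))) \<le> ennreal (exp 2 * (pi * exp (2 * C) * 10 * (\<Sum>j. exp (-1) ^ j)))" .
  qed
  also have "ennreal pi + ennreal (exp 2 * (pi * exp (2 * C) * 10 * (\<Sum>j. exp (-1) ^ j))) = ennreal (critical_const C)"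
    unfolding critical_const_def
    by (rule ennreal_plus[symmetric]) (auto intro!: mult_nonneg_nonneg suminf_nonneg summable_geometric)
  finally show ?thesis by simp
qed

section \<open>Smooth functions\<close>

text \<open>\<open>Ck\<close> lives on the plane; this is its one-variable companion for the outer
  functions of compositions. \<open>ln\<close>, \<open>sqrt\<close> and \<open>inverse\<close> are
  smooth on part of the line only, hence the set. Derivatives at its points are two-sided, so it is
  meant to be open.\<close>

primrec Ck_on :: "nat \<Rightarrow> (real \<Rightarrow> real) \<Rightarrow> real set \<Rightarrow> bool" where
  "Ck_on 0 f S \<longleftrightarrow> continuous_on S f"
| "Ck_on (Suc k) f S \<longleftrightarrow> (\<forall>x\<in>S. f differentiable (at x)) \<and> Ck_on k (deriv f) S"

lemma Ck_on_cong:
  assumes "open S" "\<And>x. x \<in> S \<Longrightarrow> f x = g x" "Ck_on k f S"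
  shows "Ck_on k g S"
  using assms(2,3)
proof (induction k arbitrary: f g)
  case 0
  then show ?case by (simp cong: continuous_on_cong)
next
  case (Suc k)
  have ev: "\<forall>\<^sub>F y in nhds x. f y = g y" if "x \<in> S" for x
    using assms(1) Suc.prems(1) that by (auto simp: eventually_nhds)
  have "g differentiable (at x)" if "x \<in> S" for x
  proof -
    have "(f has_real_derivative deriv f x) (at x)"
      using Suc.prems(2) that by (simp add: DERIV_deriv_iff_real_differentiable)
    then have "(g has_real_derivative deriv f x) (at x)"
      using DERIV_cong_ev[OF refl ev[OF that] refl] by simp
    then show ?thesis by (auto simp: real_differentiable_def)
  qed
  moreover have "Ck_on k (deriv g) S"
    by (rule Suc.IH[of "deriv f"]) (use Suc.prems ev in \<open>auto intro!: deriv_cong_ev\<close>)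
  ultimately show ?case by simp
qed

lemma Ck_on_SucI:
  assumes "open S" "\<And>x. x \<in> S \<Longrightarrow> (f has_real_derivative f' x) (at x)" "Ck_on k f' S"
  shows "Ck_on (Suc k) f S"
proof -
  have "Ck_on k (deriv f) S"
    by (rule Ck_on_cong[OF assms(1) _ assms(3)]) (simp add: DERIV_imp_deriv[OF assms(2)])
  then show ?thesis using assms(2) by (auto simp: real_differentiable_def)
qed

lemma Ck_on_Suc_DERIV:
  "Ck_on (Suc k) f S \<Longrightarrow> x \<in> S \<Longrightarrow> (f has_real_derivative deriv f x) (at x)"
  by (simp add: DERIV_deriv_iff_real_differentiable)

lemma Ck_on_continuous_on: "Ck_on k f S \<Longrightarrow> continuous_on S f"
  by (cases k) (auto intro!: continuous_at_imp_continuous_on differentiable_imp_continuous_within)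

lemma Ck_on_Suc_imp: "Ck_on (Suc k) f S \<Longrightarrow> Ck_on k f S"
proof (induction k arbitrary: f)
  case 0
  then show ?case using Ck_on_continuous_on[of "Suc 0" f S] by simp
qed simp

lemma Ck_on_const: "open S \<Longrightarrow> Ck_on k (\<lambda>_. c) S"
  by (induction k arbitrary: c) (auto intro!: Ck_on_SucI[where f' = "\<lambda>_. 0"] simp del: Ck_on.simps(2))

lemma Ck_on_id: "open S \<Longrightarrow> Ck_on k (\<lambda>x. x) S"
  by (cases k) (auto intro!: Ck_on_SucI[where f' = "\<lambda>_. 1"] Ck_on_const simp del: Ck_on.simps(2))

lemma Ck_on_add:
  assumes "open S" "Ck_on k f S" "Ck_on k g S"
  shows "Ck_on k (\<lambda>x. f x + g x) S"
  using assms(2,3)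
proof (induction k arbitrary: f g)
  case 0
  then show ?case by (auto intro: continuous_intros)
next
  case (Suc k)
  show ?case
    by (rule Ck_on_SucI[OF assms(1), where f' = "\<lambda>x. deriv f x + deriv g x"])
       (use Suc Ck_on_Suc_DERIV in \<open>auto intro!: derivative_eq_intros simp: DERIV_deriv_iff_real_differentiable\<close>)
qed

lemma Ck_on_mult:
  assumes "open S" "Ck_on k f S" "Ck_on k g S"
  shows "Ck_on k (\<lambda>x. f x * g x) S"
  using assms(2,3)
proof (induction k arbitrary: f g)
  case 0
  then show ?case by (auto intro: continuous_intros)
next
  case (Suc k)
  note d = Ck_on_Suc_DERIV[OF Suc.prems(1)] Ck_on_Suc_DERIV[OF Suc.prems(2)]
  show ?case
  proof (rule Ck_on_SucI[OF assms(1), where f' = "\<lambda>x. deriv f x * g x + deriv g x * f x"])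
    show "((\<lambda>x. f x * g x) has_real_derivative deriv f x * g x + deriv g x * f x) (at x)" if "x \<in> S" for x
      using d[OF that] by (rule DERIV_mult)
    show "Ck_on k (\<lambda>x. deriv f x * g x + deriv g x * f x) S"
      using Suc.prems Ck_on_Suc_imp[of k f S] Ck_on_Suc_imp[of k g S]
      by (intro Ck_on_add[OF assms(1)] Suc.IH) auto
  qed
qed

lemma Ck_on_compose:
  assumes "open S" "open T" "Ck_on k f S" "Ck_on k g T" "\<And>x. x \<in> S \<Longrightarrow> f x \<in> T"
  shows "Ck_on k (\<lambda>x. g (f x)) S"
  using assms(3,4)
proof (induction k arbitrary: g)
  case 0
  then show ?case using assms(5) by (auto intro: continuous_on_compose2)
next
  case (Suc k)
  show ?case
  proof (rule Ck_on_SucI[OF assms(1), where f' = "\<lambda>x. deriv g (f x) * deriv f x"])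
    show "((\<lambda>x. g (f x)) has_real_derivative deriv g (f x) * deriv f x) (at x)" if "x \<in> S" for x
      using DERIV_chain2[OF Ck_on_Suc_DERIV[OF Suc.prems(2) assms(5)[OF that]] Ck_on_Suc_DERIV[OF Suc.prems(1) that]] .
    show "Ck_on k (\<lambda>x. deriv g (f x) * deriv f x) S"
      using Suc.prems Ck_on_Suc_imp[of k f S] by (intro Ck_on_mult[OF assms(1)] Suc.IH[of "deriv g"]) auto
  qed
qed

text \<open>Smoothness is local: this glues the profile of a bump from the regions where it is zero
  and the region where it is given by a formula.\<close>

lemma Ck_on_Un: "Ck_on k f S \<Longrightarrow> Ck_on k f T \<Longrightarrow> open S \<Longrightarrow> open T \<Longrightarrow> Ck_on k f (S \<union> T)"
  by (induction k arbitrary: f) (auto intro: continuous_on_open_Un)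

lemma Ck_on_exp: "open S \<Longrightarrow> Ck_on k exp S"
proof (induction k)
  case (Suc k)
  then show ?case by (intro Ck_on_SucI[where f' = exp]) (auto intro: DERIV_exp)
qed (auto intro!: continuous_intros)

lemma Ck_on_inverse:
  assumes "open S" "0 \<notin> S" shows "Ck_on k inverse S"
proof (induction k)
  case 0
  then show ?case using assms by (auto intro!: continuous_intros)
next
  case (Suc k)
  show ?case
  proof (rule Ck_on_SucI[OF assms(1), where f' = "\<lambda>x. (-1) * (inverse x * inverse x)"])
    show "(inverse has_real_derivative (-1) * (inverse x * inverse x)) (at x)" if "x \<in> S" for x
      using that assms by (intro derivative_eq_intros) (auto simp: power2_eq_square)
    show "Ck_on k (\<lambda>x. (-1) * (inverse x * inverse x)) S"
      using Suc by (intro Ck_on_mult Ck_on_const assms)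
  qed
qed

lemma Ck_on_ln:
  assumes "open S" "S \<subseteq> {0<..}" shows "Ck_on k ln S"
proof (cases k)
  case 0
  then show ?thesis using assms(2) by (auto intro!: continuous_intros)
next
  case (Suc k')
  have "0 \<notin> S" using assms by auto
  then show ?thesis unfolding Suc using assms
    by (intro Ck_on_SucI[where f' = inverse] Ck_on_inverse) (auto intro!: derivative_eq_intros simp: inverse_eq_divide)
qed

text \<open>\<open>flat 0\<close> is the classical function exp (- 1 / s), smooth at 0 with all
  derivatives zero there. The powers of s in the denominator close the family under differentiation
  up to linear combinations, so that an induction over all \<open>m\<close> at once avoids
  unspecified polynomials.\<close>

definition flat :: "nat \<Rightarrow> real \<Rightarrow> real" where
  "flat m s = (if s > 0 then exp (- 1 / s) / s ^ m else 0)"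

lemma flat_lim0: "((flat m) \<longlongrightarrow> 0) (at 0)"
proof -
  have "((\<lambda>x. x ^ m / exp x) \<longlongrightarrow> (0::real)) at_top"
    by (rule tendsto_power_div_exp_0)
  then have "((\<lambda>s. inverse s ^ m / exp (inverse s)) \<longlongrightarrow> (0::real)) (at_right 0)"
    by (rule filterlim_compose[OF _ filterlim_inverse_at_top_right])
  then have "(flat m \<longlongrightarrow> 0) (at_right 0)"
    by (rule Lim_transform_eventually)
       (auto simp: eventually_at_right_field flat_def exp_minus field_simps intro!: exI[of _ 1])
  moreover have "(flat m \<longlongrightarrow> 0) (at_left 0)"
    by (rule Lim_transform_eventually[OF tendsto_const])
       (auto simp: eventually_at_left_field flat_def intro!: exI[of _ "-1"])
  ultimately show ?thesis by (simp add: filterlim_at_split)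
qed

lemma flat_DERIV: "(flat m has_real_derivative flat (m + 2) s - m * flat (m + 1) s) (at s)"
proof (cases s "0::real" rule: linorder_cases)
  case less
  have "((\<lambda>_. 0) has_real_derivative flat (m + 2) s - m * flat (m + 1) s) (at s)"
    using less by (simp add: flat_def)
  then show ?thesis
    by (rule has_field_derivative_transform_within_open[of _ _ _ "{..<0}"]) (use less in \<open>auto simp: flat_def\<close>)
next
  case greater
  have "((\<lambda>s. exp (- 1 / s) / s ^ m) has_real_derivative flat (m + 2) s - m * flat (m + 1) s) (at s)"
    using greater
    by (auto intro!: derivative_eq_intros simp: flat_def field_simps power2_eq_square)
       (cases m; auto simp: field_simps)
  then show ?thesis
    by (rule has_field_derivative_transform_within_open[of _ _ _ "{0<..}"]) (use greater in \<open>auto simp: flat_def\<close>)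
next
  case equal
  \<comment> \<open>At 0 the difference quotient of \<open>flat m\<close> is
    \<open>flat (m + 1)\<close>, so the limit of the next member of the family is the
    derivative.\<close>
  have "((\<lambda>h. (flat m (0 + h) - flat m 0) / h) \<longlongrightarrow> 0) (at 0)"
    by (rule Lim_transform_eventually[OF flat_lim0[of "m + 1"]])
       (auto simp: flat_def eventually_at intro!: exI[of _ 1])
  then show ?thesis using equal by (simp add: DERIV_def flat_def)
qed

lemma Ck_on_flat: "Ck_on k (flat m) UNIV"
proof (induction k arbitrary: m)
  case 0
  show ?case by (auto intro!: continuous_at_imp_continuous_on DERIV_isCont[OF flat_DERIV])
next
  case (Suc k)
  have "Ck_on k (\<lambda>s. flat (m + 2) s + (- real m) * flat (m + 1) s) UNIV"
    by (intro Ck_on_add Ck_on_mult Ck_on_const Suc) auto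
  then show ?case
    by (intro Ck_on_SucI[where f' = "\<lambda>s. flat (m + 2) s + (- real m) * flat (m + 1) s"])
       (use flat_DERIV in auto)
qed

section \<open>Differentiability classes on the plane\<close>

lemma Ck_continuous: "Ck k f \<Longrightarrow> continuous_on UNIV f"
  by (cases k) (auto intro!: continuous_at_imp_continuous_on simp: gderiv_def dest: has_derivative_continuous)

lemma Ck_Suc_imp: "Ck (Suc k) f \<Longrightarrow> Ck k f"
proof (induction k arbitrary: f)
  case 0
  then show ?case using Ck_continuous[of "Suc 0" f] by simp
next
  case (Suc k)
  then show ?case by (metis Ck.simps(2))
qed

lemma Ck_const: "Ck k (\<lambda>_. c)"
  by (induction k arbitrary: c) (auto intro!: exI[of _ "\<lambda>_. 0"] GDERIV_const)

lemma Ck_component: "Ck k (\<lambda>x. x $ i)"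
proof (cases k)
  case (Suc k')
  have "GDERIV (\<lambda>x::real^2. x $ i) x :> axis i 1" for x
    unfolding gderiv_def inner_axis using bounded_linear_imp_has_derivative[OF bounded_linear_vec_nth[of i]] by simp
  then show ?thesis using Suc by (auto intro!: exI[of _ "\<lambda>_. axis i 1"] Ck_const)
qed (auto intro: continuous_intros)

lemma Ck_add: "Ck k f \<Longrightarrow> Ck k g \<Longrightarrow> Ck k (\<lambda>x. f x + g x)"
proof (induction k arbitrary: f g)
  case 0
  then show ?case by (auto intro: continuous_intros)
next
  case (Suc k)
  then obtain F G where "\<forall>x. GDERIV f x :> F x" "\<forall>i. Ck k (\<lambda>x. F x $ i)"
    "\<forall>x. GDERIV g x :> G x" "\<forall>i. Ck k (\<lambda>x. G x $ i)" by auto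
  then show ?case using Suc.IH by (auto intro!: exI[of _ "\<lambda>x. F x + G x"] GDERIV_add)
qed

lemma Ck_mult: "Ck k f \<Longrightarrow> Ck k g \<Longrightarrow> Ck k (\<lambda>x. f x * g x)"
proof (induction k arbitrary: f g)
  case 0
  then show ?case by (auto intro: continuous_intros)
next
  case (Suc k)
  then obtain F G where "\<forall>x. GDERIV f x :> F x" "\<forall>i. Ck k (\<lambda>x. F x $ i)"
    "\<forall>x. GDERIV g x :> G x" "\<forall>i. Ck k (\<lambda>x. G x $ i)" by auto
  then show ?case using Suc.IH Ck_Suc_imp[OF Suc.prems(1)] Ck_Suc_imp[OF Suc.prems(2)]
    by (auto intro!: exI[of _ "\<lambda>x. f x *\<^sub>R G x + g x *\<^sub>R F x"] GDERIV_mult Ck_add)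
qed

lemma Ck_compose:
  assumes "open S" "\<And>x. P x \<in> S" "\<And>j. Ck j P" "Ck_on k F S"
  shows "Ck k (\<lambda>x. F (P x))"
  using assms(4)
proof (induction k arbitrary: F)
  case 0
  then show ?case using assms(2) Ck_continuous[OF assms(3)[of 0]]
    by (auto intro: continuous_on_compose2)
next
  case (Suc k)
  obtain G where G: "\<forall>x. GDERIV P x :> G x" "\<forall>i. Ck k (\<lambda>x. G x $ i)"
    using assms(3)[of "Suc k"] by auto
  have "GDERIV (\<lambda>x. F (P x)) x :> deriv F (P x) *\<^sub>R G x" for x
    using G(1) Ck_on_Suc_DERIV[OF Suc.prems assms(2)] by (intro GDERIV_DERIV_compose) auto
  moreover have "Ck k (\<lambda>x. deriv F (P x))" using Suc by simp
  ultimately show ?case using G by (auto intro!: exI[of _ "\<lambda>x. deriv F (P x) *\<^sub>R G x"] Ck_mult)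
qed

lemma Ck_diff_const: "Ck k f \<Longrightarrow> Ck k (\<lambda>x. f x - c)"
  using Ck_add[OF _ Ck_const[of _ "-c"]] by simp

lemma Ck_norm_square: "Ck k (\<lambda>x. (norm (x - a))\<^sup>2)"
proof -
  have "(\<lambda>x::real^2. (norm (x - a))\<^sup>2) = (\<lambda>x. (x $ 1 - a $ 1) * (x $ 1 - a $ 1) + (x $ 2 - a $ 2) * (x $ 2 - a $ 2))"
    unfolding power2_norm_eq_inner inner_vec_def sum_2 by simp
  then show ?thesis by (auto intro!: Ck_add Ck_mult Ck_diff_const Ck_component)
qed

section \<open>Test functions and weak gradients\<close>

lemma gradient_eq: "GDERIV f x :> D \<Longrightarrow> gradient f x = D"
  unfolding gradient_def
proof (rule the_equality)
  fix D' assume "GDERIV f x :> D" "GDERIV f x :> D'"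
  then have "(\<lambda>h. inner h D') = (\<lambda>h. inner h D)"
    unfolding gderiv_def by (rule has_derivative_unique[rotated])
  then show "D' = D" by (metis vector_eq_ldot)
qed

lemma Ck_gradient:
  assumes "\<And>k. Ck k \<phi>"
  shows "GDERIV \<phi> x :> gradient \<phi> x" "continuous_on UNIV (gradient \<phi>)"
proof -
  obtain G where G: "\<forall>x. GDERIV \<phi> x :> G x" "\<forall>i. Ck 0 (\<lambda>x. G x $ i)"
    using assms[of "Suc 0"] by auto
  have eq: "gradient \<phi> = G" using G gradient_eq by auto
  show "GDERIV \<phi> x :> gradient \<phi> x" unfolding eq using G by auto
  show "continuous_on UNIV (gradient \<phi>)"
    unfolding eq using G(2) continuous_on_vec_lambda[of UNIV "\<lambda>i x. G x $ i"] by simp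
qed

lemma GDERIV_has_real_derivative_line:
  assumes "GDERIV f (x + t *\<^sub>R e) :> D"
  shows "((\<lambda>t. f (x + t *\<^sub>R e)) has_real_derivative (e \<bullet> D)) (at t)"
proof -
  have "((\<lambda>t. x + t *\<^sub>R e) has_derivative (\<lambda>h. h *\<^sub>R e)) (at t)"
    by (auto intro!: derivative_eq_intros)
  from has_derivative_compose[OF this] assms
  have "((\<lambda>t. f (x + t *\<^sub>R e)) has_derivative (\<lambda>h. (h *\<^sub>R e) \<bullet> D)) (at t)"
    unfolding gderiv_def by blast
  then show ?thesis
    unfolding has_field_derivative_def
    by (rule has_derivative_eq_rhs) (auto simp: mult.commute)
qed

lemma GDERIV_lipschitz:
  fixes F :: "real^2 \<Rightarrow> real"
  assumes "\<And>x. GDERIV F x :> G x" "\<And>x. norm (G x) \<le> B"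
  shows "\<bar>F (x + h) - F x\<bar> \<le> B * norm h"
proof -
  have "norm (F (x + h) - F x) \<le> B * norm ((x + h) - x)"
  proof (rule differentiable_bound[OF convex_UNIV])
    show "(F has_derivative (\<lambda>h. h \<bullet> G x)) (at x within UNIV)" for x
      using assms(1) by (simp add: gderiv_def)
    show "onorm (\<lambda>h. h \<bullet> G x) \<le> B" for x
    proof (rule onorm_le)
      show "norm (h \<bullet> G x) \<le> B * norm h" for h
        using Cauchy_Schwarz_ineq2[of h "G x"] mult_right_mono[OF assms(2)[of x] norm_ge_zero[of h]]
        by (simp add: mult.commute)
    qed
  qed auto
  then show ?thesis by simp
qed

lemma GDERIV_zero_outside:
  assumes "\<And>x. GDERIV F x :> G x" "closed K" "\<And>x. x \<notin> K \<Longrightarrow> F x = 0" "x \<notin> K"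
  shows "G x = 0"
proof -
  have "((\<lambda>_. 0) has_derivative (\<lambda>h. h \<bullet> G x)) (at x)"
    by (rule has_derivative_transform_within_open[of F _ _ _ "- K"])
       (use assms in \<open>auto simp: gderiv_def\<close>)
  then have "(\<lambda>h. h \<bullet> G x) = (\<lambda>_. 0)"
    by (rule has_derivative_unique) simp
  then show ?thesis by (metis inner_eq_zero_iff)
qed

lemma compact_support_bounded:
  fixes f :: "'a::euclidean_space \<Rightarrow> 'b::real_normed_vector"
  assumes "continuous_on UNIV f" "compact K" "\<And>x. x \<notin> K \<Longrightarrow> f x = 0"
  obtains B where "B \<ge> 0" "\<And>x. norm (f x) \<le> B"
proof -
  have "bounded (f ` K)"
    using assms by (intro compact_imp_bounded compact_continuous_image) (auto intro: continuous_on_subset)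
  then obtain B where B: "\<And>x. x \<in> K \<Longrightarrow> norm (f x) \<le> B" by (auto simp: bounded_iff)
  have "norm (f x) \<le> max B 0" for x using B[of x] assms(3)[of x] by (cases "x \<in> K") auto
  then show thesis by (intro that[of "max B 0"]) auto
qed

lemma compact_support_integrable:
  fixes f :: "'a::euclidean_space \<Rightarrow> 'b::euclidean_space"
  assumes "continuous_on UNIV f" "compact K" "\<And>x. x \<notin> K \<Longrightarrow> f x = 0"
  shows "integrable lborel f"
proof -
  obtain B where B: "\<And>x. norm (f x) \<le> B" using compact_support_bounded[OF assms] by blast
  show ?thesis
    by (rule integrableI_bounded_set[of K _ _ B])
       (use assms B in \<open>auto intro!: borel_measurable_continuous_onI borel_compact emeasure_compact_finite[unfolded infinity_ennreal_def]\<close>)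
qed

text \<open>Integration by parts reduced to translation invariance: F (x + h e) - F x has integral
  zero for every h, and the difference quotients converge to e \<bullet> G x. By the Lipschitz bound
  they are dominated by B on the ball of radius R + 1 and vanish outside it, because the steps h are
  at most 1.\<close>

lemma integral_gradient_eq_0:
  fixes F :: "real^2 \<Rightarrow> real"
  assumes F: "\<And>x. GDERIV F x :> G x" and G: "continuous_on UNIV G"
    and K: "compact K" "\<And>x. x \<notin> K \<Longrightarrow> F x = 0"
  shows "(LINT x|lborel. G x) = 0"
proof -
  have contF: "continuous_on UNIV F"
    using F by (auto intro!: continuous_at_imp_continuous_on simp: gderiv_def dest: has_derivative_continuous)
  have G0: "G x = 0" if "x \<notin> K" for x
    using GDERIV_zero_outside[OF F compact_imp_closed[OF K(1)] K(2) that] .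
  obtain B where B: "B \<ge> 0" "\<And>x. norm (G x) \<le> B" using compact_support_bounded[OF G K(1) G0] by blast
  obtain R where R: "\<And>x. x \<in> K \<Longrightarrow> norm x \<le> R" using compact_imp_bounded[OF K(1)] by (auto simp: bounded_iff)
  have intF: "integrable lborel F" by (rule compact_support_integrable[OF contF K])
  have intG: "integrable lborel G" by (rule compact_support_integrable[OF G K(1) G0])
  have [measurable]: "F \<in> borel_measurable borel" "G \<in> borel_measurable borel"
    using contF G by (auto intro: borel_measurable_continuous_onI)
  have "(LINT x|lborel. e \<bullet> G x) = 0" if e: "norm e = 1" for e
  proof -
    define s where "s n x = (F (x + (1 / real (Suc n)) *\<^sub>R e) - F x) * real (Suc n)" for n x
    have trans: "(LINT x|lborel. F (x + a)) = (LINT x|lborel. F x)" "integrable lborel (\<lambda>x. F (x + a))" for a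
    proof -
      have "(LINT x|lborel. F x) = (LINT x|distr lborel borel ((+) a). F x)"
        by (simp add: lborel_distr_plus)
      also have "\<dots> = (LINT x|lborel. F (x + a))" by (subst integral_distr) (auto simp: add.commute)
      finally show "(LINT x|lborel. F (x + a)) = (LINT x|lborel. F x)" ..
      have "integrable (distr lborel borel ((+) a)) F" using intF by (simp add: lborel_distr_plus)
      then show "integrable lborel (\<lambda>x. F (x + a))" by (subst (asm) integrable_distr_eq) (auto simp: add.commute)
    qed
    have s0: "(LINT x|lborel. s n x) = 0" for n
      unfolding s_def using trans intF by (simp del: of_nat_Suc)
    have lim: "(\<lambda>n. LINT x|lborel. s n x) \<longlonglongrightarrow> (LINT x|lborel. e \<bullet> G x)"
    proof (rule integral_dominated_convergence[where w = "\<lambda>x. indicator (cball 0 (R + 1)) x * B"])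
      show "integrable lborel (\<lambda>x::real^2. indicator (cball 0 (R + 1)) x * B)"
        by (intro integrable_mult_left integrable_real_indicator)
           (use emeasure_compact_finite[OF compact_cball, of "0::real^2" "R + 1"] in auto)
      show "AE x in lborel. (\<lambda>n. s n x) \<longlonglongrightarrow> e \<bullet> G x"
      proof (rule AE_I2)
        fix x
        have "((\<lambda>t. F (x + t *\<^sub>R e)) has_real_derivative (e \<bullet> G x)) (at 0)"
          using GDERIV_has_real_derivative_line[of F x 0 e "G x"] F by simp
        then have "((\<lambda>h. (F (x + h *\<^sub>R e) - F x) / h) \<longlongrightarrow> e \<bullet> G x) (at 0)"
          by (simp add: DERIV_def)
        moreover have "filterlim (\<lambda>n. 1 / real (Suc n)) (at 0) sequentially"
          unfolding filterlim_at using LIMSEQ_inverse_real_of_nat by (auto simp: inverse_eq_divide)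
        ultimately have "(\<lambda>n. (F (x + (1 / real (Suc n)) *\<^sub>R e) - F x) / (1 / real (Suc n))) \<longlonglongrightarrow> e \<bullet> G x"
          by (rule filterlim_compose)
        then show "(\<lambda>n. s n x) \<longlonglongrightarrow> e \<bullet> G x" by (simp add: s_def)
      qed
      show "AE x in lborel. norm (s n x) \<le> indicator (cball 0 (R + 1)) x * B" for n
      proof (rule AE_I2)
        fix x
        let ?h = "(1 / real (Suc n)) *\<^sub>R e"
        have nh: "norm ?h = 1 / real (Suc n)" using e by simp
        show "norm (s n x) \<le> indicator (cball 0 (R + 1)) x * B"
        proof (cases "norm x \<le> R + 1")
          case True
          have "\<bar>F (x + ?h) - F x\<bar> * real (Suc n) \<le> (B * norm ?h) * real (Suc n)"
            by (intro mult_right_mono GDERIV_lipschitz[OF F B(2)]) auto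
          also have "\<dots> = B" unfolding nh by simp
          finally show ?thesis using True by (simp add: s_def abs_mult del: of_nat_Suc)
        next
          case False
          have "norm ?h \<le> 1" unfolding nh by simp
          then have "norm (x + ?h) > R" using False norm_triangle_ineq4[of "x + ?h" ?h] unfolding add_diff_cancel_right' by linarith
          then have "F (x + ?h) = 0" "F x = 0" using False R K(2) by fastforce+
          then show ?thesis using False by (simp add: s_def)
        qed
      qed
    qed (auto simp: s_def)
    then show ?thesis unfolding s0 by (simp add: LIMSEQ_const_iff)
  qed
  then have "(LINT x|lborel. axis i 1 \<bullet> G x) = 0" for i by simp
  then have "axis i 1 \<bullet> (LINT x|lborel. G x) = 0" for i
    using integral_inner_right[of "axis i 1" lborel G] intG by simp
  then show ?thesis by (simp add: vec_eq_iff inner_axis')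
qed

lemma test_functionsD:
  assumes "\<phi> \<in> test_functions U"
  shows "Ck k \<phi>" "GDERIV \<phi> x :> gradient \<phi> x" "continuous_on UNIV \<phi>" "continuous_on UNIV (gradient \<phi>)"
    "\<phi> \<in> borel_measurable borel" "gradient \<phi> \<in> borel_measurable borel"
proof -
  have C: "\<And>k. Ck k \<phi>" using assms by (simp add: test_functions_def)
  show "Ck k \<phi>" by (rule C)
  show "GDERIV \<phi> x :> gradient \<phi> x" by (rule Ck_gradient[OF C])
  show 1: "continuous_on UNIV \<phi>" using C by (rule Ck_continuous)
  show 2: "continuous_on UNIV (gradient \<phi>)" by (rule Ck_gradient[OF C])
  show "\<phi> \<in> borel_measurable borel" "gradient \<phi> \<in> borel_measurable borel"
    using 1 2 by (auto intro: borel_measurable_continuous_onI)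
qed

lemma test_functions_support:
  assumes "\<phi> \<in> test_functions U"
  obtains K where "compact K" "K \<subseteq> U" "\<And>x. x \<notin> K \<Longrightarrow> \<phi> x = 0" "\<And>x. x \<notin> K \<Longrightarrow> gradient \<phi> x = 0"
proof
  let ?K = "closure {x. \<phi> x \<noteq> 0}"
  show "compact ?K" "?K \<subseteq> U" using assms by (auto simp: test_functions_def)
  show z: "\<phi> x = 0" if "x \<notin> ?K" for x using that closure_subset[of "{x. \<phi> x \<noteq> 0}"] by blast
  show "gradient \<phi> x = 0" if "x \<notin> ?K" for x
    using GDERIV_zero_outside[OF test_functionsD(2)[OF assms] closed_closure z that] .
qed

lemma test_functionsI:
  assumes "\<And>k. Ck k \<phi>" "compact K" "K \<subseteq> U" "\<And>x. x \<notin> K \<Longrightarrow> \<phi> x = 0"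
  shows "\<phi> \<in> test_functions U"
proof -
  have "{x. \<phi> x \<noteq> 0} \<subseteq> K" using assms(4) by blast
  then have sub: "closure {x. \<phi> x \<noteq> 0} \<subseteq> K"
    using compact_imp_closed[OF assms(2)] by (rule closure_minimal)
  then have "compact (closure {x. \<phi> x \<noteq> 0})"
    using compact_Int_closed[OF assms(2) closed_closure[of "{x. \<phi> x \<noteq> 0}"]] by (simp add: Int_absorb1)
  moreover have "closure {x. \<phi> x \<noteq> 0} \<subseteq> U" using sub assms(3) by (rule order_trans)
  ultimately show ?thesis using assms(1) unfolding test_functions_def by blast
qed

lemma locally_integrable_continuous:
  assumes "continuous_on UNIV f" shows "locally_integrable U f"
  unfolding locally_integrable_def
proof (intro allI impI)
  fix K :: "(real^2) set" assume "compact K \<and> K \<subseteq> U"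
  then have K: "compact K" by simp
  have "bounded (f ` K)" using assms K by (intro compact_imp_bounded compact_continuous_image) (auto intro: continuous_on_subset)
  then obtain B where B: "\<And>x. x \<in> K \<Longrightarrow> norm (f x) \<le> B" by (auto simp: bounded_iff)
  have [measurable]: "f \<in> borel_measurable borel" using assms by (rule borel_measurable_continuous_onI)
  have [measurable]: "K \<in> sets borel" using K by (rule borel_compact)
  have "integrable lborel (\<lambda>x. indicator K x *\<^sub>R f x)"
    by (rule integrableI_bounded_set[of K _ _ B])
       (use K B emeasure_compact_finite[OF K] in auto)
  then show "set_integrable lebesgue K f"
    unfolding set_integrable_def by (subst integrable_completion) auto
qed

text \<open>The product with a test function has compact support, and
  \<open>integral_gradient_eq_0\<close> applied to this product is the defining identity.\<close>

lemma has_weak_gradient_smooth: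
  assumes "\<And>k. Ck k f"
  shows "has_weak_gradient f (gradient f) U"
  unfolding has_weak_gradient_def
proof (intro conjI ballI)
  have contf: "continuous_on UNIV f" using assms by (rule Ck_continuous)
  note g = Ck_gradient[OF assms]
  show "locally_integrable U f" "locally_integrable U (gradient f)"
    using contf g by (auto intro: locally_integrable_continuous)
  fix \<psi> assume \<psi>: "\<psi> \<in> test_functions U"
  obtain K where K: "compact K" "K \<subseteq> U" "\<And>x. x \<notin> K \<Longrightarrow> \<psi> x = 0" "\<And>x. x \<notin> K \<Longrightarrow> gradient \<psi> x = 0"
    using test_functions_support[OF \<psi>] by blast
  note p = test_functionsD[OF \<psi>]
  have "(LINT x|lborel. f x *\<^sub>R gradient \<psi> x + \<psi> x *\<^sub>R gradient f x) = 0"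
    by (rule integral_gradient_eq_0[where F = "\<lambda>x. f x * \<psi> x" and K = K])
       (use K g p contf in \<open>auto intro!: GDERIV_mult continuous_intros\<close>)
  moreover have i1: "integrable lborel (\<lambda>x. f x *\<^sub>R gradient \<psi> x)"
    by (rule compact_support_integrable[of _ K]) (use K p contf in \<open>auto intro!: continuous_intros\<close>)
  moreover have i2: "integrable lborel (\<lambda>x. \<psi> x *\<^sub>R gradient f x)"
    by (rule compact_support_integrable[of _ K]) (use K p g in \<open>auto intro!: continuous_intros\<close>)
  ultimately have *: "(LINT x|lborel. f x *\<^sub>R gradient \<psi> x) = - (LINT x|lborel. \<psi> x *\<^sub>R gradient f x)"
    by (simp add: eq_neg_iff_add_eq_0)
  have "(LINT x:U|lebesgue. f x *\<^sub>R gradient \<psi> x) = (LINT x|lebesgue. f x *\<^sub>R gradient \<psi> x)"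
    unfolding set_lebesgue_integral_def using K by (intro Bochner_Integration.integral_cong) (auto split: split_indicator)
  also have "\<dots> = (LINT x|lborel. f x *\<^sub>R gradient \<psi> x)"
    using i1 by (intro integral_completion) auto
  finally have 1: "(LINT x:U|lebesgue. f x *\<^sub>R gradient \<psi> x) = (LINT x|lborel. f x *\<^sub>R gradient \<psi> x)" .
  have "(LINT x:U|lebesgue. \<psi> x *\<^sub>R gradient f x) = (LINT x|lebesgue. \<psi> x *\<^sub>R gradient f x)"
    unfolding set_lebesgue_integral_def using K by (intro Bochner_Integration.integral_cong) (auto split: split_indicator)
  also have "\<dots> = (LINT x|lborel. \<psi> x *\<^sub>R gradient f x)"
    using i2 by (intro integral_completion) auto
  finally show "(LINT x:U|lebesgue. f x *\<^sub>R gradient \<psi> x) = - (LINT x:U|lebesgue. \<psi> x *\<^sub>R gradient f x)"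
    using 1 * by simp
qed

section \<open>Uniqueness of weak gradients\<close>

lemma locally_integrable_test_integrable:
  fixes f :: "real^2 \<Rightarrow> 'b::euclidean_space" and w :: "real^2 \<Rightarrow> real"
  assumes f: "locally_integrable U f" and w: "continuous_on UNIV w"
    and K: "compact K" "K \<subseteq> U" "\<And>x. x \<notin> K \<Longrightarrow> w x = 0"
  shows "set_integrable lebesgue U (\<lambda>x. w x *\<^sub>R f x)"
proof -
  obtain B where B: "B \<ge> 0" "\<And>x. norm (w x) \<le> B" using compact_support_bounded[OF w K(1,3)] by blast
  have [measurable]: "w \<in> borel_measurable lebesgue"
    using borel_measurable_continuous_onI[OF w] by (simp add: measurable_completion)
  have i: "integrable lebesgue (\<lambda>x. indicator K x *\<^sub>R f x)"
    using f K by (auto simp: locally_integrable_def set_integrable_def)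
  then have [measurable]: "(\<lambda>x. indicator K x *\<^sub>R f x) \<in> borel_measurable lebesgue" by auto
  have "integrable lebesgue (\<lambda>x. w x *\<^sub>R (indicator K x *\<^sub>R f x))"
  proof (rule Bochner_Integration.integrable_bound[OF integrable_scaleR_right[OF i, of B]])
    show "AE x in lebesgue. norm (w x *\<^sub>R indicator K x *\<^sub>R f x) \<le> norm (B *\<^sub>R indicator K x *\<^sub>R f x)"
      using B by (intro AE_I2) (auto simp: abs_mult intro!: mult_right_mono split: split_indicator)
  qed measurable
  also have "(\<lambda>x. w x *\<^sub>R (indicator K x *\<^sub>R f x)) = (\<lambda>x. indicator U x *\<^sub>R (w x *\<^sub>R f x))"
    using K by (auto simp: fun_eq_iff split: split_indicator)
  finally show ?thesis unfolding set_integrable_def .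
qed

text \<open>Boxes are stable under intersection and generate the Borel sets, so the finite measures
  whose densities are the positive and the negative part of \<open>f\<close> coincide. The densities
  are then equal almost everywhere, and a real number with equal positive and negative part is
  zero.\<close>

lemma integral_boxes_zero_imp_AE_zero:
  fixes f :: "'a::euclidean_space \<Rightarrow> real"
  assumes f: "integrable lborel f" and z: "\<And>a b. (LINT x|lborel. indicator (box a b) x * f x) = 0"
  shows "AE x in lborel. f x = 0"
proof -
  have [measurable]: "f \<in> borel_measurable borel" using borel_measurable_integrable[OF f] by simp
  define p q where "p x = ennreal (f x)" and "q x = ennreal (- f x)" for x
  have [measurable]: "p \<in> borel_measurable borel" "q \<in> borel_measurable borel"
    unfolding p_def q_def by measurable
  have finp: "integral\<^sup>N lborel p < \<infinity>" "integral\<^sup>N lborel q < \<infinity>"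
    using f unfolding real_integrable_def p_def q_def by (auto simp: less_top)
  have "density lborel p = density lborel q"
  proof (rule measure_eqI_generator_eq)
    let ?E = "range (\<lambda>(a, b). box a b::'a set)"
    show "Int_stable ?E"
      by (auto simp: Int_stable_def box_Int_box)
    show "?E \<subseteq> Pow UNIV" "sets (density lborel p) = sigma_sets UNIV ?E" "sets (density lborel q) = sigma_sets UNIV ?E"
      by (simp_all add: borel_eq_box)
    let ?A = "\<lambda>n::nat. box (- (real n *\<^sub>R One)) (real n *\<^sub>R One) :: 'a set"
    show "range ?A \<subseteq> ?E" "(\<Union>i. ?A i) = UNIV"
      unfolding UN_box_eq_UNIV by auto
    have le: "(\<integral>\<^sup>+x. p x * indicator X x \<partial>lborel) < \<infinity>" "(\<integral>\<^sup>+x. q x * indicator X x \<partial>lborel) < \<infinity>" for X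
      by (rule le_less_trans[OF nn_integral_mono finp(1)], simp split: split_indicator)
         (rule le_less_trans[OF nn_integral_mono finp(2)], simp split: split_indicator)
    show "emeasure (density lborel p) (?A i) \<noteq> \<infinity>" for i
      using le(1)[of "?A i"] by (subst emeasure_density) auto
    show "emeasure (density lborel p) X = emeasure (density lborel q) X" if XE: "X \<in> ?E" for X
    proof -
      obtain a b where X: "X = box a b" using XE by (auto simp: image_iff)
      have 1: "(\<integral>\<^sup>+x. p x * indicator X x \<partial>lborel) = (\<integral>\<^sup>+x. ennreal (indicator X x * f x) \<partial>lborel)"
        by (intro nn_integral_cong) (auto simp: p_def split: split_indicator)
      have 2: "(\<integral>\<^sup>+x. q x * indicator X x \<partial>lborel) = (\<integral>\<^sup>+x. ennreal (- (indicator X x * f x)) \<partial>lborel)"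
        by (intro nn_integral_cong) (auto simp: q_def split: split_indicator)
      have i: "integrable lborel (\<lambda>x. indicator X x * f x)"
        using integrable_mult_indicator[OF _ f, of X] X by simp
      have "enn2real (\<integral>\<^sup>+x. p x * indicator X x \<partial>lborel) = enn2real (\<integral>\<^sup>+x. q x * indicator X x \<partial>lborel)"
        using z[of a b] unfolding X[symmetric] real_lebesgue_integral_def[OF i] 1 2 by simp
      then have "(\<integral>\<^sup>+x. p x * indicator X x \<partial>lborel) = (\<integral>\<^sup>+x. q x * indicator X x \<partial>lborel)"
        using le[of X] by (metis ennreal_enn2real infinity_ennreal_def)
      then show ?thesis using X by (simp add: emeasure_density)
    qed
  qed
  then have "AE x in lborel. p x = q x"
    by (subst (asm) finite_density_unique) (use finp in auto)
  then show ?thesis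
  proof (rule eventually_mono)
    fix x assume "p x = q x"
    then show "f x = 0"
      by (cases "f x \<ge> 0") (auto simp: p_def q_def ennreal_neg ennreal_eq_0_iff dest: sym)
  qed
qed

text \<open>A smooth function with values in [0, 1] that vanishes off the box and tends to its
  indicator as \<open>n\<close> grows: \<open>flat 0 (n * s)\<close> tends to 1 for s > 0 and is 0
  for s \<le> 0.\<close>

definition box_bump :: "real^2 \<Rightarrow> real^2 \<Rightarrow> nat \<Rightarrow> real^2 \<Rightarrow> real" where
  "box_bump a b n x = flat 0 (real n * (x $ 1 - a $ 1)) * flat 0 (real n * (b $ 1 - x $ 1)) *
     (flat 0 (real n * (x $ 2 - a $ 2)) * flat 0 (real n * (b $ 2 - x $ 2)))"

lemma flat_le_1: "flat 0 s \<le> 1" "flat 0 s \<ge> 0"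
  by (auto simp: flat_def)

lemma flat_scaled_tendsto: "(\<lambda>n. flat 0 (real n * s)) \<longlonglongrightarrow> indicator {0<..} s"
proof (cases "s > 0")
  case True
  have "(\<lambda>n. exp (- 1 / (real n * s))) \<longlonglongrightarrow> exp 0"
    using True by (intro tendsto_exp) real_asymp
  moreover have "\<forall>\<^sub>F n in sequentially. exp (- 1 / (real n * s)) = flat 0 (real n * s)"
    using eventually_gt_at_top[of 0] by eventually_elim (use True in \<open>simp add: flat_def\<close>)
  ultimately have "(\<lambda>n. flat 0 (real n * s)) \<longlonglongrightarrow> exp 0"
    by (rule Lim_transform_eventually)
  then show ?thesis using True by simp
next
  case False
  then have "flat 0 (real n * s) = 0" for n by (auto simp: flat_def zero_less_mult_iff)
  then show ?thesis using False by simp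
qed

lemma box_bump_Ck: "Ck k (box_bump a b n)"
proof -
  have 1: "Ck k (\<lambda>x. flat 0 (c * (x $ i) + d))" for c d i
    by (rule Ck_compose[where S = UNIV and P = "\<lambda>x. c * (x $ i) + d" and F = "flat 0"])
       (auto intro!: Ck_on_flat Ck_add Ck_mult Ck_const Ck_component)
  have "(\<lambda>x. flat 0 (real n * (x $ i - a $ i)) * flat 0 (real n * (b $ i - x $ i))) =
     (\<lambda>x. flat 0 (real n * (x $ i) + (- real n * a $ i)) * flat 0 (- real n * (x $ i) + (real n * b $ i)))" for i
    by (simp add: algebra_simps)
  then have "Ck k (\<lambda>x. flat 0 (real n * (x $ i - a $ i)) * flat 0 (real n * (b $ i - x $ i)))" for i
    by (simp only:) (rule Ck_mult[OF 1 1])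
  from Ck_mult[OF this[of 1] this[of 2]] show ?thesis
    unfolding box_bump_def[abs_def] .
qed

lemma mem_box_plane: "x \<in> box a b \<longleftrightarrow> a $ 1 < x $ 1 \<and> x $ 1 < b $ 1 \<and> a $ 2 < x $ 2 \<and> x $ (2::2) < b $ 2"
  for x :: "real^2"
  by (auto simp: mem_box_cart forall_2)

lemma box_bump_support: "x \<notin> box a b \<Longrightarrow> box_bump a b n x = 0"
  by (auto simp: box_bump_def mem_box_plane flat_def zero_less_mult_iff)

lemma box_bump_bounds: "0 \<le> box_bump a b n x" "box_bump a b n x \<le> 1"
  unfolding box_bump_def by (auto intro!: mult_nonneg_nonneg mult_le_one flat_le_1)

lemma box_bump_tendsto: "(\<lambda>n. box_bump a b n x) \<longlonglongrightarrow> indicator (box a b) x"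
proof -
  have "(\<lambda>n. box_bump a b n x) \<longlonglongrightarrow> indicator {0<..} (x $ 1 - a $ 1) * indicator {0<..} (b $ 1 - x $ 1) *
     (indicator {0<..} (x $ 2 - a $ 2) * indicator {0<..} (b $ 2 - x $ 2))"
    unfolding box_bump_def by (intro tendsto_mult flat_scaled_tendsto)
  also have "indicator {0<..} (x $ 1 - a $ 1) * indicator {0<..} (b $ 1 - x $ 1) *
     (indicator {0<..} (x $ 2 - a $ 2) * indicator {0<..} (b $ 2 - x $ 2)) = (indicator (box a b) x :: real)"
    by (auto simp: mem_box_plane split: split_indicator)
  finally show ?thesis .
qed

text \<open>The fundamental lemma of the calculus of variations. Instead of mollifying
  \<open>d\<close>, the test functions \<open>box_bump\<close> are sent to indicators of boxes, and
  a function whose integrals over all boxes vanish is zero.\<close>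

lemma locally_integrable_annihilates_imp_AE_zero:
  fixes d :: "real^2 \<Rightarrow> real^2"
  assumes U: "open U" and d: "locally_integrable U d"
    and z: "\<And>\<psi>. \<psi> \<in> test_functions U \<Longrightarrow> (LINT x:U|lebesgue. \<psi> x *\<^sub>R d x) = 0"
  shows "AE x in lebesgue. x \<in> U \<longrightarrow> d x = 0"
proof -
  have box0: "(LINT x|lebesgue. indicator (box a b) x *\<^sub>R d x) = 0" if sub: "cbox a b \<subseteq> U" for a b
  proof -
    have id: "integrable lebesgue (\<lambda>x. indicator (cbox a b) x *\<^sub>R d x)"
      using d sub by (auto simp: locally_integrable_def set_integrable_def)
    have m: "(\<lambda>x. indicator (cbox a b) x *\<^sub>R d x) \<in> borel_measurable lebesgue"
      using id by auto
    have bb: "box_bump a b n \<in> borel_measurable lebesgue" for n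
      using borel_measurable_continuous_onI[OF Ck_continuous[OF box_bump_Ck[of 0 a b n]]] by (simp add: measurable_completion)
    have e1: "indicator (box a b) x *\<^sub>R d x = indicator (box a b) x *\<^sub>R (indicator (cbox a b) x *\<^sub>R d x)" for x
      using box_subset_cbox[of a b] by (auto split: split_indicator)
    have "(\<lambda>n. LINT x|lebesgue. box_bump a b n x *\<^sub>R (indicator (cbox a b) x *\<^sub>R d x)) \<longlonglongrightarrow> (LINT x|lebesgue. indicator (box a b) x *\<^sub>R (indicator (cbox a b) x *\<^sub>R d x))"
    proof (rule integral_dominated_convergence[where w = "\<lambda>x. norm (indicator (cbox a b) x *\<^sub>R d x)"])
      show "AE x in lebesgue. (\<lambda>n. box_bump a b n x *\<^sub>R (indicator (cbox a b) x *\<^sub>R d x)) \<longlonglongrightarrow> indicator (box a b) x *\<^sub>R (indicator (cbox a b) x *\<^sub>R d x)"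
        by (intro AE_I2 tendsto_scaleR box_bump_tendsto tendsto_const)
      show "AE x in lebesgue. norm (box_bump a b n x *\<^sub>R (indicator (cbox a b) x *\<^sub>R d x)) \<le> norm (indicator (cbox a b) x *\<^sub>R d x)" for n
        using box_bump_bounds[of a b n] by (intro AE_I2) (auto intro!: mult_left_le_one_le split: split_indicator)
      show "integrable lebesgue (\<lambda>x. norm (indicator (cbox a b) x *\<^sub>R d x))"
        using id by (rule integrable_norm)
      show "(\<lambda>x. indicator (box a b) x *\<^sub>R (indicator (cbox a b) x *\<^sub>R d x)) \<in> borel_measurable lebesgue"
        by (rule borel_measurable_scaleR[OF borel_measurable_indicator m]) simp
      show "(\<lambda>x. box_bump a b n x *\<^sub>R (indicator (cbox a b) x *\<^sub>R d x)) \<in> borel_measurable lebesgue" for n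
        by (rule borel_measurable_scaleR[OF bb m])
    qed
    moreover have "(LINT x|lebesgue. box_bump a b n x *\<^sub>R (indicator (cbox a b) x *\<^sub>R d x)) = 0" for n
    proof -
      have "box_bump a b n \<in> test_functions U"
      proof (rule test_functionsI[of _ "cbox a b"])
        show "box_bump a b n x = 0" if "x \<notin> cbox a b" for x
          using that box_subset_cbox[of a b] by (intro box_bump_support) auto
      qed (use box_bump_Ck sub in \<open>auto simp: compact_cbox\<close>)
      from z[OF this] have "(LINT x:U|lebesgue. box_bump a b n x *\<^sub>R d x) = 0" .
      moreover have e: "box_bump a b n x *\<^sub>R (indicator (cbox a b) x *\<^sub>R d x) = indicator U x *\<^sub>R (box_bump a b n x *\<^sub>R d x)" for x
        using box_bump_support[of x a b n] sub box_subset_cbox[of a b] by (auto split: split_indicator)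
      ultimately show ?thesis unfolding set_lebesgue_integral_def by (simp only: e)
    qed
    ultimately show ?thesis unfolding e1 by (simp add: LIMSEQ_const_iff)
  qed
  have on_box: "AE x in lebesgue. x \<in> cbox c e \<longrightarrow> d x = 0" if sub: "cbox c e \<subseteq> U" for c e
  proof -
    have id: "integrable lebesgue (\<lambda>x. indicator (cbox c e) x *\<^sub>R d x)"
      using d sub by (auto simp: locally_integrable_def set_integrable_def)
    have "AE x in lebesgue. x \<in> box c e \<longrightarrow> d x $ i = 0" for i
    proof -
      define f where "f x = indicator (box c e) x * (d x $ i)" for x
      have ic: "integrable lebesgue (\<lambda>x. (indicator (cbox c e) x *\<^sub>R d x) $ i)"
        using id by (rule integrable_bounded_linear[OF bounded_linear_vec_nth])
      have "integrable lebesgue (\<lambda>x. indicator (box c e) x *\<^sub>R ((indicator (cbox c e) x *\<^sub>R d x) $ i))"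
        by (rule integrable_mult_indicator[OF _ ic]) simp
      also have "(\<lambda>x. indicator (box c e) x *\<^sub>R ((indicator (cbox c e) x *\<^sub>R d x) $ i)) = f"
        using box_subset_cbox[of c e] by (auto simp: f_def fun_eq_iff split: split_indicator)
      finally have intf: "integrable lebesgue f" .
      \<comment> \<open>\<open>integral_boxes_zero_imp_AE_zero\<close> is about
        \<open>lborel\<close>, so \<open>f\<close> is exchanged for a Borel function equal to it
        almost everywhere.\<close>
      obtain f' where f'[measurable]: "f' \<in> borel_measurable lborel" and ff': "AE x in lborel. f x = f' x"
        using completion_ex_borel_measurable_real[of f lborel] intf by auto
      have ff'c: "AE x in lebesgue. f x = f' x" using ff' by (rule AE_completion)
      have "integrable lebesgue f'"
        using intf ff'c borel_measurable_integrable[OF intf] by (subst integrable_cong_AE[symmetric]) (auto simp: measurable_completion)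
      then have if': "integrable lborel f'" by (subst (asm) integrable_completion) auto
      have "AE x in lborel. f' x = 0"
      proof (rule integral_boxes_zero_imp_AE_zero[OF if'])
        fix a b :: "real^2"
        have "(LINT x|lborel. indicator (box a b) x * f' x) = (LINT x|lebesgue. indicator (box a b) x * f' x)"
          by (rule integral_completion[symmetric]) auto
        also have "\<dots> = (LINT x|lebesgue. indicator (box a b) x * f x)"
          using ff'c borel_measurable_integrable[OF intf]
          by (intro integral_cong_AE borel_measurable_times borel_measurable_indicator)
             (auto simp: measurable_completion elim!: eventually_mono)
        also have "\<dots> = 0"
        proof -
          \<comment> \<open>The intersection of two boxes is a box, which reduces the integral of
            \<open>f\<close> over any box to \<open>box0\<close>. The empty case is separate: that
            the closed box lies in \<open>U\<close> is derived from the open one being dense in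
            it.\<close>
          obtain a' b' where ab: "box a b \<inter> box c e = box a' b'" by (rule that[OF box_Int_box])
          show ?thesis
          proof (cases "box a' b' = {}")
            case True
            have "indicator (box a b) x * f x = 0" for x
              using ab True by (auto simp: f_def split: split_indicator)
            then show ?thesis by (simp only: integral_zero)
          next
            case False
            have "cbox a' b' = closure (box a' b')" using False by (simp add: closure_box)
            also have "\<dots> \<subseteq> cbox c e"
              using ab box_subset_cbox[of c e] by (intro closure_minimal closed_cbox) auto
            finally have sub': "cbox a' b' \<subseteq> U" using sub by auto
            have ii: "integrable lebesgue (\<lambda>x. indicator (box a' b') x *\<^sub>R d x)"
            proof -
              have "integrable lebesgue (\<lambda>x. indicator (box a' b') x *\<^sub>R (indicator (cbox c e) x *\<^sub>R d x))"
                by (rule integrable_mult_indicator[OF _ id]) simp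
              also have "(\<lambda>x. indicator (box a' b') x *\<^sub>R (indicator (cbox c e) x *\<^sub>R d x)) = (\<lambda>x. indicator (box a' b') x *\<^sub>R d x)"
                using ab box_subset_cbox[of c e] by (auto simp: fun_eq_iff split: split_indicator)
              finally show ?thesis .
            qed
            have "indicator (box a b) x * f x = (indicator (box a' b') x *\<^sub>R d x) $ i" for x
              unfolding ab[symmetric] by (auto simp: f_def split: split_indicator)
            then have "(LINT x|lebesgue. indicator (box a b) x * f x) = (LINT x|lebesgue. indicator (box a' b') x *\<^sub>R d x) $ i"
              using integral_bounded_linear[OF bounded_linear_vec_nth ii, of i] by simp
            then show ?thesis using box0[OF sub'] by simp
          qed
        qed
        finally show "(LINT x|lborel. indicator (box a b) x * f' x) = 0" .
      qed
      then have "AE x in lebesgue. f' x = 0" by (rule AE_completion)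
      with ff'c show ?thesis by eventually_elim (auto simp: f_def)
    qed
    then have "AE x in lebesgue. \<forall>i. x \<in> box c e \<longrightarrow> d x $ i = 0"
      by (subst AE_all_countable) auto
    moreover have "AE x in lebesgue. x \<notin> cbox c e - box c e"
    proof (rule AE_not_in)
      have "negligible (cbox c e - box c e)"
        using negligible_frontier_interval[of c e] by (simp add: frontier_cbox)
      then show "cbox c e - box c e \<in> null_sets lebesgue" by (simp add: negligible_iff_null_sets)
    qed
    ultimately show ?thesis by eventually_elim (auto simp: vec_eq_iff)
  qed
  obtain \<D> where D: "countable \<D>" "\<D> \<subseteq> Pow U" "\<And>X. X \<in> \<D> \<Longrightarrow> \<exists>a b. X = cbox a b" "\<Union>\<D> = U"
    using open_countable_Union_open_cbox[OF U] by metis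
  have "AE x in lebesgue. \<forall>X\<in>\<D>. x \<in> X \<longrightarrow> d x = 0"
    unfolding AE_ball_countable[OF D(1)]
  proof
    fix X assume X: "X \<in> \<D>"
    then obtain a b where "X = cbox a b" using D(3) by blast
    then show "AE x in lebesgue. x \<in> X \<longrightarrow> d x = 0" using on_box[of a b] X D(2) by auto
  qed
  then show ?thesis using D(4) by (auto elim!: eventually_mono)
qed

lemma has_weak_gradient_diff:
  assumes "has_weak_gradient u g U" "has_weak_gradient v h U"
  shows "has_weak_gradient (\<lambda>x. u x - v x) (\<lambda>x. g x - h x) U"
  unfolding has_weak_gradient_def
proof (intro conjI ballI)
  note u = assms(1)[unfolded has_weak_gradient_def] and v = assms(2)[unfolded has_weak_gradient_def]
  show "locally_integrable U (\<lambda>x. u x - v x)" "locally_integrable U (\<lambda>x. g x - h x)"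
    using u v unfolding locally_integrable_def by (auto intro!: set_integral_diff)
  fix \<psi> assume \<psi>: "\<psi> \<in> test_functions U"
  obtain K where K: "compact K" "K \<subseteq> U" "\<And>x. x \<notin> K \<Longrightarrow> \<psi> x = 0" "\<And>x. x \<notin> K \<Longrightarrow> gradient \<psi> x = 0"
    using test_functions_support[OF \<psi>] by blast
  note p = test_functionsD[OF \<psi>]
  have i: "set_integrable lebesgue U (\<lambda>x. \<psi> x *\<^sub>R g x)" "set_integrable lebesgue U (\<lambda>x. \<psi> x *\<^sub>R h x)"
    using u v K p by (auto intro!: locally_integrable_test_integrable)
  \<comment> \<open>Here the scalar factor is merely locally integrable and the vector factor is
    continuous, the opposite of \<open>locally_integrable_test_integrable\<close>; hence that lemma
    is applied to each component.\<close>
  have j: "set_integrable lebesgue U (\<lambda>x. w x *\<^sub>R gradient \<psi> x)" if "locally_integrable U w" for w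
  proof -
    have "set_integrable lebesgue U (\<lambda>x. (gradient \<psi> x $ i) *\<^sub>R w x)" for i
      using that K p by (intro locally_integrable_test_integrable) (auto intro!: continuous_intros)
    then have "integrable lebesgue (\<lambda>x. (indicator U x * (gradient \<psi> x $ i) * w x) *\<^sub>R axis i (1::real))" for i
      by (intro integrable_scaleR_left) (simp add: set_integrable_def mult.assoc)
    then have "integrable lebesgue (\<lambda>x. \<Sum>i\<in>UNIV. (indicator U x * (gradient \<psi> x $ i) * w x) *\<^sub>R axis i (1::real))"
      by (intro Bochner_Integration.integrable_sum)
    also have "(\<lambda>x. \<Sum>i\<in>UNIV. (indicator U x * (gradient \<psi> x $ i) * w x) *\<^sub>R axis i (1::real)) = (\<lambda>x. indicator U x *\<^sub>R (w x *\<^sub>R gradient \<psi> x))"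
      by (auto simp: fun_eq_iff vec_eq_iff sum_2 axis_def forall_2)
    finally show ?thesis by (simp add: set_integrable_def)
  qed
  have "(LINT x:U|lebesgue. (u x - v x) *\<^sub>R gradient \<psi> x) = (LINT x:U|lebesgue. u x *\<^sub>R gradient \<psi> x) - (LINT x:U|lebesgue. v x *\<^sub>R gradient \<psi> x)"
    unfolding scaleR_left_diff_distrib using u v j by (intro set_integral_diff) auto
  also have "\<dots> = - ((LINT x:U|lebesgue. \<psi> x *\<^sub>R g x) - (LINT x:U|lebesgue. \<psi> x *\<^sub>R h x))"
    using u v \<psi> by auto
  also have "(LINT x:U|lebesgue. \<psi> x *\<^sub>R g x) - (LINT x:U|lebesgue. \<psi> x *\<^sub>R h x) = (LINT x:U|lebesgue. \<psi> x *\<^sub>R (g x - h x))"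
    unfolding scaleR_right_diff_distrib using i by (intro set_integral_diff(2)[symmetric]) auto
  finally show "(LINT x:U|lebesgue. (u x - v x) *\<^sub>R gradient \<psi> x) = - (LINT x:U|lebesgue. \<psi> x *\<^sub>R (g x - h x))" .
qed

lemma has_weak_gradient_unique:
  assumes "open U" "has_weak_gradient u g U" "has_weak_gradient u h U"
  shows "AE x in lebesgue. x \<in> U \<longrightarrow> g x = h x"
proof -
  have d: "has_weak_gradient (\<lambda>x. u x - u x) (\<lambda>x. g x - h x) U"
    by (rule has_weak_gradient_diff[OF assms(2,3)])
  have "AE x in lebesgue. x \<in> U \<longrightarrow> g x - h x = 0"
  proof (rule locally_integrable_annihilates_imp_AE_zero[OF assms(1)])
    show "locally_integrable U (\<lambda>x. g x - h x)" using d by (simp add: has_weak_gradient_def)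
    show "(LINT x:U|lebesgue. \<psi> x *\<^sub>R (g x - h x)) = 0" if "\<psi> \<in> test_functions U" for \<psi>
      using d that by (simp add: has_weak_gradient_def)
  qed
  then show ?thesis by simp
qed

lemma weak_gradient_AE:
  assumes "open U" "has_weak_gradient u g U"
  shows "AE x in lebesgue. x \<in> U \<longrightarrow> weak_gradient U u x = g x"
  using has_weak_gradient_unique[OF assms(1) _ assms(2)] someI[of "\<lambda>g. has_weak_gradient u g U", OF assms(2)]
  unfolding weak_gradient_def by blast

section \<open>The energy space\<close>

text \<open>Local integrability speaks of compact subsets only. The closed balls of radius 1 - 1 /
  (n + 1) exhaust the disc, and measurability passes to the limit.\<close>

lemma locally_integrable_measurable:
  fixes f :: "real^2 \<Rightarrow> 'b::euclidean_space"
  assumes "locally_integrable unit_disc f"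
  shows "(\<lambda>x. indicator unit_disc x *\<^sub>R f x) \<in> borel_measurable lebesgue"
proof (rule borel_measurable_LIMSEQ_metric)
  show "(\<lambda>x. indicator (cball 0 (1 - 1 / real (Suc n))) x *\<^sub>R f x) \<in> borel_measurable lebesgue" for n
  proof -
    have "1 - 1 / real (Suc n) < 1" by simp
    then have "cball 0 (1 - 1 / real (Suc n)) \<subseteq> unit_disc" 
      using le_less_trans[of _ "1 - 1 / real (Suc n)" 1] by (simp only: subset_iff mem_cball mem_ball) auto
    then have "set_integrable lebesgue (cball 0 (1 - 1 / real (Suc n))) f"
      using assms compact_cball unfolding locally_integrable_def by blast
    then show ?thesis by (auto simp: set_integrable_def)
  qed
  show "(\<lambda>n. indicator (cball 0 (1 - 1 / real (Suc n))) x *\<^sub>R f x) \<longlonglongrightarrow> indicator unit_disc x *\<^sub>R f x" for x :: "real^2"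
  proof (cases "x \<in> unit_disc")
    case True
    have "(\<lambda>n. 1 - 1 / real (Suc n)) \<longlonglongrightarrow> 1 - 0"
      using LIMSEQ_inverse_real_of_nat by (intro tendsto_diff tendsto_const) (simp add: inverse_eq_divide)
    then have "\<forall>\<^sub>F n in sequentially. norm x < 1 - 1 / real (Suc n)"
      using True by (intro order_tendstoD) auto
    then have "\<forall>\<^sub>F n in sequentially. indicator unit_disc x *\<^sub>R f x = indicator (cball 0 (1 - 1 / real (Suc n))) x *\<^sub>R f x"
      by eventually_elim (use True in auto)
    then show ?thesis by (rule Lim_transform_eventually[OF tendsto_const])
  next
    case False
    have "x \<notin> cball 0 (1 - 1 / real (Suc n))" for n
    proof -
      have "1 - 1 / real (Suc n) < 1" by simp
      then show ?thesis using False unfolding mem_cball mem_ball by linarith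
    qed
    then show ?thesis using False by simp
  qed
qed

lemma locally_integrable_borel_real:
  fixes f :: "real^2 \<Rightarrow> real"
  assumes "locally_integrable unit_disc f"
  obtains f' where "f' \<in> borel_measurable borel" "AE x in lborel. x \<in> unit_disc \<longrightarrow> f x = f' x"
proof -
  obtain f' where "f' \<in> borel_measurable lborel" "AE x in lborel. indicator unit_disc x *\<^sub>R f x = f' x"
    using completion_ex_borel_measurable_real[OF locally_integrable_measurable[OF assms]] by blast
  then show thesis by (intro that[of f']) (auto elim!: eventually_mono)
qed

lemma locally_integrable_component:
  fixes f :: "real^2 \<Rightarrow> real^2"
  shows "locally_integrable U f \<Longrightarrow> locally_integrable U (\<lambda>x. f x $ i)"
  unfolding locally_integrable_def set_integrable_def
  using integrable_bounded_linear[OF bounded_linear_vec_nth[of i], of lebesgue "\<lambda>x. indicator _ x *\<^sub>R f x"] by simp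

lemma locally_integrable_borel_vec:
  fixes f :: "real^2 \<Rightarrow> real^2"
  assumes "locally_integrable unit_disc f"
  obtains f' where "f' \<in> borel_measurable borel" "AE x in lborel. x \<in> unit_disc \<longrightarrow> f x = f' x"
proof -
  obtain p where p: "p \<in> borel_measurable borel" "AE x in lborel. x \<in> unit_disc \<longrightarrow> f x $ 1 = p x"
    using locally_integrable_borel_real[OF locally_integrable_component[OF assms, of 1]] by blast
  obtain q where q: "q \<in> borel_measurable borel" "AE x in lborel. x \<in> unit_disc \<longrightarrow> f x $ 2 = q x"
    using locally_integrable_borel_real[OF locally_integrable_component[OF assms, of 2]] by blast
  show thesis
  proof
    show "(\<lambda>x. p x *\<^sub>R axis 1 1 + q x *\<^sub>R axis 2 1 :: real^2) \<in> borel_measurable borel" using p q by measurable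
    show "AE x in lborel. x \<in> unit_disc \<longrightarrow> f x = p x *\<^sub>R axis 1 1 + q x *\<^sub>R axis 2 1"
      using p(2) q(2) by eventually_elim (auto simp: vec_eq_iff forall_2 axis_def)
  qed
qed

text \<open>\<open>V\<close> is unconstrained outside \<open>(0, 1)\<close>, so its values there are replaced by \<open>0\<close>.\<close>

definition potential :: "(real \<Rightarrow> real) \<Rightarrow> real^2 \<Rightarrow> real" where
  "potential V x = (if x \<in> unit_disc - {0} then V (norm x) else 0)"

lemma potential_measurable [measurable]:
  assumes "continuous_on {0<..<1} V"
  shows "potential V \<in> borel_measurable borel"
proof -
  have "continuous_on (unit_disc - {0::real^2}) (\<lambda>x. V (norm x))"
    by (rule continuous_on_compose2[OF assms]) (auto intro: continuous_intros)
  then have "(\<lambda>x. indicator (unit_disc - {0}) x *\<^sub>R V (norm x)) \<in> borel_measurable borel"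
    by (intro borel_measurable_continuous_on_indicator) auto
  also have "(\<lambda>x. indicator (unit_disc - {0}) x *\<^sub>R V (norm x)) = potential V"
    by (auto simp: fun_eq_iff potential_def)
  finally show ?thesis .
qed

text \<open>Moves energies from \<open>lebesgue\<close> and the chosen weak gradient to
  representatives on \<open>lborel\<close>; if these are Borel, Tonelli's theorem and
  \<open>log_polar\<close> apply. The value of \<open>V\<close> at 0 enters only at the origin, a
  null set.\<close>

lemma energy_eq:
  assumes w: "has_weak_gradient u g unit_disc" and A: "A \<subseteq> unit_disc"
    and u': "AE x in lborel. x \<in> unit_disc \<longrightarrow> u x = u' x"
    and g': "AE x in lborel. x \<in> unit_disc \<longrightarrow> g x = g' x"
  shows "energy V \<mu> A u = (\<integral>\<^sup>+x. indicator A x * ennreal ((norm (g' x))\<^sup>2 + \<mu> * potential V x * (u' x)\<^sup>2) \<partial>lborel)"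
proof -
  have "energy V \<mu> A u = (\<integral>\<^sup>+x. indicator A x * ennreal ((norm (g' x))\<^sup>2 + \<mu> * potential V x * (u' x)\<^sup>2) \<partial>lebesgue)"
    unfolding energy_def
  proof (rule nn_integral_cong_AE)
    have "AE x in lborel. x \<noteq> (0::real^2)" by (rule AE_lborel_singleton)
    then have "AE x in lebesgue. x \<noteq> (0::real^2)" by (rule AE_completion)
    with weak_gradient_AE[OF open_ball w] AE_completion[OF u'] AE_completion[OF g']
    show "AE x in lebesgue. ennreal ((norm (weak_gradient unit_disc u x))\<^sup>2 + \<mu> * V (norm x) * (u x)\<^sup>2) * indicator A x
      = indicator A x * ennreal ((norm (g' x))\<^sup>2 + \<mu> * potential V x * (u' x)\<^sup>2)"
      by eventually_elim (use A in \<open>auto simp: potential_def split: split_indicator\<close>)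
  qed
  then show ?thesis by (simp add: nn_integral_completion)
qed

text \<open>The support is a compact subset of the punctured disc, on which
  \<open>V (norm x)\<close> is continuous and hence bounded, however singular \<open>V\<close> is at
  0 or 1.\<close>

lemma test_energy_finite:
  assumes V: "continuous_on {0<..<1} V" and \<mu>: "\<mu> \<ge> 0" and \<phi>: "\<phi> \<in> test_functions (unit_disc - {0})"
  shows "(\<integral>\<^sup>+x. indicator unit_disc x * ennreal ((norm (gradient \<phi> x))\<^sup>2 + \<mu> * potential V x * (\<phi> x)\<^sup>2) \<partial>lborel) < \<infinity>"
proof -
  obtain K where K: "compact K" "K \<subseteq> unit_disc - {0}" "\<And>x. x \<notin> K \<Longrightarrow> \<phi> x = 0" "\<And>x. x \<notin> K \<Longrightarrow> gradient \<phi> x = 0"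
    using test_functions_support[OF \<phi>] by blast
  note p = test_functionsD[OF \<phi>]
  have "continuous_on K (\<lambda>x. (norm (gradient \<phi> x))\<^sup>2 + \<mu> * V (norm x) * (\<phi> x)\<^sup>2)"
    using K(2) by (intro continuous_intros continuous_on_subset[OF p(3)] continuous_on_subset[OF p(4)] continuous_on_compose2[OF V]) auto
  then have "bounded ((\<lambda>x. (norm (gradient \<phi> x))\<^sup>2 + \<mu> * V (norm x) * (\<phi> x)\<^sup>2) ` K)"
    using K by (intro compact_imp_bounded compact_continuous_image)
  then obtain B where B: "\<And>x. x \<in> K \<Longrightarrow> \<bar>(norm (gradient \<phi> x))\<^sup>2 + \<mu> * V (norm x) * (\<phi> x)\<^sup>2\<bar> \<le> B"
    by (auto simp: bounded_iff)
  have "(\<integral>\<^sup>+x. indicator unit_disc x * ennreal ((norm (gradient \<phi> x))\<^sup>2 + \<mu> * potential V x * (\<phi> x)\<^sup>2) \<partial>lborel)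
    \<le> (\<integral>\<^sup>+x. ennreal B * indicator K x \<partial>lborel)"
  proof (rule nn_integral_mono)
    fix x
    show "indicator unit_disc x * ennreal ((norm (gradient \<phi> x))\<^sup>2 + \<mu> * potential V x * (\<phi> x)\<^sup>2) \<le> ennreal B * indicator K x"
    proof (cases "x \<in> K")
      case True
      then show ?thesis using B[OF True] K(2) by (auto simp: potential_def intro!: ennreal_leI)
    qed (simp add: K)
  qed
  also have "\<dots> = ennreal B * emeasure lborel K"
    using K(1) by (simp add: nn_integral_cmult_indicator borel_compact)
  also have "\<dots> < \<infinity>" using emeasure_compact_finite[OF K(1)] by (simp add: ennreal_mult_less_top)
  finally show ?thesis .
qed

text \<open>The smallest potential that the hypothesis admits. With |x| = exp (- t) the measure
  \<open>hardy\<close> (|x|) dx becomes dt / t^2 times the angle, which is the weight of the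
  classical Hardy inequality on the half line.\<close>

definition hardy :: "real \<Rightarrow> real" where
  "hardy r = 1 / (r\<^sup>2 * (- ln r)\<^sup>2)"

lemma hardy_ge_1: "0 < r \<Longrightarrow> r < 1 \<Longrightarrow> hardy r \<ge> 1"
proof -
  assume r: "0 < r" "r < 1"
  have "- ln r = ln (1 / r)" using r by (simp add: ln_div)
  also have "\<dots> \<le> 1 / r - 1" using r by (intro ln_le_minus_one) auto
  finally have "r * (- ln r) \<le> 1" using r by (simp add: field_simps)
  moreover have "r * (- ln r) > 0" using r by (simp add: mult_pos_neg)
  ultimately have "(r * (- ln r))\<^sup>2 \<le> 1" "(r * (- ln r))\<^sup>2 > 0"
    using power_le_one[of "r * (- ln r)" 2] zero_less_power[of "r * (- ln r)" 2] by linarith+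
  then show "hardy r \<ge> 1" unfolding hardy_def power_mult_distrib[symmetric] by simp
qed

lemma L2_le_hardy:
  "(\<integral>\<^sup>+x. indicator unit_disc x * ennreal ((v x)\<^sup>2) \<partial>lborel)
    \<le> (\<integral>\<^sup>+x. indicator unit_disc x * ennreal (potential hardy x * (v x)\<^sup>2) \<partial>lborel)"
proof (rule nn_integral_mono_AE)
  show "AE x in lborel. indicator unit_disc x * ennreal ((v x)\<^sup>2) \<le> indicator unit_disc x * ennreal (potential hardy x * (v x)\<^sup>2)"
    using AE_lborel_singleton[of "0::real^2"]
  proof eventually_elim
    fix x :: "real^2" assume "x \<noteq> 0"
    then have "1 * (v x)\<^sup>2 \<le> potential hardy x * (v x)\<^sup>2" if "x \<in> unit_disc"
      using that hardy_ge_1[of "norm x"] by (intro mult_right_mono) (auto simp: potential_def)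
    then show "indicator unit_disc x * ennreal ((v x)\<^sup>2) \<le> indicator unit_disc x * ennreal (potential hardy x * (v x)\<^sup>2)"
      by (auto split: split_indicator intro: ennreal_leI)
  qed
qed

text \<open>All that the upper bounds use about the space. In the conclusion \<open>V\<close> has
  been replaced by \<open>hardy\<close>, which only decreases the energies because \<open>V\<close>
  is the larger potential. The functions are Borel measurable, and convergence is that of gradients
  in L2 and of values in the weighted L2 space.\<close>

lemma H_space_unit_ball_approx:
  assumes \<mu>: "\<mu> > 0" and V: "continuous_on {0<..<1} V" and V1: "\<forall>r\<in>{0<..<1}. V r \<ge> 1 / (r\<^sup>2 * (- ln r)\<^sup>2)"
    and u: "u \<in> H_space V \<mu>" and n1: "H_norm V \<mu> u \<le> 1"
  obtains u' g' \<phi> where "u' \<in> borel_measurable borel" "g' \<in> borel_measurable borel"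
    "AE x in lborel. x \<in> unit_disc \<longrightarrow> u x = u' x"
    "\<And>n::nat. \<phi> n \<in> test_functions (unit_disc - {0})"
    "(\<lambda>n. \<integral>\<^sup>+x. indicator unit_disc x * ennreal ((norm (gradient (\<phi> n) x - g' x))\<^sup>2) \<partial>lborel) \<longlonglongrightarrow> 0"
    "(\<lambda>n. \<integral>\<^sup>+x. indicator unit_disc x * ennreal (potential hardy x * (\<phi> n x - u' x)\<^sup>2) \<partial>lborel) \<longlonglongrightarrow> 0"
    "(\<integral>\<^sup>+x. indicator unit_disc x * ennreal ((norm (g' x))\<^sup>2 + \<mu> * potential hardy x * (u' x)\<^sup>2) \<partial>lborel) \<le> 1"
proof -
  obtain g \<phi> where g: "has_weak_gradient u g unit_disc" and \<phi>: "\<And>n::nat. \<phi> n \<in> test_functions (unit_disc - {0})"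
    and lim: "(\<lambda>n. energy V \<mu> unit_disc (\<lambda>x. \<phi> n x - u x)) \<longlonglongrightarrow> 0"
    using u unfolding H_space_def by auto
  obtain u' where u': "u' \<in> borel_measurable borel" "AE x in lborel. x \<in> unit_disc \<longrightarrow> u x = u' x"
    using g locally_integrable_borel_real unfolding has_weak_gradient_def by blast
  obtain g' where g': "g' \<in> borel_measurable borel" "AE x in lborel. x \<in> unit_disc \<longrightarrow> g x = g' x"
    using g locally_integrable_borel_vec unfolding has_weak_gradient_def by blast
  note [measurable] = u'(1) g'(1) potential_measurable[OF V]
  have [measurable]: "\<phi> n \<in> borel_measurable borel" "gradient (\<phi> n) \<in> borel_measurable borel" for n
    using test_functionsD[OF \<phi>] by auto
  have h0: "0 \<le> potential hardy x" "potential hardy x \<le> potential V x" for x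
    using V1 by (auto simp: potential_def hardy_def)
  have V0: "0 \<le> potential V x" for x using h0[of x] by simp
  have ed: "energy V \<mu> unit_disc (\<lambda>x. \<phi> n x - u x) = (\<integral>\<^sup>+x. indicator unit_disc x *
      ennreal ((norm (gradient (\<phi> n) x - g' x))\<^sup>2 + \<mu> * potential V x * (\<phi> n x - u' x)\<^sup>2) \<partial>lborel)" for n
  proof (rule energy_eq[OF has_weak_gradient_diff[OF has_weak_gradient_smooth g]])
    show "Ck k (\<phi> n)" for k by (rule test_functionsD[OF \<phi>])
    show "AE x in lborel. x \<in> unit_disc \<longrightarrow> \<phi> n x - u x = \<phi> n x - u' x"
      using u'(2) by eventually_elim auto
    show "AE x in lborel. x \<in> unit_disc \<longrightarrow> gradient (\<phi> n) x - g x = gradient (\<phi> n) x - g' x"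
      using g'(2) by eventually_elim auto
  qed simp
  have eu: "energy V \<mu> unit_disc u = (\<integral>\<^sup>+x. indicator unit_disc x *
      ennreal ((norm (g' x))\<^sup>2 + \<mu> * potential V x * (u' x)\<^sup>2) \<partial>lborel)"
    by (rule energy_eq[OF g _ u'(2) g'(2)]) simp
  \<comment> \<open>\<open>enn2real\<close> sends infinity to 0, so the bound on
    \<open>H_norm\<close> says nothing until the energy is known to be finite. It is finite because
    \<open>u\<close> differs from a test function by a function of energy below 1.\<close>
  have fin: "energy V \<mu> unit_disc u < \<infinity>"
  proof -
    have "\<forall>\<^sub>F n in sequentially. energy V \<mu> unit_disc (\<lambda>x. \<phi> n x - u x) < 1"
      using lim by (rule order_tendstoD) simp
    then obtain n where n: "energy V \<mu> unit_disc (\<lambda>x. \<phi> n x - u x) < 1"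
      using eventually_happens'[OF sequentially_bot] by blast
    let ?a = "\<lambda>x. indicator unit_disc x * ennreal ((norm (gradient (\<phi> n) x - g' x))\<^sup>2 + \<mu> * potential V x * (\<phi> n x - u' x)\<^sup>2)"
    let ?b = "\<lambda>x. indicator unit_disc x * ennreal ((norm (gradient (\<phi> n) x))\<^sup>2 + \<mu> * potential V x * (\<phi> n x)\<^sup>2)"
    have "energy V \<mu> unit_disc u \<le> (\<integral>\<^sup>+x. 2 * ?a x + 2 * ?b x \<partial>lborel)"
      unfolding eu
    proof (rule nn_integral_mono)
      fix x
      let ?G = "gradient (\<phi> n) x"
      have sq: "s\<^sup>2 \<le> 2 * (t - s)\<^sup>2 + 2 * t\<^sup>2" for s t :: real
        using zero_le_power2[of "s - 2 * t"] by (simp add: power2_eq_square algebra_simps)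
      have "norm (g' x) \<le> norm (?G - g' x) + norm ?G"
        using norm_triangle_ineq4[of ?G "?G - g' x"] by simp
      then have "(norm (g' x))\<^sup>2 \<le> (norm (?G - g' x) + norm ?G)\<^sup>2" by (rule power_mono) simp
      also have "\<dots> \<le> 2 * (norm (?G - g' x))\<^sup>2 + 2 * (norm ?G)\<^sup>2"
        using sum_squares_bound[of "norm (?G - g' x)" "norm ?G"] by (simp add: power2_eq_square algebra_simps)
      finally have 1: "(norm (g' x))\<^sup>2 \<le> 2 * (norm (?G - g' x))\<^sup>2 + 2 * (norm ?G)\<^sup>2" .
      have 2: "\<mu> * potential V x * (u' x)\<^sup>2 \<le> \<mu> * potential V x * (2 * (\<phi> n x - u' x)\<^sup>2 + 2 * (\<phi> n x)\<^sup>2)"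
        using \<mu> V0[of x] sq[of "u' x" "\<phi> n x"] by (intro mult_left_mono) auto
      have "ennreal ((norm (g' x))\<^sup>2 + \<mu> * potential V x * (u' x)\<^sup>2) \<le>
        ennreal (2 * ((norm (?G - g' x))\<^sup>2 + \<mu> * potential V x * (\<phi> n x - u' x)\<^sup>2) + 2 * ((norm ?G)\<^sup>2 + \<mu> * potential V x * (\<phi> n x)\<^sup>2))"
        using 1 2 by (intro ennreal_leI) (simp add: algebra_simps)
      also have "\<dots> = 2 * ennreal ((norm (?G - g' x))\<^sup>2 + \<mu> * potential V x * (\<phi> n x - u' x)\<^sup>2) + 2 * ennreal ((norm ?G)\<^sup>2 + \<mu> * potential V x * (\<phi> n x)\<^sup>2)"
        using \<mu> V0[of x] by (simp add: ennreal_mult)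
      finally show "indicator unit_disc x * ennreal ((norm (g' x))\<^sup>2 + \<mu> * potential V x * (u' x)\<^sup>2) \<le> 2 * ?a x + 2 * ?b x"
        by (auto split: split_indicator)
    qed
    also have "\<dots> = 2 * (\<integral>\<^sup>+x. ?a x \<partial>lborel) + 2 * (\<integral>\<^sup>+x. ?b x \<partial>lborel)"
      by (subst nn_integral_add, measurable, subst nn_integral_cmult, measurable, subst nn_integral_cmult, measurable)
    also have "\<dots> < \<infinity>"
    proof -
      have "(\<integral>\<^sup>+x. ?a x \<partial>lborel) < top" using n[unfolded ed] ennreal_one_less_top by (rule less_trans)
      moreover have "(\<integral>\<^sup>+x. ?b x \<partial>lborel) < top"
        using test_energy_finite[OF V less_imp_le[OF \<mu>] \<phi>[of n]] by simp
      ultimately show ?thesis by (simp add: ennreal_mult_less_top)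
    qed
    finally show ?thesis .
  qed
  have le1: "energy V \<mu> unit_disc u \<le> 1"
  proof -
    have "enn2real (energy V \<mu> unit_disc u) \<le> 1" using n1 unfolding H_norm_def by simp
    then show ?thesis using fin by (metis ennreal_1 ennreal_enn2real ennreal_leI infinity_ennreal_def)
  qed
  have lim1: "(\<lambda>n. \<integral>\<^sup>+x. indicator unit_disc x * ennreal ((norm (gradient (\<phi> n) x - g' x))\<^sup>2) \<partial>lborel) \<longlonglongrightarrow> 0"
  proof (rule tendsto_sandwich[OF _ _ tendsto_const lim])
    show "\<forall>\<^sub>F n in sequentially. (\<integral>\<^sup>+x. indicator unit_disc x * ennreal ((norm (gradient (\<phi> n) x - g' x))\<^sup>2) \<partial>lborel)
       \<le> energy V \<mu> unit_disc (\<lambda>x. \<phi> n x - u x)"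
      unfolding ed using \<mu> V0 by (intro always_eventually allI nn_integral_mono mult_left_mono ennreal_leI) auto
  qed simp
  have lim2: "(\<lambda>n. \<integral>\<^sup>+x. indicator unit_disc x * ennreal (potential hardy x * (\<phi> n x - u' x)\<^sup>2) \<partial>lborel) \<longlonglongrightarrow> 0"
  proof (rule tendsto_sandwich[OF _ _ tendsto_const])
    show "(\<lambda>n. ennreal (1 / \<mu>) * energy V \<mu> unit_disc (\<lambda>x. \<phi> n x - u x)) \<longlonglongrightarrow> 0"
      using ennreal_tendsto_cmult[OF _ lim, of "ennreal (1 / \<mu>)"] by simp
    show "\<forall>\<^sub>F n in sequentially. (\<integral>\<^sup>+x. indicator unit_disc x * ennreal (potential hardy x * (\<phi> n x - u' x)\<^sup>2) \<partial>lborel)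
       \<le> ennreal (1 / \<mu>) * energy V \<mu> unit_disc (\<lambda>x. \<phi> n x - u x)"
    proof (intro always_eventually allI)
      fix n
      have "(\<integral>\<^sup>+x. indicator unit_disc x * ennreal (potential hardy x * (\<phi> n x - u' x)\<^sup>2) \<partial>lborel)
        \<le> (\<integral>\<^sup>+x. ennreal (1 / \<mu>) * (indicator unit_disc x *
      ennreal ((norm (gradient (\<phi> n) x - g' x))\<^sup>2 + \<mu> * potential V x * (\<phi> n x - u' x)\<^sup>2)) \<partial>lborel)"
      proof (rule nn_integral_mono)
        fix x
        have "potential hardy x * (\<phi> n x - u' x)\<^sup>2 \<le> potential V x * (\<phi> n x - u' x)\<^sup>2"
          using h0 by (intro mult_right_mono) auto
        also have "\<dots> \<le> 1 / \<mu> * ((norm (gradient (\<phi> n) x - g' x))\<^sup>2 + \<mu> * potential V x * (\<phi> n x - u' x)\<^sup>2)"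
          using \<mu> by (simp add: field_simps)
        finally have "ennreal (potential hardy x * (\<phi> n x - u' x)\<^sup>2) \<le> ennreal (1 / \<mu> * ((norm (gradient (\<phi> n) x - g' x))\<^sup>2 + \<mu> * potential V x * (\<phi> n x - u' x)\<^sup>2))"
          by (rule ennreal_leI)
        then show "indicator unit_disc x * ennreal (potential hardy x * (\<phi> n x - u' x)\<^sup>2)
          \<le> ennreal (1 / \<mu>) * (indicator unit_disc x *
      ennreal ((norm (gradient (\<phi> n) x - g' x))\<^sup>2 + \<mu> * potential V x * (\<phi> n x - u' x)\<^sup>2))"
          unfolding ennreal_mult'[OF less_imp_le[OF divide_pos_pos[OF zero_less_one \<mu>]]]
          by (auto split: split_indicator)
      qed
      also have "\<dots> = ennreal (1 / \<mu>) * energy V \<mu> unit_disc (\<lambda>x. \<phi> n x - u x)"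
        unfolding ed by (rule nn_integral_cmult) measurable
      finally show "(\<integral>\<^sup>+x. indicator unit_disc x * ennreal (potential hardy x * (\<phi> n x - u' x)\<^sup>2) \<partial>lborel)
       \<le> ennreal (1 / \<mu>) * energy V \<mu> unit_disc (\<lambda>x. \<phi> n x - u x)" .
    qed
  qed simp
  have "(\<integral>\<^sup>+x. indicator unit_disc x * ennreal ((norm (g' x))\<^sup>2 + \<mu> * potential hardy x * (u' x)\<^sup>2) \<partial>lborel) \<le> energy V \<mu> unit_disc u"
    unfolding eu using h0 \<mu> by (intro nn_integral_mono mult_left_mono ennreal_leI add_left_mono mult_right_mono) auto
  with le1 have "(\<integral>\<^sup>+x. indicator unit_disc x * ennreal ((norm (g' x))\<^sup>2 + \<mu> * potential hardy x * (u' x)\<^sup>2) \<partial>lborel) \<le> 1" by simp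
  then show thesis using that[OF u'(1) g'(1) u'(2) \<phi> lim1 lim2] by blast
qed

section \<open>The bound for general functions\<close>

lemma nn_integral_FTC_abs_le:
  fixes w :: "real \<Rightarrow> real"
  assumes "a \<le> b" "\<And>t. a \<le> t \<Longrightarrow> t \<le> b \<Longrightarrow> (w has_real_derivative w' t) (at t)" "continuous_on {a..b} w'"
  shows "ennreal \<bar>w b - w a\<bar> \<le> (\<integral>\<^sup>+t. indicator {a..b} t * ennreal \<bar>w' t\<bar> \<partial>lborel)"
proof -
  have h: "has_bochner_integral lborel (\<lambda>x. indicator {a..b} x *\<^sub>R w' x) (w b - w a)"
    using assms by (intro has_bochner_integral_FTC_Icc)
      (auto simp: has_real_derivative_iff_has_vector_derivative intro: has_vector_derivative_at_within)
  then have i: "integrable lborel (\<lambda>x. indicator {a..b} x *\<^sub>R w' x)" and e: "(LINT x|lborel. indicator {a..b} x *\<^sub>R w' x) = w b - w a"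
    by (auto simp: has_bochner_integral_iff)
  have "ennreal (norm (LINT x|lborel. indicator {a..b} x *\<^sub>R w' x)) \<le> (\<integral>\<^sup>+x. ennreal (norm (indicator {a..b} x *\<^sub>R w' x)) \<partial>lborel)"
    using i by (rule integral_norm_bound_ennreal)
  also have "\<dots> = (\<integral>\<^sup>+t. indicator {a..b} t * ennreal \<bar>w' t\<bar> \<partial>lborel)"
    by (intro nn_integral_cong) (auto split: split_indicator)
  finally show ?thesis unfolding e by simp
qed

lemma ennreal_power2_tendsto_0:
  fixes a b :: "nat \<Rightarrow> ennreal"
  assumes "\<And>n. (a n)\<^sup>2 \<le> b n" "b \<longlonglongrightarrow> 0"
  shows "a \<longlonglongrightarrow> 0"
proof (rule order_tendstoI)
  fix e :: ennreal assume "0 < e"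
  then have "0 < e\<^sup>2" by (simp add: zero_less_iff_neq_zero)
  then have "\<forall>\<^sub>F n in sequentially. b n < e\<^sup>2" using assms(2) by (rule order_tendstoD(2)[rotated])
  then show "\<forall>\<^sub>F n in sequentially. a n < e"
  proof eventually_elim
    case (elim n)
    show ?case
    proof (rule ccontr)
      assume "\<not> a n < e"
      then have "e\<^sup>2 \<le> (a n)\<^sup>2" by (intro power_mono) auto
      with assms(1)[of n] elim show False by auto
    qed
  qed
qed simp

text \<open>Tested against \<open>K\<close> and \<open>E\<close>, both errors are integrals of
  products of L2 functions: \<open>r n\<close> against \<open>K\<close>, and the difference of
  \<open>\<phi> n\<close> and \<open>u\<close> against the indicator of \<open>E\<close>, a set of
  measure at most pi. The Cauchy-Schwarz inequality sends them to 0, with no pointwise convergence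
  involved.\<close>

lemma kernel_bound_limit:
  fixes u :: "real^2 \<Rightarrow> real" and K f :: "real^2 \<Rightarrow> ennreal"
  assumes [measurable]: "E \<in> sets borel" "u \<in> borel_measurable borel" "\<And>n. \<phi> n \<in> borel_measurable borel"
      "K \<in> borel_measurable borel" "f \<in> borel_measurable borel" "\<And>n. r n \<in> borel_measurable borel"
    and E: "E \<subseteq> unit_disc"
    and rep: "\<And>n. (\<integral>\<^sup>+x. indicator E x * ennreal \<bar>\<phi> n x\<bar> \<partial>lborel) \<le> (\<integral>\<^sup>+y. K y * F n y \<partial>lborel)"
    and F: "\<And>n y. F n y \<le> f y + r n y"
    and r: "(\<lambda>n. \<integral>\<^sup>+y. (r n y)\<^sup>2 \<partial>lborel) \<longlonglongrightarrow> 0"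
    and L2: "(\<lambda>n. \<integral>\<^sup>+x. indicator unit_disc x * ennreal ((\<phi> n x - u x)\<^sup>2) \<partial>lborel) \<longlonglongrightarrow> 0"
    and K: "(\<integral>\<^sup>+y. (K y)\<^sup>2 \<partial>lborel) < \<infinity>"
  shows "(\<integral>\<^sup>+x. indicator E x * ennreal \<bar>u x\<bar> \<partial>lborel) \<le> (\<integral>\<^sup>+y. K y * f y \<partial>lborel)"
proof -
  let ?a = "\<lambda>n. \<integral>\<^sup>+y. K y * r n y \<partial>lborel"
  let ?b = "\<lambda>n. \<integral>\<^sup>+x. indicator E x * ennreal \<bar>\<phi> n x - u x\<bar> \<partial>lborel"
  have a: "?a \<longlonglongrightarrow> 0"
  proof (rule ennreal_power2_tendsto_0)
    show "(?a n)\<^sup>2 \<le> (\<integral>\<^sup>+y. (K y)\<^sup>2 \<partial>lborel) * (\<integral>\<^sup>+y. (r n y)\<^sup>2 \<partial>lborel)" for n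
      by (rule Cauchy_Schwarz_nn_integral) measurable
    show "(\<lambda>n. (\<integral>\<^sup>+y. (K y)\<^sup>2 \<partial>lborel) * (\<integral>\<^sup>+y. (r n y)\<^sup>2 \<partial>lborel)) \<longlonglongrightarrow> 0"
      using ennreal_tendsto_cmult[OF _ r, of "\<integral>\<^sup>+y. (K y)\<^sup>2 \<partial>lborel"] K by simp
  qed
  have b: "?b \<longlonglongrightarrow> 0"
  proof (rule ennreal_power2_tendsto_0)
    fix n
    have "(?b n)\<^sup>2 \<le> (\<integral>\<^sup>+x. (indicator E x)\<^sup>2 \<partial>lborel) * (\<integral>\<^sup>+x. (indicator unit_disc x * ennreal \<bar>\<phi> n x - u x\<bar>)\<^sup>2 \<partial>lborel)"
    proof -
      have "?b n = (\<integral>\<^sup>+x. indicator E x * (indicator unit_disc x * ennreal \<bar>\<phi> n x - u x\<bar>) \<partial>lborel)"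
        using E by (intro nn_integral_cong) (auto split: split_indicator)
      then show ?thesis by (simp only:) (rule Cauchy_Schwarz_nn_integral; measurable)
    qed
    also have "(\<integral>\<^sup>+x. (indicator unit_disc x * ennreal \<bar>\<phi> n x - u x\<bar>)\<^sup>2 \<partial>lborel) = (\<integral>\<^sup>+x. indicator unit_disc x * ennreal ((\<phi> n x - u x)\<^sup>2) \<partial>lborel)"
      by (intro nn_integral_cong) (auto simp: ennreal_power split: split_indicator)
    also have "(\<integral>\<^sup>+x. (indicator E x)\<^sup>2 \<partial>lborel) \<le> ennreal pi"
    proof -
      have "(\<integral>\<^sup>+x. (indicator E x)\<^sup>2 \<partial>lborel) = (\<integral>\<^sup>+x. indicator E x \<partial>lborel)"
        by (intro nn_integral_cong) (auto split: split_indicator)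
      also have "\<dots> \<le> emeasure lborel unit_disc" using E by (simp add: emeasure_mono)
      finally show ?thesis by (simp add: emeasure_ball_plane)
    qed
    finally show "(?b n)\<^sup>2 \<le> ennreal pi * (\<integral>\<^sup>+x. indicator unit_disc x * ennreal ((\<phi> n x - u x)\<^sup>2) \<partial>lborel)"
      by (simp add: mult_right_mono)
  next
    show "(\<lambda>n. ennreal pi * (\<integral>\<^sup>+x. indicator unit_disc x * ennreal ((\<phi> n x - u x)\<^sup>2) \<partial>lborel)) \<longlonglongrightarrow> 0"
      using ennreal_tendsto_cmult[OF _ L2, of "ennreal pi"] by simp
  qed
  have "(\<integral>\<^sup>+x. indicator E x * ennreal \<bar>u x\<bar> \<partial>lborel) \<le> (\<integral>\<^sup>+y. K y * f y \<partial>lborel) + ?a n + ?b n" for n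
  proof -
    have "(\<integral>\<^sup>+x. indicator E x * ennreal \<bar>u x\<bar> \<partial>lborel)
      \<le> (\<integral>\<^sup>+x. indicator E x * ennreal \<bar>\<phi> n x\<bar> + indicator E x * ennreal \<bar>\<phi> n x - u x\<bar> \<partial>lborel)"
      by (intro nn_integral_mono) (auto split: split_indicator simp flip: ennreal_plus intro!: ennreal_leI)
    also have "\<dots> = (\<integral>\<^sup>+x. indicator E x * ennreal \<bar>\<phi> n x\<bar> \<partial>lborel) + ?b n"
      by (rule nn_integral_add) measurable
    also have "\<dots> \<le> (\<integral>\<^sup>+y. K y * F n y \<partial>lborel) + ?b n"
      by (intro add_right_mono rep)
    also have "(\<integral>\<^sup>+y. K y * F n y \<partial>lborel) \<le> (\<integral>\<^sup>+y. K y * f y + K y * r n y \<partial>lborel)"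
      by (intro nn_integral_mono) (auto simp flip: distrib_left intro!: mult_left_mono F)
    also have "\<dots> = (\<integral>\<^sup>+y. K y * f y \<partial>lborel) + ?a n"
      by (rule nn_integral_add) measurable
    finally show ?thesis by (simp add: add_right_mono)
  qed
  moreover have "(\<lambda>n. (\<integral>\<^sup>+y. K y * f y \<partial>lborel) + ?a n + ?b n) \<longlonglongrightarrow> (\<integral>\<^sup>+y. K y * f y \<partial>lborel) + 0 + 0"
    by (intro tendsto_add tendsto_const a b)
  ultimately show ?thesis
    using LIMSEQ_le_const[of "\<lambda>n. (\<integral>\<^sup>+y. K y * f y \<partial>lborel) + ?a n + ?b n"] by fastforce
qed

text \<open>The bound \<open>h\<close> is asked for off the diagonal only, as single points are
  null. This matters for the Riesz kernel: at x = x' its Gram integral is infinite, whereas the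
  logarithmic bound takes a finite value there through the default \<open>ln 0 = 0\<close>.\<close>

lemma gram_Fubini_le:
  fixes k :: "real^2 \<Rightarrow> real^2 \<Rightarrow> ennreal"
  assumes [measurable]: "(\<lambda>(x, y). k x y) \<in> borel_measurable (borel \<Otimes>\<^sub>M borel)" "E \<in> sets borel" "F \<in> sets borel"
    and h: "\<And>x x'. x \<in> E \<Longrightarrow> x' \<in> F \<Longrightarrow> x \<noteq> x' \<Longrightarrow> (\<integral>\<^sup>+y. k x y * k x' y \<partial>lborel) \<le> h x x'"
    and c: "\<And>x'. x' \<in> F \<Longrightarrow> (\<integral>\<^sup>+x. indicator E x * h x x' \<partial>lborel) \<le> c"
  shows "(\<integral>\<^sup>+y. (\<integral>\<^sup>+x. indicator E x * k x y \<partial>lborel) * (\<integral>\<^sup>+x. indicator F x * k x y \<partial>lborel) \<partial>lborel)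
    \<le> c * emeasure lborel F"
proof -
  have "(\<integral>\<^sup>+y. (\<integral>\<^sup>+x. indicator E x * k x y \<partial>lborel) * (\<integral>\<^sup>+x. indicator F x * k x y \<partial>lborel) \<partial>lborel)
    = (\<integral>\<^sup>+y. (\<integral>\<^sup>+x'. (\<integral>\<^sup>+x. indicator F x' * (indicator E x * (k x y * k x' y)) \<partial>lborel) \<partial>lborel) \<partial>lborel)"
  proof (rule nn_integral_cong)
    fix y
    have "(\<integral>\<^sup>+x. indicator E x * k x y \<partial>lborel) * (\<integral>\<^sup>+x. indicator F x * k x y \<partial>lborel)
      = (\<integral>\<^sup>+x'. (\<integral>\<^sup>+x. indicator E x * k x y \<partial>lborel) * (indicator F x' * k x' y) \<partial>lborel)"
      by (rule nn_integral_cmult[symmetric]) measurable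
    also have "\<dots> = (\<integral>\<^sup>+x'. (\<integral>\<^sup>+x. indicator E x * k x y * (indicator F x' * k x' y) \<partial>lborel) \<partial>lborel)"
      by (intro nn_integral_cong nn_integral_multc[symmetric]) measurable
    finally show "(\<integral>\<^sup>+x. indicator E x * k x y \<partial>lborel) * (\<integral>\<^sup>+x. indicator F x * k x y \<partial>lborel)
      = (\<integral>\<^sup>+x'. (\<integral>\<^sup>+x. indicator F x' * (indicator E x * (k x y * k x' y)) \<partial>lborel) \<partial>lborel)"
      by (simp add: mult_ac)
  qed
  also have "\<dots> = (\<integral>\<^sup>+x'. (\<integral>\<^sup>+y. (\<integral>\<^sup>+x. indicator F x' * (indicator E x * (k x y * k x' y)) \<partial>lborel) \<partial>lborel) \<partial>lborel)"
    by (rule lborel_pair.Fubini') measurable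
  also have "\<dots> = (\<integral>\<^sup>+x'. (\<integral>\<^sup>+x. (\<integral>\<^sup>+y. indicator F x' * (indicator E x * (k x y * k x' y)) \<partial>lborel) \<partial>lborel) \<partial>lborel)"
    by (rule nn_integral_cong, rule lborel_pair.Fubini') measurable
  also have "\<dots> = (\<integral>\<^sup>+x'. indicator F x' * (\<integral>\<^sup>+x. indicator E x * (\<integral>\<^sup>+y. k x y * k x' y \<partial>lborel) \<partial>lborel) \<partial>lborel)"
    by (subst nn_integral_cmult, measurable)+
  also have "\<dots> \<le> (\<integral>\<^sup>+x'. indicator F x' * c \<partial>lborel)"
  proof (rule nn_integral_mono)
    fix x'
    show "indicator F x' * (\<integral>\<^sup>+x. indicator E x * (\<integral>\<^sup>+y. k x y * k x' y \<partial>lborel) \<partial>lborel) \<le> indicator F x' * c"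
    proof (cases "x' \<in> F")
      case True
      have "(\<integral>\<^sup>+x. indicator E x * (\<integral>\<^sup>+y. k x y * k x' y \<partial>lborel) \<partial>lborel) \<le> (\<integral>\<^sup>+x. indicator E x * h x x' \<partial>lborel)"
      proof (rule nn_integral_mono_AE)
        show "AE x in lborel. indicator E x * (\<integral>\<^sup>+y. k x y * k x' y \<partial>lborel) \<le> indicator E x * h x x'"
          using AE_lborel_singleton[of x'] by eventually_elim (use h True in \<open>auto split: split_indicator\<close>)
      qed
      also have "\<dots> \<le> c" by (rule c[OF True])
      finally show ?thesis using True by simp
    qed simp
  qed
  also have "\<dots> = c * emeasure lborel F" by (simp add: mult.commute[of _ c] nn_integral_cmult_indicator)
  finally show ?thesis .
qed

text \<open>\<open>rep\<close> concerns superlevel sets of \<open>u\<close>. If \<open>u\<close> is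
  a function of the norm, these are rotation invariant, and for such sets the radial representation
  is available although \<open>\<phi> n\<close> is not radial. \<open>gram\<close> serves twice: in
  the exponential bound and, with both sets equal, for the square integrability demanded by
  \<open>kernel_bound_limit\<close>.\<close>

lemma moser_bound_from_kernel:
  fixes u :: "real^2 \<Rightarrow> real" and k :: "real^2 \<Rightarrow> real^2 \<Rightarrow> ennreal"
  assumes u [measurable]: "u \<in> borel_measurable borel" and \<phi> [measurable]: "\<And>n. \<phi> n \<in> borel_measurable borel"
    and k [measurable]: "(\<lambda>(x, y). k x y) \<in> borel_measurable (borel \<Otimes>\<^sub>M borel)"
    and f [measurable]: "f \<in> borel_measurable borel" and f1: "(\<integral>\<^sup>+y. (f y)\<^sup>2 \<partial>lborel) \<le> 1"
    and r [measurable]: "\<And>n. r n \<in> borel_measurable borel" and r0: "(\<lambda>n. \<integral>\<^sup>+y. (r n y)\<^sup>2 \<partial>lborel) \<longlonglongrightarrow> 0"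
    and F: "\<And>n y. F n y \<le> f y + r n y"
    and L2: "(\<lambda>n. \<integral>\<^sup>+x. indicator unit_disc x * ennreal ((\<phi> n x - u x)\<^sup>2) \<partial>lborel) \<longlonglongrightarrow> 0"
    and c: "c > 0" and C: "C \<ge> 0"
    and rep: "\<And>n E \<tau>. E = {x \<in> unit_disc. \<bar>u x\<bar> > \<tau>} \<Longrightarrow>
      (\<integral>\<^sup>+x. indicator E x * ennreal \<bar>\<phi> n x\<bar> \<partial>lborel) \<le> (\<integral>\<^sup>+y. (\<integral>\<^sup>+x. indicator E x * k x y \<partial>lborel) * F n y \<partial>lborel)"
    and gram: "\<And>E F T. E \<in> sets borel \<Longrightarrow> F \<in> sets borel \<Longrightarrow> E \<subseteq> unit_disc \<Longrightarrow> F \<subseteq> unit_disc \<Longrightarrow>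
      T \<ge> 0 \<Longrightarrow> emeasure lborel E = ennreal (pi * exp (- (2 * T))) \<Longrightarrow>
      (\<integral>\<^sup>+y. (\<integral>\<^sup>+x. indicator E x * k x y \<partial>lborel) * (\<integral>\<^sup>+x. indicator F x * k x y \<partial>lborel) \<partial>lborel)
        \<le> emeasure lborel E * emeasure lborel F * ennreal ((T + C) / c)"
  shows "(\<integral>\<^sup>+x. indicator unit_disc x * ennreal (exp (2 * c * (u x)\<^sup>2)) \<partial>lborel) \<le> ennreal (critical_const C)"
proof -
  have "(\<integral>\<^sup>+x. indicator unit_disc x * ennreal (exp (2 * c * \<bar>u x\<bar>\<^sup>2)) \<partial>lborel) \<le> ennreal (critical_const C)"
  proof (rule critical_exp_integral_le[OF _ _ k f f1 c _ gram C])
    fix \<tau> :: real and E assume E: "E = {x \<in> unit_disc. \<tau> < \<bar>u x\<bar>}"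
    have [measurable]: "E \<in> sets borel" unfolding E by measurable
    have E_sub: "E \<subseteq> unit_disc" by (auto simp: E)
    define e where "e = measure lborel E"
    have "emeasure lborel E \<le> ennreal pi"
      using emeasure_mono[OF E_sub, of lborel] by (simp add: emeasure_ball_plane)
    then have ee: "emeasure lborel E = ennreal e"
      unfolding e_def by (intro emeasure_eq_ennreal_measure) (auto simp: top_unique)
    have e: "0 \<le> e" "e \<le> pi" using \<open>emeasure lborel E \<le> ennreal pi\<close> by (auto simp: e_def ee)
    show "(\<integral>\<^sup>+x. indicator E x * ennreal \<bar>u x\<bar> \<partial>lborel) \<le> (\<integral>\<^sup>+y. (\<integral>\<^sup>+x. indicator E x * k x y \<partial>lborel) * f y \<partial>lborel)"
    \<comment> \<open>\<open>T\<close> is a logarithm of the measure, so null sets are treated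
      apart.\<close>
    proof (cases "e = 0")
      case True
      have "AE x in lborel. x \<notin> E" using ee True by (intro AE_not_in) (simp add: null_sets_def)
      then have "(\<integral>\<^sup>+x. indicator E x * ennreal \<bar>u x\<bar> \<partial>lborel) = 0"
        by (subst nn_integral_0_iff_AE) (auto elim!: eventually_mono)
      then show ?thesis by simp
    next
      case False
      then have e': "e > 0" using e by simp
      define T where "T = - ln (e / pi) / 2"
      have T: "T \<ge> 0" "emeasure lborel E = ennreal (pi * exp (- (2 * T)))"
        using e e' by (auto simp: T_def ee)
      show ?thesis
      proof (rule kernel_bound_limit[where \<phi> = \<phi> and r = r and F = F, OF _ u \<phi> _ f r E_sub rep[OF E] F r0 L2])
        have "(\<integral>\<^sup>+y. (\<integral>\<^sup>+x. indicator E x * k x y \<partial>lborel)\<^sup>2 \<partial>lborel) \<le> emeasure lborel E * emeasure lborel E * ennreal ((T + C) / c)"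
          unfolding power2_eq_square by (rule gram[OF _ _ E_sub E_sub T]) measurable
        also have "\<dots> < \<infinity>" by (simp add: ee ennreal_mult_less_top)
        finally show "(\<integral>\<^sup>+y. (\<integral>\<^sup>+x. indicator E x * k x y \<partial>lborel)\<^sup>2 \<partial>lborel) < \<infinity>" .
      qed measurable
    qed
  qed auto
  then show ?thesis by simp
qed

lemma exp_integral_eq:
  assumes "AE x in lborel. x \<in> unit_disc \<longrightarrow> u x = u' x"
  shows "exp_integral \<alpha> u = (\<integral>\<^sup>+x. indicator unit_disc x * ennreal (exp (\<alpha> * (u' x)\<^sup>2)) \<partial>lborel)"
proof -
  have "exp_integral \<alpha> u = (\<integral>\<^sup>+x. indicator unit_disc x * ennreal (exp (\<alpha> * (u' x)\<^sup>2)) \<partial>lebesgue)"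
    unfolding exp_integral_def
    by (rule nn_integral_cong_AE, use AE_completion[OF assms] in eventually_elim) (auto split: split_indicator)
  then show ?thesis by (simp add: nn_integral_completion)
qed

section \<open>The Riesz potential of the gradient\<close>

text \<open>Along each ray from \<open>x\<close> to infinity, |\<phi> x| is at most the integral of
  the norm of the gradient. Averaging over the directions in polar coordinates around
  \<open>x\<close> turns exp (- t) dt into dz / (2 pi |z|).\<close>

lemma abs_le_riesz_potential_gradient:
  fixes \<phi> :: "real^2 \<Rightarrow> real"
  assumes \<phi>: "\<phi> \<in> test_functions U"
  shows "ennreal \<bar>\<phi> x\<bar> \<le> (\<integral>\<^sup>+y. ennreal (1 / (2 * pi * norm (y - x))) * ennreal (norm (gradient \<phi> y)) \<partial>lborel)"
proof -
  obtain K where K: "compact K" "K \<subseteq> U" "\<And>x. x \<notin> K \<Longrightarrow> \<phi> x = 0" "\<And>x. x \<notin> K \<Longrightarrow> gradient \<phi> x = 0"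
    using test_functions_support[OF \<phi>] by blast
  note p = test_functionsD[OF \<phi>]
  note [measurable] = p(5,6)
  obtain R where R: "\<And>y. y \<in> K \<Longrightarrow> norm y \<le> R" using compact_imp_bounded[OF K(1)] by (auto simp: bounded_iff)
  have ray: "ennreal \<bar>\<phi> x\<bar> \<le> (\<integral>\<^sup>+t. ennreal (exp (-t)) * ennreal (norm (gradient \<phi> (x + exp (-t) *\<^sub>R e))) \<partial>lborel)"
    (is "_ \<le> ?I") if e: "norm e = 1" for e
  proof -
    define w w' where "w t = \<phi> (x + exp (-t) *\<^sub>R e)" and "w' t = - exp (-t) * (e \<bullet> gradient \<phi> (x + exp (-t) *\<^sub>R e))" for t
    have d: "(w has_real_derivative w' t) (at t)" for t
    proof -
      have 1: "((\<lambda>s. \<phi> (x + s *\<^sub>R e)) has_real_derivative (e \<bullet> gradient \<phi> (x + exp (-t) *\<^sub>R e))) (at (exp (-t)))"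
        by (rule GDERIV_has_real_derivative_line) (rule p)
      have 2: "((\<lambda>t. exp (-t)) has_real_derivative - exp (-t)) (at t)"
        by (auto intro!: derivative_eq_intros)
      show ?thesis unfolding w_def w'_def using DERIV_chain2[OF 1 2] by (simp add: mult.commute)
    qed
    have cw': "continuous_on S w'" for S
      unfolding w'_def by (intro continuous_intros continuous_on_compose2[OF p(4)]) auto
    \<comment> \<open>At this parameter the point of the ray is at distance |x| + |R| + 1 from
      \<open>x\<close>, hence outside the ball that contains the support.\<close>
    define a where "a = - ln (norm x + \<bar>R\<bar> + 1)"
    have wa: "w a = 0"
    proof -
      have "norm (exp (-a) *\<^sub>R e) = norm x + \<bar>R\<bar> + 1" using e by (simp add: a_def add_nonneg_pos)
      moreover have "norm (exp (-a) *\<^sub>R e) \<le> norm (x + exp (-a) *\<^sub>R e) + norm x"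
        using norm_triangle_ineq4[of "x + exp (-a) *\<^sub>R e" x] by simp
      ultimately have "norm (x + exp (-a) *\<^sub>R e) > R" by linarith
      then show ?thesis unfolding w_def using K(3) R by fastforce
    qed
    have le: "ennreal \<bar>w b\<bar> \<le> ?I" if "a \<le> b" for b
    proof -
      have "ennreal \<bar>w b - w a\<bar> \<le> (\<integral>\<^sup>+t. indicator {a..b} t * ennreal \<bar>w' t\<bar> \<partial>lborel)"
        by (rule nn_integral_FTC_abs_le[OF that d cw'])
      also have "\<dots> \<le> ?I"
      proof (rule nn_integral_mono)
        fix t
        have "\<bar>w' t\<bar> \<le> exp (-t) * norm (gradient \<phi> (x + exp (-t) *\<^sub>R e))"
          using Cauchy_Schwarz_ineq2[of e] e by (simp add: w'_def abs_mult)
        then show "indicator {a..b} t * ennreal \<bar>w' t\<bar> \<le> ennreal (exp (-t)) * ennreal (norm (gradient \<phi> (x + exp (-t) *\<^sub>R e)))"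
          by (auto split: split_indicator simp flip: ennreal_mult intro: ennreal_leI)
      qed
      finally show ?thesis using wa by simp
    qed
    have lim: "((\<lambda>b. ennreal \<bar>w b\<bar>) \<longlongrightarrow> ennreal \<bar>\<phi> x\<bar>) at_top"
    proof -
      have "((\<lambda>t. exp (-t)) \<longlongrightarrow> (0::real)) at_top" by real_asymp
      then have "((\<lambda>b. x + exp (-b) *\<^sub>R e) \<longlongrightarrow> x + 0 *\<^sub>R e) at_top" by (intro tendsto_intros)
      then have "((\<lambda>b. \<phi> (x + exp (-b) *\<^sub>R e)) \<longlongrightarrow> \<phi> x) at_top"
        using continuous_on_tendsto_compose[OF p(3), of "\<lambda>b. x + exp (-b) *\<^sub>R e" x] by simp
      then show ?thesis unfolding w_def by (intro tendsto_ennrealI tendsto_rabs)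
    qed
    show ?thesis
      by (rule tendsto_upperbound[OF lim eventually_mono[OF eventually_ge_at_top[of a] le]]) auto
  qed
  define F where "F z = ennreal (1 / (2 * pi * norm z)) * ennreal (norm (gradient \<phi> (x + z)))" for z
  have [measurable]: "F \<in> borel_measurable borel" unfolding F_def by measurable
  \<comment> \<open>The constant is spread over the disc with weight 1 / (2 pi), so that it can be
    compared with the integral over directions in \<open>log_polar\<close>; the area pi and the
    factor 2 cancel the weight.\<close>
  have "ennreal \<bar>\<phi> x\<bar> = 2 * (\<integral>\<^sup>+y. indicator (unit_disc::(real^2) set) y * (ennreal (1 / (2 * pi)) * ennreal \<bar>\<phi> x\<bar>) \<partial>lborel)"
  proof -
    have "2 * (\<integral>\<^sup>+y. indicator (unit_disc::(real^2) set) y * (ennreal (1 / (2 * pi)) * ennreal \<bar>\<phi> x\<bar>) \<partial>lborel)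
      = ennreal 2 * (ennreal pi * (ennreal (1 / (2 * pi)) * ennreal \<bar>\<phi> x\<bar>))"
      by (subst nn_integral_multc) (simp_all add: ball_borel emeasure_ball_plane)
    also have "\<dots> = ennreal \<bar>\<phi> x\<bar>" by (simp flip: ennreal_mult del: ennreal_numeral)
    finally show ?thesis ..
  qed
  also have "\<dots> \<le> 2 * (\<integral>\<^sup>+y. indicator unit_disc y *
      (\<integral>\<^sup>+t. F (exp (-t) *\<^sub>R (y /\<^sub>R norm y)) * ennreal (exp (- (2 * t))) \<partial>lborel) \<partial>lborel)"
  proof (intro mult_left_mono nn_integral_mono_AE)
    show "AE y in lborel. indicator unit_disc y * (ennreal (1 / (2 * pi)) * ennreal \<bar>\<phi> x\<bar>)
      \<le> indicator unit_disc y * (\<integral>\<^sup>+t. F (exp (-t) *\<^sub>R (y /\<^sub>R norm y)) * ennreal (exp (- (2 * t))) \<partial>lborel)"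
      using AE_lborel_singleton[of "0::real^2"]
    proof eventually_elim
      fix y :: "real^2" assume y: "y \<noteq> 0"
      define e where "e = y /\<^sub>R norm y"
      have e: "norm e = 1" using y by (simp add: e_def)
      have "ennreal (1 / (2 * pi)) * ennreal \<bar>\<phi> x\<bar> \<le> ennreal (1 / (2 * pi)) * (\<integral>\<^sup>+t. ennreal (exp (-t)) * ennreal (norm (gradient \<phi> (x + exp (-t) *\<^sub>R e))) \<partial>lborel)"
        by (intro mult_left_mono ray e) simp
      also have "\<dots> = (\<integral>\<^sup>+t. ennreal (1 / (2 * pi)) * (ennreal (exp (-t)) * ennreal (norm (gradient \<phi> (x + exp (-t) *\<^sub>R e)))) \<partial>lborel)"
        by (rule nn_integral_cmult[symmetric]) measurable
      also have "\<dots> = (\<integral>\<^sup>+t. F (exp (-t) *\<^sub>R e) * ennreal (exp (- (2 * t))) \<partial>lborel)"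
      proof (rule nn_integral_cong)
        fix t :: real
        have "1 / (2 * pi * exp (-t)) * exp (- (2 * t)) = 1 / (2 * pi) * exp (-t)"
          by (simp add: exp_minus field_simps power2_eq_square flip: exp_add)
        then have "1 / (2 * pi * exp (-t)) * n * exp (- (2 * t)) = 1 / (2 * pi) * (exp (-t) * n)" for n
          by (metis mult.assoc mult.commute)
        then show "ennreal (1 / (2 * pi)) * (ennreal (exp (-t)) * ennreal (norm (gradient \<phi> (x + exp (-t) *\<^sub>R e))))
          = F (exp (-t) *\<^sub>R e) * ennreal (exp (- (2 * t)))"
          unfolding F_def using e by (simp flip: ennreal_mult)
      qed
      finally show "indicator unit_disc y * (ennreal (1 / (2 * pi)) * ennreal \<bar>\<phi> x\<bar>)
        \<le> indicator unit_disc y * (\<integral>\<^sup>+t. F (exp (-t) *\<^sub>R (y /\<^sub>R norm y)) * ennreal (exp (- (2 * t))) \<partial>lborel)"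
        unfolding e_def by (rule mult_left_mono) simp
    qed
  qed simp
  also have "\<dots> = (\<integral>\<^sup>+z. F z \<partial>lborel)" by (rule log_polar[symmetric]) measurable
  also have "\<dots> = (\<integral>\<^sup>+z. ennreal (1 / (2 * pi * norm ((x + z) - x))) * ennreal (norm (gradient \<phi> (x + z))) \<partial>lborel)"
    by (simp add: F_def)
  also have "\<dots> = (\<integral>\<^sup>+y. ennreal (1 / (2 * pi * norm (y - x))) * ennreal (norm (gradient \<phi> y)) \<partial>lborel)"
    by (rule nn_integral_lborel_translate) measurable
  finally show ?thesis .
qed

text \<open>The restriction to the disc changes nothing where gradients vanish outside it, and it
  keeps the product of two kernels integrable at infinity, where each decays like 1 / |y|
  only.\<close>

definition riesz_kernel :: "real^2 \<Rightarrow> real^2 \<Rightarrow> ennreal" where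
  "riesz_kernel x y = indicator unit_disc y * ennreal (1 / (2 * pi * norm (y - x)))"

lemma riesz_kernel_measurable [measurable]:
  "(\<lambda>(x, y). riesz_kernel x y) \<in> borel_measurable (borel \<Otimes>\<^sub>M borel)"
  unfolding riesz_kernel_def by measurable

text \<open>Let d = |x - x'|, and let a, b be the distances of y to the two points. Within d / 2 of
  one point the other is at least d / 2 away, and the two discs of this radius contribute a
  constant. Elsewhere 2 / (a b) \<le> 1 / a^2 + 1 / b^2, where each annulus from d / 2 to 2
  contributes 2 pi ln (4 / d). Half their sum keeps the sharp factor 1 / (2 pi) in front of the
  logarithm; the remaining terms make up 2 + ln 4.\<close>

lemma riesz_kernel_gram:
  assumes x: "x \<in> unit_disc" "x' \<in> unit_disc" "x \<noteq> x'"
  shows "(\<integral>\<^sup>+y. riesz_kernel x y * riesz_kernel x' y \<partial>lborel)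
    \<le> ennreal (1 / (2 * pi)) * ennreal (- ln (norm (x - x')) + (2 + ln 4))"
proof -
  define d where "d = norm (x - x')"
  have d: "d > 0" "d < 2" using x norm_triangle_ineq4[of x x'] by (auto simp: d_def)
  have t: "ennreal (1/2) * ennreal z = ennreal (1/2 * z)" "ennreal (2/d) * ennreal z = ennreal (2/d * z)" for z
    by (rule ennreal_mult'[symmetric], use d in simp)+
  have pl: "ennreal (A + B + C + D) = ennreal A + ennreal B + ennreal C + ennreal D"
    if "A \<ge> 0" "B \<ge> 0" "C \<ge> 0" "D \<ge> 0" for A B C D :: real using that by simp
  define p where "p = ennreal (2 / d)"
  define I where "I z y = indicator (ball z (d/2)) y * ennreal (1 / norm (y - z))" for z y :: "real^2"
  define J where "J z y = indicator (ball z 2 - ball z (d/2)) y * ennreal (1 / (norm (y - z))\<^sup>2)" for z y :: "real^2"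
  have [measurable]: "I z \<in> borel_measurable borel" "J z \<in> borel_measurable borel" for z
    unfolding I_def J_def by measurable
  have I_int: "(\<integral>\<^sup>+y. I z y \<partial>lborel) = ennreal (pi * d)" for z
    unfolding I_def using nn_integral_inverse_norm_ball[of "d/2" z] d by simp
  have J_int: "(\<integral>\<^sup>+y. J z y \<partial>lborel) = ennreal (2 * pi * ln (4 / d))" for z
    unfolding J_def using nn_integral_inverse_norm_square_annulus[of "d/2" 2 z] d by simp
  have "(\<integral>\<^sup>+y. riesz_kernel x y * riesz_kernel x' y \<partial>lborel)
    \<le> (\<integral>\<^sup>+y. ennreal (1 / (4 * pi\<^sup>2)) * (p * I x y + p * I x' y + ennreal (1/2) * J x y + ennreal (1/2) * J x' y) \<partial>lborel)"
  proof (rule nn_integral_mono)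
    fix y
    show "riesz_kernel x y * riesz_kernel x' y
      \<le> ennreal (1 / (4 * pi\<^sup>2)) * (p * I x y + p * I x' y + ennreal (1/2) * J x y + ennreal (1/2) * J x' y)"
    proof (cases "y \<in> unit_disc")
      case True
      define a b where "a = norm (y - x)" and "b = norm (y - x')"
      have ab: "a \<ge> 0" "b \<ge> 0" "d \<le> a + b" "a < 2" "b < 2"
        using True x norm_triangle_ineq4[of y x] norm_triangle_ineq4[of y x'] norm_triangle_ineq4[of "y - x'" "y - x"]
        by (auto simp: a_def b_def d_def)
      have "1 / (a * b) \<le> 2 / d * (indicator {..<d/2} a * (1 / a)) + 2 / d * (indicator {..<d/2} b * (1 / b))
          + 1/2 * (indicator {d/2..} a * (1 / a\<^sup>2)) + 1/2 * (indicator {d/2..} b * (1 / b\<^sup>2))"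
      proof -
        consider "a < d/2" | "b < d/2" "a \<ge> d/2" | "a \<ge> d/2" "b \<ge> d/2" by linarith
        then show ?thesis
        proof cases
          case 1
          then have b: "b \<ge> d/2" using ab by linarith
          have "1 / b \<le> 2 / d" using b d by (simp add: field_simps)
          then have "1 / b * (1 / a) \<le> 2 / d * (1 / a)" using ab by (intro mult_right_mono) auto
          then show ?thesis using 1 b d by (simp add: mult.commute add_increasing2)
        next
          case 2
          have "1 / a \<le> 2 / d" using 2 d by (simp add: field_simps)
          then have "1 / a * (1 / b) \<le> 2 / d * (1 / b)" using ab by (intro mult_right_mono) auto
          then show ?thesis using 2 d by (simp add: mult.commute add_increasing2)
        next
          case 3
          have "2 * (1 / a) * (1 / b) \<le> (1 / a)\<^sup>2 + (1 / b)\<^sup>2" by (rule sum_squares_bound)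
          then show ?thesis using 3 by (simp add: power_divide)
        qed
      qed
      then have "ennreal (1 / (a * b)) \<le> ennreal (2 / d * (indicator {..<d/2} a * (1 / a)) + 2 / d * (indicator {..<d/2} b * (1 / b))
          + 1/2 * (indicator {d/2..} a * (1 / a\<^sup>2)) + 1/2 * (indicator {d/2..} b * (1 / b\<^sup>2)))"
        by (rule ennreal_leI)
      also have "\<dots> = p * I x y + p * I x' y + ennreal (1/2) * J x y + ennreal (1/2) * J x' y"
      proof -
        have i: "I x y = ennreal (indicator {..<d/2} a * (1 / a))" "I x' y = ennreal (indicator {..<d/2} b * (1 / b))"
          by (auto simp: I_def a_def b_def dist_norm norm_minus_commute split: split_indicator)
        have j: "J x y = ennreal (indicator {d/2..} a * (1 / a\<^sup>2))" "J x' y = ennreal (indicator {d/2..} b * (1 / b\<^sup>2))"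
          using ab(4,5) by (auto simp: J_def a_def b_def dist_norm norm_minus_commute split: split_indicator)
        show ?thesis unfolding i j p_def t by (rule pl) (use ab d in auto)
      qed
      finally have "ennreal (1 / (4 * pi\<^sup>2)) * ennreal (1 / (a * b)) \<le> ennreal (1 / (4 * pi\<^sup>2)) * (p * I x y + p * I x' y + ennreal (1/2) * J x y + ennreal (1/2) * J x' y)"
        by (rule mult_left_mono) simp
      moreover have "riesz_kernel x y * riesz_kernel x' y = ennreal (1 / (4 * pi\<^sup>2)) * ennreal (1 / (a * b))"
        using True ab by (simp add: riesz_kernel_def a_def[symmetric] b_def[symmetric] power2_eq_square mult_ac flip: ennreal_mult)
      ultimately show ?thesis by simp
    qed (simp add: riesz_kernel_def)
  qed
  also have "\<dots> = ennreal (1 / (4 * pi\<^sup>2)) * (p * (\<integral>\<^sup>+y. I x y \<partial>lborel) + p * (\<integral>\<^sup>+y. I x' y \<partial>lborel)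
     + ennreal (1/2) * (\<integral>\<^sup>+y. J x y \<partial>lborel) + ennreal (1/2) * (\<integral>\<^sup>+y. J x' y \<partial>lborel))"
    by (simp add: nn_integral_cmult nn_integral_add)
  also have "\<dots> = ennreal (1 / (4 * pi\<^sup>2)) * (p * ennreal (pi * d) + p * ennreal (pi * d)
     + ennreal (1/2) * ennreal (2 * pi * ln (4 / d)) + ennreal (1/2) * ennreal (2 * pi * ln (4 / d)))"
    unfolding I_int J_int ..
  also have "\<dots>
    = ennreal (1 / (4 * pi\<^sup>2) * (2 / d * (pi * d) + 2 / d * (pi * d) + 1/2 * (2 * pi * ln (4 / d)) + 1/2 * (2 * pi * ln (4 / d))))"
  proof -
    have "ennreal (1 / (4 * pi\<^sup>2)) * (ennreal A + ennreal A + ennreal B + ennreal B) = ennreal (1 / (4 * pi\<^sup>2) * (A + A + B + B))"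
      if "A \<ge> 0" "B \<ge> 0" for A B
      unfolding pl[OF that(1,1,2,2), symmetric] by (rule ennreal_mult'[symmetric]) simp
    then show ?thesis unfolding p_def t by this (use d in auto)
  qed
  also have "1 / (4 * pi\<^sup>2) * (2 / d * (pi * d) + 2 / d * (pi * d) + 1/2 * (2 * pi * ln (4 / d)) + 1/2 * (2 * pi * ln (4 / d)))
    = 1 / (2 * pi) * (- ln d + (2 + ln 4))"
    using d by (simp add: ln_div field_simps power2_eq_square)
  also have "ennreal (1 / (2 * pi) * (- ln d + (2 + ln 4))) = ennreal (1 / (2 * pi)) * ennreal (- ln d + (2 + ln 4))"
    by (rule ennreal_mult') simp
  finally show ?thesis unfolding d_def .
qed

text \<open>The potential term of the energy is dropped: \<open>f\<close> is the norm of the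
  gradient, and c = 2 pi. The constant 4 + ln 4 is the 2 + ln 4 of \<open>riesz_kernel_gram\<close>
  plus the 2 of \<open>nn_integral_log_le\<close>.\<close>

lemma moser_trudinger_upper:
  assumes \<mu>: "\<mu> > 0" and V: "continuous_on {0<..<1} V" and V1: "\<forall>r\<in>{0<..<1}. V r \<ge> 1 / (r\<^sup>2 * (- ln r)\<^sup>2)"
    and u: "u \<in> H_space V \<mu>" and n1: "H_norm V \<mu> u \<le> 1"
  shows "exp_integral (4 * pi) u \<le> ennreal (critical_const (4 + ln 4))"
proof (rule H_space_unit_ball_approx[OF assms])
  fix u' g' \<phi>
  assume u': "u' \<in> borel_measurable borel" and g': "g' \<in> borel_measurable borel"
    and eq: "AE x in lborel. x \<in> unit_disc \<longrightarrow> u x = u' x"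
    and \<phi>: "\<And>n::nat. \<phi> n \<in> test_functions (unit_disc - {0})"
    and lim1: "(\<lambda>n. \<integral>\<^sup>+x. indicator unit_disc x * ennreal ((norm (gradient (\<phi> n) x - g' x))\<^sup>2) \<partial>lborel) \<longlonglongrightarrow> 0"
    and lim2: "(\<lambda>n. \<integral>\<^sup>+x. indicator unit_disc x * ennreal (potential hardy x * (\<phi> n x - u' x)\<^sup>2) \<partial>lborel) \<longlonglongrightarrow> 0"
    and le1: "(\<integral>\<^sup>+x. indicator unit_disc x * ennreal ((norm (g' x))\<^sup>2 + \<mu> * potential hardy x * (u' x)\<^sup>2) \<partial>lborel) \<le> 1"
  note [measurable] = u' g' test_functionsD(5,6)[OF \<phi>]
  have h0: "0 \<le> potential hardy x" for x by (auto simp: potential_def hardy_def)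
  have L2: "(\<lambda>n. \<integral>\<^sup>+x. indicator unit_disc x * ennreal ((\<phi> n x - u' x)\<^sup>2) \<partial>lborel) \<longlonglongrightarrow> 0"
  proof (rule tendsto_sandwich[OF _ _ tendsto_const lim2])
    show "\<forall>\<^sub>F n in sequentially. (\<integral>\<^sup>+x. indicator unit_disc x * ennreal ((\<phi> n x - u' x)\<^sup>2) \<partial>lborel)
       \<le> (\<integral>\<^sup>+x. indicator unit_disc x * ennreal (potential hardy x * (\<phi> n x - u' x)\<^sup>2) \<partial>lborel)"
    by (intro always_eventually allI L2_le_hardy)
  qed simp
  have "(\<integral>\<^sup>+x. indicator unit_disc x * ennreal (exp (2 * (2 * pi) * (u' x)\<^sup>2)) \<partial>lborel) \<le> ennreal (critical_const (4 + ln 4))"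
  proof (rule moser_bound_from_kernel[where \<phi> = \<phi> and k = riesz_kernel and f = "\<lambda>y. indicator unit_disc y * ennreal (norm (g' y))"
        and r = "\<lambda>n y. indicator unit_disc y * ennreal (norm (gradient (\<phi> n) y - g' y))"
        and F = "\<lambda>n y. indicator unit_disc y * ennreal (norm (gradient (\<phi> n) y))", OF u' _ _ _ _ _ _ _ L2])
    have "(\<integral>\<^sup>+y. (indicator unit_disc y * ennreal (norm (g' y)))\<^sup>2 \<partial>lborel)
      \<le> (\<integral>\<^sup>+x. indicator unit_disc x * ennreal ((norm (g' x))\<^sup>2 + \<mu> * potential hardy x * (u' x)\<^sup>2) \<partial>lborel)"
      using h0 \<mu> by (intro nn_integral_mono) (auto simp: ennreal_power split: split_indicator intro!: ennreal_leI)
    then show "(\<integral>\<^sup>+y. (indicator unit_disc y * ennreal (norm (g' y)))\<^sup>2 \<partial>lborel) \<le> 1"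
      using le1 by (rule order_trans)
    have "(\<integral>\<^sup>+y. (indicator unit_disc y * ennreal (norm (gradient (\<phi> n) y - g' y)))\<^sup>2 \<partial>lborel)
       = (\<integral>\<^sup>+x. indicator unit_disc x * ennreal ((norm (gradient (\<phi> n) x - g' x))\<^sup>2) \<partial>lborel)" for n
      by (intro nn_integral_cong) (auto simp: ennreal_power split: split_indicator)
    then show "(\<lambda>n. \<integral>\<^sup>+y. (indicator unit_disc y * ennreal (norm (gradient (\<phi> n) y - g' y)))\<^sup>2 \<partial>lborel) \<longlonglongrightarrow> 0"
      using lim1 by simp
    show "indicator unit_disc y * ennreal (norm (gradient (\<phi> n) y)) \<le>
       indicator unit_disc y * ennreal (norm (g' y)) + indicator unit_disc y * ennreal (norm (gradient (\<phi> n) y - g' y))" for n y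
      using norm_triangle_sub[of "gradient (\<phi> n) y" "g' y"]
      by (auto split: split_indicator simp flip: ennreal_plus intro!: ennreal_leI)
    show "(\<integral>\<^sup>+x. indicator E x * ennreal \<bar>\<phi> n x\<bar> \<partial>lborel) \<le> (\<integral>\<^sup>+y. (\<integral>\<^sup>+x. indicator E x * riesz_kernel x y \<partial>lborel) *
        (indicator unit_disc y * ennreal (norm (gradient (\<phi> n) y))) \<partial>lborel)"
      if E: "E = {x \<in> unit_disc. \<tau> < \<bar>u' x\<bar>}" for n E \<tau>
    proof -
      have [measurable]: "E \<in> sets borel" unfolding E by measurable
      obtain K where K: "compact K" "K \<subseteq> unit_disc - {0}" "\<And>x. x \<notin> K \<Longrightarrow> \<phi> n x = 0" "\<And>x. x \<notin> K \<Longrightarrow> gradient (\<phi> n) x = 0"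
        using test_functions_support[OF \<phi>[of n]] by blast
      have "(\<integral>\<^sup>+x. indicator E x * ennreal \<bar>\<phi> n x\<bar> \<partial>lborel)
        \<le> (\<integral>\<^sup>+x. indicator E x * (\<integral>\<^sup>+y. ennreal (1 / (2 * pi * norm (y - x))) * ennreal (norm (gradient (\<phi> n) y)) \<partial>lborel) \<partial>lborel)"
        by (intro nn_integral_mono mult_left_mono abs_le_riesz_potential_gradient[OF \<phi>]) auto
      also have "\<dots> = (\<integral>\<^sup>+x. (\<integral>\<^sup>+y. indicator E x * riesz_kernel x y * (indicator unit_disc y * ennreal (norm (gradient (\<phi> n) y))) \<partial>lborel) \<partial>lborel)"
      proof (rule nn_integral_cong)
        fix x
        have "ennreal (1 / (2 * pi * norm (y - x))) * ennreal (norm (gradient (\<phi> n) y))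
          = riesz_kernel x y * (indicator unit_disc y * ennreal (norm (gradient (\<phi> n) y)))" for y
          using K by (cases "y \<in> K") (auto simp: riesz_kernel_def)
        then show "indicator E x * (\<integral>\<^sup>+y. ennreal (1 / (2 * pi * norm (y - x))) * ennreal (norm (gradient (\<phi> n) y)) \<partial>lborel)
          = (\<integral>\<^sup>+y. indicator E x * riesz_kernel x y * (indicator unit_disc y * ennreal (norm (gradient (\<phi> n) y))) \<partial>lborel)"
          by (simp add: mult.assoc) (subst nn_integral_cmult[symmetric], measurable)
      qed
      also have "\<dots> = (\<integral>\<^sup>+y. (\<integral>\<^sup>+x. indicator E x * riesz_kernel x y * (indicator unit_disc y * ennreal (norm (gradient (\<phi> n) y))) \<partial>lborel) \<partial>lborel)"
        by (rule lborel_pair.Fubini') measurable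
      also have "\<dots> = (\<integral>\<^sup>+y. (\<integral>\<^sup>+x. indicator E x * riesz_kernel x y \<partial>lborel) *
        (indicator unit_disc y * ennreal (norm (gradient (\<phi> n) y))) \<partial>lborel)"
        by (intro nn_integral_cong nn_integral_multc) measurable
      finally show ?thesis .
    qed
    show "(\<integral>\<^sup>+y. (\<integral>\<^sup>+x. indicator E x * riesz_kernel x y \<partial>lborel) * (\<integral>\<^sup>+x. indicator F x * riesz_kernel x y \<partial>lborel) \<partial>lborel)
      \<le> emeasure lborel E * emeasure lborel F * ennreal ((T + (4 + ln 4)) / (2 * pi))"
      if [measurable]: "E \<in> sets borel" "F \<in> sets borel" and sub: "E \<subseteq> unit_disc" "F \<subseteq> unit_disc"
        and T: "T \<ge> 0" "emeasure lborel E = ennreal (pi * exp (- (2 * T)))" for E F T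
    proof -
      have "(\<integral>\<^sup>+y. (\<integral>\<^sup>+x. indicator E x * riesz_kernel x y \<partial>lborel) * (\<integral>\<^sup>+x. indicator F x * riesz_kernel x y \<partial>lborel) \<partial>lborel)
        \<le> (ennreal (1 / (2 * pi)) * (emeasure lborel E * ennreal (T + (2 + ln 4) + 2))) * emeasure lborel F"
      proof (rule gram_Fubini_le[where h = "\<lambda>x x'. ennreal (1 / (2 * pi)) * ennreal (- ln (norm (x - x')) + (2 + ln 4))"])
        fix x' assume "x' \<in> F"
        have "(\<integral>\<^sup>+x. indicator E x * (ennreal (1 / (2 * pi)) * ennreal (- ln (norm (x - x')) + (2 + ln 4))) \<partial>lborel)
          = ennreal (1 / (2 * pi)) * (\<integral>\<^sup>+x. indicator E x * ennreal (- ln (norm (x - x')) + (2 + ln 4)) \<partial>lborel)"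
          by (subst nn_integral_cmult[symmetric], measurable) (simp add: mult_ac)
        also have "\<dots> \<le> ennreal (1 / (2 * pi)) * (emeasure lborel E * ennreal (T + (2 + ln 4) + 2))"
          using T by (intro mult_left_mono nn_integral_log_le) auto
        finally show "(\<integral>\<^sup>+x. indicator E x * (ennreal (1 / (2 * pi)) * ennreal (- ln (norm (x - x')) + (2 + ln 4))) \<partial>lborel)
          \<le> ennreal (1 / (2 * pi)) * (emeasure lborel E * ennreal (T + (2 + ln 4) + 2))" .
      next
        show "(\<integral>\<^sup>+y. riesz_kernel x y * riesz_kernel x' y \<partial>lborel)
          \<le> ennreal (1 / (2 * pi)) * ennreal (- ln (norm (x - x')) + (2 + ln 4))" if "x \<in> E" "x' \<in> F" "x \<noteq> x'" for x x'
          using riesz_kernel_gram[of x x'] that sub by blast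
      qed measurable
      also have "\<dots> = emeasure lborel E * emeasure lborel F * (ennreal (1 / (2 * pi)) * ennreal (T + (2 + ln 4) + 2))"
        by (simp add: mult_ac)
      also have "ennreal (1 / (2 * pi)) * ennreal (T + (2 + ln 4) + 2) = ennreal ((T + (4 + ln 4)) / (2 * pi))"
      proof -
        have "(T + (4 + ln 4)) / (2 * pi) = 1 / (2 * pi) * (T + (2 + ln 4) + 2)" by (simp add: field_simps)
        then show ?thesis by (simp only:) (rule ennreal_mult'[symmetric], simp)
      qed
      finally show ?thesis .
    qed
    show "\<phi> n \<in> borel_measurable borel" for n by measurable
    show "(\<lambda>(x, y). riesz_kernel x y) \<in> borel_measurable (borel \<Otimes>\<^sub>M borel)"
      by (rule riesz_kernel_measurable)
    show "(\<lambda>y. indicator unit_disc y * ennreal (norm (g' y))) \<in> borel_measurable borel" by measurable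
    show "(\<lambda>y. indicator unit_disc y * ennreal (norm (gradient (\<phi> n) y - g' y))) \<in> borel_measurable borel" for n
      by measurable
  qed simp_all
  then show ?thesis by (simp add: exp_integral_eq[OF eq])
qed

section \<open>The bound for radial functions\<close>

text \<open>In the variable t = - ln |x| a compact subset of the punctured disc lies in a bounded
  interval away from 0. Boundary terms then vanish on rays, and the weight 1 / t is
  harmless.\<close>

lemma test_functions_annulus:
  assumes "\<phi> \<in> test_functions (unit_disc - {0})"
  obtains a b where "0 < a" "a < b"
    "\<And>x. \<phi> x \<noteq> 0 \<or> gradient \<phi> x \<noteq> 0 \<Longrightarrow> exp (-b) < norm x \<and> norm x < exp (-a)"
proof -
  obtain K where K: "compact K" "K \<subseteq> unit_disc - {0}" "\<And>x. x \<notin> K \<Longrightarrow> \<phi> x = 0" "\<And>x. x \<notin> K \<Longrightarrow> gradient \<phi> x = 0"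
    using test_functions_support[OF assms] by blast
  show thesis
  proof (cases "K = {}")
    case True
    then show ?thesis using K(3,4) by (intro that[of 1 2]) auto
  next
    case False
    have n: "continuous_on K norm" by (intro continuous_intros)
    obtain p where p: "p \<in> K" "\<And>x. x \<in> K \<Longrightarrow> norm p \<le> norm x"
      using continuous_attains_inf[OF K(1) False n] by blast
    obtain q where q: "q \<in> K" "\<And>x. x \<in> K \<Longrightarrow> norm x \<le> norm q"
      using continuous_attains_sup[OF K(1) False n] by blast
    have pq: "0 < norm p" "norm p \<le> norm q" "norm q < 1" "0 < norm q"
      using p q K(2) by (auto simp: subset_iff)
    \<comment> \<open>Halving and adding 1 leave room on both sides: the inequalities for the
      annulus become strict, and a < b even if all points of \<open>K\<close> have the same
      norm.\<close>
    define a b where "a = - ln (norm q) / 2" and "b = - ln (norm p) + 1"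
    have lq: "ln (norm q) < 0" using pq by simp
    have lpq: "ln (norm p) \<le> ln (norm q)" using pq by simp
    have b: "exp (-b) < norm p"
    proof -
      have "exp (-b) < exp (ln (norm p))" by (simp add: b_def)
      then show ?thesis unfolding exp_ln[OF pq(1)] .
    qed
    have a: "norm q < exp (-a)"
    proof -
      have "exp (ln (norm q)) < exp (-a)" using lq unfolding exp_less_cancel_iff by (simp add: a_def)
      then show ?thesis unfolding exp_ln[OF pq(4)] .
    qed
    show ?thesis
    proof (rule that[of a b])
      show "0 < a" using lq by (simp add: a_def)
      show "a < b" using lq lpq by (simp add: a_def b_def)
      fix x assume "\<phi> x \<noteq> 0 \<or> gradient \<phi> x \<noteq> 0"
      then have "x \<in> K" using K by blast
      then show "exp (-b) < norm x \<and> norm x < exp (-a)"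
        using p(2)[of x] q(2)[of x] a b by linarith
    qed
  qed
qed

text \<open>Both uses are expanded squares whose mixed term is an exact derivative up to lower order
  terms: the Hardy identity on rays and the energy of the concentrating profile.\<close>

lemma nn_integral_Icc_eq_up_to_exact:
  fixes P Q R G :: "real \<Rightarrow> real"
  assumes "a \<le> b" "\<And>t. t \<in> {a..b} \<Longrightarrow> P t = Q t + R t" "\<And>t. 0 \<le> P t" "\<And>t. 0 \<le> Q t"
    and cont: "continuous_on {a..b} P" "continuous_on {a..b} Q" "continuous_on {a..b} R"
    and G: "\<And>t. a \<le> t \<Longrightarrow> t \<le> b \<Longrightarrow> (G has_real_derivative R t) (at t)" "G a = G b"
  shows "(\<integral>\<^sup>+t. indicator {a..b} t * ennreal (P t) \<partial>lborel) = (\<integral>\<^sup>+t. indicator {a..b} t * ennreal (Q t) \<partial>lborel)"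
proof -
  have "has_bochner_integral lborel (\<lambda>t. indicator {a..b} t *\<^sub>R R t) (G b - G a)"
    using G(1) cont(3) assms(1) by (intro has_bochner_integral_FTC_Icc)
      (auto simp: has_real_derivative_iff_has_vector_derivative intro: has_vector_derivative_at_within)
  then have R: "has_bochner_integral lborel (\<lambda>t. indicator {a..b} t *\<^sub>R R t) 0" using G(2) by simp
  have iQ: "integrable lborel (\<lambda>t. indicator {a..b} t *\<^sub>R Q t)" and iP: "integrable lborel (\<lambda>t. indicator {a..b} t *\<^sub>R P t)"
    using borel_integrable_atLeastAtMost'[OF cont(1)] borel_integrable_atLeastAtMost'[OF cont(2)] by (auto simp: set_integrable_def)
  have "(\<lambda>t. indicator {a..b} t *\<^sub>R P t) = (\<lambda>t. indicator {a..b} t *\<^sub>R Q t + indicator {a..b} t *\<^sub>R R t)"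
    using assms(2) by (auto simp: fun_eq_iff split: split_indicator)
  then have eq: "(LINT t|lborel. indicator {a..b} t *\<^sub>R P t) = (LINT t|lborel. indicator {a..b} t *\<^sub>R Q t)"
    using R iQ by (auto simp: has_bochner_integral_iff)
  have "(\<integral>\<^sup>+t. indicator {a..b} t * ennreal (P t) \<partial>lborel) = (\<integral>\<^sup>+t. ennreal (indicator {a..b} t *\<^sub>R P t) \<partial>lborel)"
    by (intro nn_integral_cong) (auto split: split_indicator)
  also have "\<dots> = ennreal (LINT t|lborel. indicator {a..b} t *\<^sub>R P t)"
    using assms(3) by (intro nn_integral_eq_integral[OF iP]) (auto split: split_indicator)
  also have "\<dots> = (\<integral>\<^sup>+t. ennreal (indicator {a..b} t *\<^sub>R Q t) \<partial>lborel)"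
    unfolding eq using assms(4) by (intro nn_integral_eq_integral[OF iQ, symmetric]) (auto split: split_indicator)
  also have "\<dots> = (\<integral>\<^sup>+t. indicator {a..b} t * ennreal (Q t) \<partial>lborel)"
    by (intro nn_integral_cong) (auto split: split_indicator)
  finally show ?thesis .
qed

section \<open>The Hardy inequality on rays as a factorisation\<close>

text \<open>The mixed term 2 \<gamma> w w' / t of the square is the derivative of \<gamma> w^2 / t
  plus \<gamma> w^2 / t^2. The derivative integrates to zero, and the correction turns \<gamma>^2
  into \<gamma>^2 + \<gamma>.\<close>

lemma hardy_identity_ray:
  fixes w :: "real \<Rightarrow> real"
  assumes ab: "0 < a" "a \<le> b" and w: "\<And>t. (w has_real_derivative w' t) (at t)" and w': "continuous_on {a..b} w'"
    and z: "w a = 0" "w b = 0" and \<gamma>: "\<gamma> \<ge> 0"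
  shows "(\<integral>\<^sup>+t. indicator {a..b} t * ennreal ((w' t + \<gamma> * w t / t)\<^sup>2) \<partial>lborel)
    = (\<integral>\<^sup>+t. indicator {a..b} t * ennreal ((w' t)\<^sup>2 + (\<gamma>\<^sup>2 + \<gamma>) * (w t)\<^sup>2 / t\<^sup>2) \<partial>lborel)"
proof (rule nn_integral_Icc_eq_up_to_exact[where G = "\<lambda>t. \<gamma> * (w t)\<^sup>2 / t"
      and R = "\<lambda>t. \<gamma> * (2 * w t * w' t / t - (w t)\<^sup>2 / t\<^sup>2)"])
  have cw: "continuous_on {a..b} w"
    using w by (auto intro!: continuous_at_imp_continuous_on DERIV_isCont)
  have nz: "t \<noteq> 0" if "t \<in> {a..b}" for t using that ab by auto
  show "(w' t + \<gamma> * w t / t)\<^sup>2 = (w' t)\<^sup>2 + (\<gamma>\<^sup>2 + \<gamma>) * (w t)\<^sup>2 / t\<^sup>2 + \<gamma> * (2 * w t * w' t / t - (w t)\<^sup>2 / t\<^sup>2)"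
    if "t \<in> {a..b}" for t
    using nz[OF that] by (simp add: power2_eq_square field_simps)
  show "continuous_on {a..b} (\<lambda>t. (w' t + \<gamma> * w t / t)\<^sup>2)"
    "continuous_on {a..b} (\<lambda>t. (w' t)\<^sup>2 + (\<gamma>\<^sup>2 + \<gamma>) * (w t)\<^sup>2 / t\<^sup>2)"
    "continuous_on {a..b} (\<lambda>t. \<gamma> * (2 * w t * w' t / t - (w t)\<^sup>2 / t\<^sup>2))"
    by (intro continuous_intros cw w'; use nz in auto)+
  show "((\<lambda>t. \<gamma> * (w t)\<^sup>2 / t) has_real_derivative \<gamma> * (2 * w t * w' t / t - (w t)\<^sup>2 / t\<^sup>2)) (at t)"
    if "a \<le> t" "t \<le> b" for t
    using that ab by (auto intro!: derivative_eq_intros w simp: field_simps power2_eq_square)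
qed (use ab z \<gamma> in auto)

text \<open>t^\<gamma> is an integrating factor: the derivative of t^\<gamma> w is t^\<gamma> (w' +
  \<gamma> w / t). Hence \<open>w\<close> is recovered from its first order factor by integrating
  from a point where it vanishes.\<close>

lemma weighted_representation_ray:
  fixes w :: "real \<Rightarrow> real"
  assumes a: "0 < a" and w: "\<And>t. (w has_real_derivative w' t) (at t)" and w': "\<And>S. continuous_on S w'"
    and z: "\<And>t. t \<le> a \<Longrightarrow> w t = 0"
  shows "ennreal \<bar>w t\<bar> \<le> (\<integral>\<^sup>+s. indicator {0<..<t} s * ennreal ((s / t) powr \<gamma>) * ennreal \<bar>w' s + \<gamma> * w s / s\<bar> \<partial>lborel)"
proof (cases "t \<le> a")
  case False
  then have t: "a < t" "0 < t" using a by auto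
  define W W' where "W s = s powr \<gamma> * w s" and "W' s = s powr \<gamma> * (w' s + \<gamma> * w s / s)" for s
  have cw: "continuous_on S w" for S
    using w by (auto intro!: continuous_at_imp_continuous_on DERIV_isCont)
  have d: "(W has_real_derivative W' s) (at s)" if "a \<le> s" "s \<le> t" for s
    unfolding W_def W'_def using that a
    by (auto intro!: derivative_eq_intros w simp: powr_diff field_simps)
  have c: "continuous_on {a..t} W'"
    unfolding W'_def using a by (intro continuous_intros w' cw) auto
  have "ennreal (t powr \<gamma>) * ennreal \<bar>w t\<bar> = ennreal \<bar>W t - W a\<bar>"
    using z[of a] by (simp add: W_def abs_mult flip: ennreal_mult)
  also have "\<dots> \<le> (\<integral>\<^sup>+s. indicator {a..t} s * ennreal \<bar>W' s\<bar> \<partial>lborel)"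
    by (rule nn_integral_FTC_abs_le[OF _ d c]) (use t in auto)
  finally have "ennreal (1 / t powr \<gamma>) * (ennreal (t powr \<gamma>) * ennreal \<bar>w t\<bar>)
    \<le> ennreal (1 / t powr \<gamma>) * (\<integral>\<^sup>+s. indicator {a..t} s * ennreal \<bar>W' s\<bar> \<partial>lborel)"
    by (rule mult_left_mono) simp
  also have "ennreal (1 / t powr \<gamma>) * (ennreal (t powr \<gamma>) * ennreal \<bar>w t\<bar>) = ennreal \<bar>w t\<bar>"
    using t by (simp flip: ennreal_mult)
  also have "ennreal (1 / t powr \<gamma>) * (\<integral>\<^sup>+s. indicator {a..t} s * ennreal \<bar>W' s\<bar> \<partial>lborel)
    = (\<integral>\<^sup>+s. indicator {a..t} s * ennreal (1 / t powr \<gamma> * \<bar>W' s\<bar>) \<partial>lborel)"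
  proof -
    have [measurable]: "(\<lambda>s. indicator {a..t} s * ennreal \<bar>W' s\<bar>) \<in> borel_measurable borel"
    proof -
      have "(\<lambda>s. ennreal \<bar>indicator {a..t} s *\<^sub>R W' s\<bar>) \<in> borel_measurable borel"
        using borel_measurable_continuous_on_indicator[OF _ c] by simp
      also have "(\<lambda>s. ennreal \<bar>indicator {a..t} s *\<^sub>R W' s\<bar>) = (\<lambda>s. indicator {a..t} s * ennreal \<bar>W' s\<bar>)"
        by (auto simp: fun_eq_iff split: split_indicator)
      finally show ?thesis .
    qed
    have m: "ennreal (1 / t powr \<gamma> * z) = ennreal (1 / t powr \<gamma>) * ennreal z" for z
      by (rule ennreal_mult') simp
    show ?thesis
      by (subst nn_integral_cmult[symmetric], measurable, intro nn_integral_cong, unfold m)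
         (simp only: mult_ac)
  qed
  also have "\<dots> \<le> (\<integral>\<^sup>+s. indicator {0<..<t} s * ennreal ((s / t) powr \<gamma>) * ennreal \<bar>w' s + \<gamma> * w s / s\<bar> \<partial>lborel)"
  proof (rule nn_integral_mono_AE)
    show "AE s in lborel. indicator {a..t} s * ennreal (1 / t powr \<gamma> * \<bar>W' s\<bar>)
      \<le> indicator {0<..<t} s * ennreal ((s / t) powr \<gamma>) * ennreal \<bar>w' s + \<gamma> * w s / s\<bar>"
      using AE_lborel_singleton[of t]
    proof eventually_elim
      fix s assume s: "s \<noteq> t"
      show "indicator {a..t} s * ennreal (1 / t powr \<gamma> * \<bar>W' s\<bar>)
        \<le> indicator {0<..<t} s * ennreal ((s / t) powr \<gamma>) * ennreal \<bar>w' s + \<gamma> * w s / s\<bar>"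
      proof (cases "s \<in> {a..t}")
        case True
        then have "1 / t powr \<gamma> * \<bar>W' s\<bar> = (s / t) powr \<gamma> * \<bar>w' s + \<gamma> * w s / s\<bar>"
          using a t by (simp add: W'_def abs_mult powr_divide)
        then show ?thesis using True s a by (simp flip: ennreal_mult)
      qed simp
    qed
  qed
  finally show ?thesis .
qed (simp add: z)

text \<open>\<open>\<rho>\<close> need not be measurable; \<open>h\<close> is the restriction of \<open>u\<close> to a suitably chosen ray.\<close>

lemma radial_borel:
  assumes u: "u \<in> borel_measurable borel" and rad: "AE x in lborel. x \<in> unit_disc \<longrightarrow> u x = \<rho> (norm x)"
  obtains h where "h \<in> borel_measurable borel" "AE x in lborel. x \<in> unit_disc \<longrightarrow> u (x::real^2) = h (norm x)"
proof -
  note [measurable] = u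
  obtain N where N: "{x \<in> space lborel. \<not> (x \<in> unit_disc \<longrightarrow> u x = \<rho> (norm x))} \<subseteq> N" "emeasure lborel N = 0" "N \<in> sets lborel"
    using rad by (rule AE_E)
  have [measurable]: "N \<in> sets borel" using N by simp
  have Nu: "u x = \<rho> (norm x)" if "x \<in> unit_disc" "x \<notin> N" for x using N that by auto
  \<comment> \<open>In polar coordinates a null set meets the ray through almost every direction in
    a null set of radii, so at least one such ray exists.\<close>
  have "0 = (\<integral>\<^sup>+z. indicator N z \<partial>lborel)" using N by simp
  also have "\<dots> = 2 * (\<integral>\<^sup>+y. indicator unit_disc y *
      (\<integral>\<^sup>+t. indicator N (exp (-t) *\<^sub>R (y /\<^sub>R norm y)) * ennreal (exp (- (2 * t))) \<partial>lborel) \<partial>lborel)"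
    by (rule log_polar) measurable
  finally have "(\<integral>\<^sup>+y. indicator unit_disc y *
      (\<integral>\<^sup>+t. indicator N (exp (-t) *\<^sub>R (y /\<^sub>R norm y)) * ennreal (exp (- (2 * t))) \<partial>lborel) \<partial>lborel) = 0"
    by simp
  then have "AE y in lborel. indicator unit_disc y *
      (\<integral>\<^sup>+t. indicator N (exp (-t) *\<^sub>R (y /\<^sub>R norm y)) * ennreal (exp (- (2 * t))) \<partial>lborel) = 0"
    by (subst (asm) nn_integral_0_iff_AE) auto
  then have ae: "AE y in lborel. y \<noteq> 0 \<and> indicator unit_disc y *
      (\<integral>\<^sup>+t. indicator N (exp (-t) *\<^sub>R (y /\<^sub>R norm y)) * ennreal (exp (- (2 * t))) \<partial>lborel) = 0"
    using AE_lborel_singleton[of "0::real^2"] by eventually_elim auto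
  have "\<exists>y\<in>unit_disc. y \<noteq> 0 \<and> (\<integral>\<^sup>+t. indicator N (exp (-t) *\<^sub>R (y /\<^sub>R norm y)) * ennreal (exp (- (2 * t))) \<partial>lborel) = 0"
  proof (rule ccontr)
    assume neg: "\<not> ?thesis"
    have "AE y in lborel. y \<notin> (unit_disc :: (real^2) set)"
      using ae by eventually_elim (use neg in \<open>auto split: split_indicator\<close>)
    then have "emeasure lborel (unit_disc :: (real^2) set) = 0"
      by (subst (asm) AE_iff_measurable[of "unit_disc"]) (auto simp: ball_borel)
    then show False by (simp add: emeasure_ball_plane)
  qed
  then obtain y where y: "y \<noteq> 0" "(\<integral>\<^sup>+t. indicator N (exp (-t) *\<^sub>R (y /\<^sub>R norm y)) * ennreal (exp (- (2 * t))) \<partial>lborel) = 0"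
    by blast
  define e where "e = y /\<^sub>R norm y"
  have e: "norm e = 1" using y by (simp add: e_def)
  \<comment> \<open>Conversely, a null set of radii on the chosen ray sweeps out a null set of the
    plane under rotation. Hence almost every point has the same value as the point of the ray with
    the same norm.\<close>
  have "(\<integral>\<^sup>+z. indicator N (norm (z::real^2) *\<^sub>R e) \<partial>lborel) = ennreal (2 * pi) * (\<integral>\<^sup>+t. indicator N (exp (-t) *\<^sub>R e) * ennreal (exp (- (2 * t))) \<partial>lborel)"
    by (rule nn_integral_radial[where h = "\<lambda>r. indicator N (r *\<^sub>R e)"]) measurable
  also have "\<dots> = 0" using y(2) by (simp add: e_def)
  finally have "AE z in lborel. indicator N (norm (z::real^2) *\<^sub>R e) = (0::ennreal)"
    by (subst (asm) nn_integral_0_iff_AE) auto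
  then have "AE z in lborel. norm (z::real^2) *\<^sub>R e \<notin> N" by eventually_elim (auto split: split_indicator_asm)
  with rad have "AE x in lborel. x \<in> unit_disc \<longrightarrow> u x = u (norm x *\<^sub>R e)"
  proof eventually_elim
    fix x :: "real^2" assume x: "x \<in> unit_disc \<longrightarrow> u x = \<rho> (norm x)" "norm x *\<^sub>R e \<notin> N"
    show "x \<in> unit_disc \<longrightarrow> u x = u (norm x *\<^sub>R e)"
      using x Nu[of "norm x *\<^sub>R e"] e by auto
  qed
  then show thesis by (intro that[of "\<lambda>r. u (r *\<^sub>R e)"]) auto
qed

text \<open>With \<open>s = - ln \<bar>y\<bar>\<close> and \<open>w\<close> the restriction of \<open>v\<close> to a ray, \<open>\<bar>y\<bar> hardy_factor \<gamma> v g y\<close> is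
  \<open>- (w' + \<gamma> w / s)\<close>: the first order factor of the operator \<open>- w'' + \<mu> w / s\<^sup>2\<close> with
  \<open>\<mu> = \<gamma>\<^sup>2 + \<gamma>\<close>.\<close>

definition hardy_factor :: "real \<Rightarrow> (real^2 \<Rightarrow> real) \<Rightarrow> (real^2 \<Rightarrow> real^2) \<Rightarrow> real^2 \<Rightarrow> real" where
  "hardy_factor \<gamma> v g y = (y \<bullet> g y + \<gamma> * v y / ln (norm y)) / norm y"

lemma hardy_factor_measurable [measurable]:
  assumes [measurable]: "v \<in> borel_measurable borel" "g \<in> borel_measurable borel"
  shows "hardy_factor \<gamma> v g \<in> borel_measurable borel"
  unfolding hardy_factor_def[abs_def] by measurable

text \<open>\<open>v\<close> and \<open>g\<close> are independent arguments: for test functions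
  \<open>g\<close> is the classical gradient, for their limits a Borel representative of the weak
  one.\<close>

definition hardy_energy :: "real \<Rightarrow> (real^2 \<Rightarrow> real) \<Rightarrow> (real^2 \<Rightarrow> real^2) \<Rightarrow> real^2 \<Rightarrow> real" where
  "hardy_energy \<mu> v g y = (norm (g y))\<^sup>2 + \<mu> * potential hardy y * (v y)\<^sup>2"

lemma potential_hardy_measurable [measurable]: "potential hardy \<in> borel_measurable borel"
proof (rule potential_measurable)
  show "continuous_on {0<..<1} hardy"
    unfolding hardy_def by (intro continuous_intros) auto
qed

lemma hardy_energy_measurable [measurable]:
  assumes [measurable]: "v \<in> borel_measurable borel" "g \<in> borel_measurable borel"
  shows "hardy_energy \<mu> v g \<in> borel_measurable borel"
  unfolding hardy_energy_def[abs_def] by measurable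

lemma ray_derivative:
  assumes "\<phi> \<in> test_functions U"
  shows "((\<lambda>t. \<phi> (exp (-t) *\<^sub>R e)) has_real_derivative - (exp (-t) *\<^sub>R e) \<bullet> gradient \<phi> (exp (-t) *\<^sub>R e)) (at t)"
    "continuous_on S (\<lambda>t. - (exp (-t) *\<^sub>R e) \<bullet> gradient \<phi> (exp (-t) *\<^sub>R e))"
proof -
  note p = test_functionsD[OF assms]
  have 1: "((\<lambda>s. \<phi> (0 + s *\<^sub>R e)) has_real_derivative (e \<bullet> gradient \<phi> (0 + exp (-t) *\<^sub>R e))) (at (exp (-t)))"
    by (rule GDERIV_has_real_derivative_line) (rule p)
  have 2: "((\<lambda>t. exp (-t)) has_real_derivative - exp (-t)) (at t)"
    by (auto intro!: derivative_eq_intros)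
  show "((\<lambda>t. \<phi> (exp (-t) *\<^sub>R e)) has_real_derivative - (exp (-t) *\<^sub>R e) \<bullet> gradient \<phi> (exp (-t) *\<^sub>R e)) (at t)"
    using DERIV_chain2[OF 1 2] by (simp add: mult.commute)
  show "continuous_on S (\<lambda>t. - (exp (-t) *\<^sub>R e) \<bullet> gradient \<phi> (exp (-t) *\<^sub>R e))"
    by (intro continuous_intros continuous_on_compose2[OF p(4)]) auto
qed

lemma hardy_factor_ray:
  assumes "norm e = 1" "t > 0"
  shows "exp (-t) * \<bar>hardy_factor \<gamma> v g (exp (-t) *\<^sub>R e)\<bar> = \<bar>- (exp (-t) *\<^sub>R e) \<bullet> g (exp (-t) *\<^sub>R e) + \<gamma> * v (exp (-t) *\<^sub>R e) / t\<bar>"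
proof -
  have "hardy_factor \<gamma> v g (exp (-t) *\<^sub>R e) = - (- (exp (-t) *\<^sub>R e) \<bullet> g (exp (-t) *\<^sub>R e) + \<gamma> * v (exp (-t) *\<^sub>R e) / t) / exp (-t)"
    using assms by (simp add: hardy_factor_def)
  then show ?thesis by (simp only: abs_divide abs_minus_cancel abs_exp_cancel) simp
qed

text \<open>\<open>hardy_identity_ray\<close> on every ray, integrated over the directions. The only
  loss is the angular part of the gradient, dropped by the Cauchy-Schwarz inequality, so the
  inequality is sharp on radial functions.\<close>

lemma hardy_factor_energy_le:
  assumes \<phi>: "\<phi> \<in> test_functions (unit_disc - {0})" and \<gamma>: "\<gamma> \<ge> 0"
  shows "(\<integral>\<^sup>+y. indicator unit_disc y * ennreal ((hardy_factor \<gamma> \<phi> (gradient \<phi>) y)\<^sup>2) \<partial>lborel)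
    \<le> (\<integral>\<^sup>+y. indicator unit_disc y * ennreal (hardy_energy (\<gamma>\<^sup>2 + \<gamma>) \<phi> (gradient \<phi>) y) \<partial>lborel)"
proof -
  obtain a b where ab: "0 < a" "a < b" "\<And>x. \<phi> x \<noteq> 0 \<or> gradient \<phi> x \<noteq> 0 \<Longrightarrow> exp (-b) < norm x \<and> norm x < exp (-a)"
    using test_functions_annulus[OF \<phi>] by blast
  note [measurable] = test_functionsD(5,6)[OF \<phi>]
  define H1 where "H1 y = indicator unit_disc y * ennreal ((hardy_factor \<gamma> \<phi> (gradient \<phi>) y)\<^sup>2)" for y
  define H2 where "H2 y = indicator unit_disc y * ennreal (hardy_energy (\<gamma>\<^sup>2 + \<gamma>) \<phi> (gradient \<phi>) y)" for y
  have [measurable]: "H1 \<in> borel_measurable borel" "H2 \<in> borel_measurable borel"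
    unfolding H1_def H2_def by measurable
  have ray: "(\<integral>\<^sup>+t. H1 (exp (-t) *\<^sub>R e) * ennreal (exp (- (2 * t))) \<partial>lborel)
      \<le> (\<integral>\<^sup>+t. H2 (exp (-t) *\<^sub>R e) * ennreal (exp (- (2 * t))) \<partial>lborel)" if e: "norm e = 1" for e
  proof -
    define w w' where "w t = \<phi> (exp (-t) *\<^sub>R e)" and "w' t = - (exp (-t) *\<^sub>R e) \<bullet> gradient \<phi> (exp (-t) *\<^sub>R e)" for t
    have w: "(w has_real_derivative w' t) (at t)" for t
      unfolding w_def[abs_def] w'_def by (rule ray_derivative[OF \<phi>])
    have w': "continuous_on S w'" for S
      unfolding w'_def[abs_def] by (rule ray_derivative[OF \<phi>])
    have out: "w t = 0" "w' t = 0" if "t \<notin> {a<..<b}" for t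
    proof -
      have "\<phi> (exp (-t) *\<^sub>R e) = 0" "gradient \<phi> (exp (-t) *\<^sub>R e) = 0"
        using ab(3)[of "exp (-t) *\<^sub>R e"] that e by auto
      then show "w t = 0" "w' t = 0" by (simp_all add: w_def w'_def)
    qed
    have n: "norm (exp (-t) *\<^sub>R e) = exp (-t)" for t using e by simp
    have e2: "exp (- (2 * t)) = (exp (-t))\<^sup>2" for t :: real
      by (simp add: power2_eq_square flip: exp_add)
    have "(\<integral>\<^sup>+t. H1 (exp (-t) *\<^sub>R e) * ennreal (exp (- (2 * t))) \<partial>lborel)
      = (\<integral>\<^sup>+t. indicator {a..b} t * ennreal ((w' t + \<gamma> * w t / t)\<^sup>2) \<partial>lborel)"
    proof (rule nn_integral_cong)
      fix t :: real
      show "H1 (exp (-t) *\<^sub>R e) * ennreal (exp (- (2 * t))) = indicator {a..b} t * ennreal ((w' t + \<gamma> * w t / t)\<^sup>2)"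
      proof (cases "t \<in> {a<..<b}")
        case True
        then have t: "t > 0" using ab by auto
        have "(hardy_factor \<gamma> \<phi> (gradient \<phi>) (exp (-t) *\<^sub>R e))\<^sup>2 * exp (- (2 * t)) = (w' t + \<gamma> * w t / t)\<^sup>2"
          using hardy_factor_ray[OF e t, of \<gamma> \<phi> "gradient \<phi>"] unfolding w_def w'_def e2
          by (metis power2_abs power_mult_distrib mult.commute)
        then show ?thesis using True t e
          by (simp add: H1_def flip: ennreal_mult)
      next
        case False
        then have "\<phi> (exp (-t) *\<^sub>R e) = 0" "gradient \<phi> (exp (-t) *\<^sub>R e) = 0"
          using ab(3)[of "exp (-t) *\<^sub>R e"] e by auto
        then show ?thesis using out[OF False] by (simp add: H1_def hardy_factor_def)
      qed
    qed
    also have "\<dots> = (\<integral>\<^sup>+t. indicator {a..b} t * ennreal ((w' t)\<^sup>2 + (\<gamma>\<^sup>2 + \<gamma>) * (w t)\<^sup>2 / t\<^sup>2) \<partial>lborel)"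
      using ab out \<gamma> by (intro hardy_identity_ray w w') auto
    also have "\<dots> \<le> (\<integral>\<^sup>+t. H2 (exp (-t) *\<^sub>R e) * ennreal (exp (- (2 * t))) \<partial>lborel)"
    proof (rule nn_integral_mono)
      fix t
      show "indicator {a..b} t * ennreal ((w' t)\<^sup>2 + (\<gamma>\<^sup>2 + \<gamma>) * (w t)\<^sup>2 / t\<^sup>2) \<le> H2 (exp (-t) *\<^sub>R e) * ennreal (exp (- (2 * t)))"
      proof (cases "t \<in> {a..b}")
        case True
        then have t: "t > 0" using ab by auto
        have "\<bar>w' t\<bar> \<le> exp (-t) * norm (gradient \<phi> (exp (-t) *\<^sub>R e))"
          using Cauchy_Schwarz_ineq2[of "- (exp (-t) *\<^sub>R e)" "gradient \<phi> (exp (-t) *\<^sub>R e)"] e by (simp add: w'_def)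
        then have "(w' t)\<^sup>2 \<le> (norm (gradient \<phi> (exp (-t) *\<^sub>R e)))\<^sup>2 * exp (- (2 * t))"
          unfolding e2 power_mult_distrib[symmetric] by (intro power2_le_iff_abs_le[THEN iffD2]) (auto simp: mult.commute)
        moreover have "(\<gamma>\<^sup>2 + \<gamma>) * (w t)\<^sup>2 / t\<^sup>2 = (\<gamma>\<^sup>2 + \<gamma>) * potential hardy (exp (-t) *\<^sub>R e) * (\<phi> (exp (-t) *\<^sub>R e))\<^sup>2 * exp (- (2 * t))"
          using t e unfolding e2 by (auto simp: potential_def hardy_def w_def field_simps)
        ultimately have "(w' t)\<^sup>2 + (\<gamma>\<^sup>2 + \<gamma>) * (w t)\<^sup>2 / t\<^sup>2 \<le> hardy_energy (\<gamma>\<^sup>2 + \<gamma>) \<phi> (gradient \<phi>) (exp (-t) *\<^sub>R e) * exp (- (2 * t))"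
          by (simp add: hardy_energy_def distrib_right)
        then have "ennreal ((w' t)\<^sup>2 + (\<gamma>\<^sup>2 + \<gamma>) * (w t)\<^sup>2 / t\<^sup>2) \<le> ennreal (hardy_energy (\<gamma>\<^sup>2 + \<gamma>) \<phi> (gradient \<phi>) (exp (-t) *\<^sub>R e)) * ennreal (exp (- (2 * t)))"
          by (simp add: ennreal_mult''[symmetric] ennreal_leI)
        then show ?thesis using True t e by (simp add: H2_def)
      qed simp
    qed
    finally show ?thesis .
  qed
  have "(\<integral>\<^sup>+y. H1 y \<partial>lborel) \<le> (\<integral>\<^sup>+y. H2 y \<partial>lborel)"
    unfolding log_polar[OF \<open>H1 \<in> borel_measurable borel\<close>] log_polar[OF \<open>H2 \<in> borel_measurable borel\<close>]
  proof (rule mult_left_mono, rule nn_integral_mono_AE)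
    show "AE y in lborel. indicator unit_disc y * (\<integral>\<^sup>+t. H1 (exp (-t) *\<^sub>R (y /\<^sub>R norm y)) * ennreal (exp (- (2 * t))) \<partial>lborel)
      \<le> indicator unit_disc y * (\<integral>\<^sup>+t. H2 (exp (-t) *\<^sub>R (y /\<^sub>R norm y)) * ennreal (exp (- (2 * t))) \<partial>lborel)"
      using AE_lborel_singleton[of "0::real^2"]
      by eventually_elim (intro mult_left_mono ray, auto)
  qed simp
  then show ?thesis unfolding H1_def H2_def .
qed

section \<open>The weighted kernel of the radial problem\<close>

text \<open>With t = - ln |x| and s = - ln |y| this is (s / t)^\<gamma> / (2 pi exp (- s)) for 0 < s
  < t: the weight of \<open>weighted_representation_ray\<close>, divided by the length of the circle
  through y.\<close>

definition hardy_kernel :: "real \<Rightarrow> real^2 \<Rightarrow> real^2 \<Rightarrow> ennreal" where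
  "hardy_kernel \<gamma> x y = (if 0 < norm x \<and> norm x < norm y \<and> norm y < 1
     then ennreal ((ln (norm y) / ln (norm x)) powr \<gamma> / (2 * pi * norm y)) else 0)"

lemma hardy_kernel_measurable [measurable]:
  "(\<lambda>(x, y). hardy_kernel \<gamma> x y) \<in> borel_measurable (borel \<Otimes>\<^sub>M borel)"
  unfolding hardy_kernel_def by measurable

text \<open>With m = min t t', the integral is at most 1 / (2 pi) times m^(- 2 \<gamma>) times the
  integral of s^(2 \<gamma>) over [0, m], that is m / (2 pi (2 \<gamma> + 1)). The factor 2 \<gamma>
  + 1 = sqrt (1 + 4 \<mu>) is the whole gain in the radial exponent. The terms \<open>- 0\<close>
  and \<open>+ 0\<close> give the bound the shape that \<open>nn_integral_log_le\<close>
  expects.\<close>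

lemma hardy_kernel_gram:
  assumes x: "x \<in> unit_disc" "x' \<in> unit_disc" and \<gamma>: "\<gamma> \<ge> 0"
  shows "(\<integral>\<^sup>+y. hardy_kernel \<gamma> x y * hardy_kernel \<gamma> x' y \<partial>lborel)
    \<le> ennreal (1 / (2 * pi * (2 * \<gamma> + 1))) * ennreal (- ln (norm (x - 0)) + 0)"
proof (cases "x = 0 \<or> x' = 0")
  case False
  define t t' where "t = - ln (norm x)" and "t' = - ln (norm x')"
  have t: "t > 0" "t' > 0" "norm x = exp (-t)" "norm x' = exp (-t')"
    using False x by (auto simp: t_def t'_def)
  define m where "m = min t t'"
  have m: "m > 0" "m \<le> t" "m \<le> t'" using t by (auto simp: m_def)
  define k where "k t r = (if exp (-t) < r \<and> r < 1 then ennreal ((ln r / - t) powr \<gamma> / (2 * pi * r)) else 0)" for t r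
  have [measurable]: "k t \<in> borel_measurable borel" for t unfolding k_def by measurable
  have hk: "hardy_kernel \<gamma> x y = k t (norm y)" "hardy_kernel \<gamma> x' y = k t' (norm y)" for y
    using t by (auto simp: hardy_kernel_def k_def)
  have "(\<integral>\<^sup>+y. hardy_kernel \<gamma> x y * hardy_kernel \<gamma> x' y \<partial>lborel)
     = ennreal (2 * pi) * (\<integral>\<^sup>+s. k t (exp (-s)) * k t' (exp (-s)) * ennreal (exp (- (2 * s))) \<partial>lborel)"
    unfolding hk by (rule nn_integral_radial) measurable
  also have "\<dots> \<le> ennreal (2 * pi) * (\<integral>\<^sup>+s. ennreal (1 / (4 * pi\<^sup>2) * m powr (- (2 * \<gamma>))) * ennreal (s powr (2 * \<gamma>) * indicator {0..m} s) \<partial>lborel)"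
  proof (rule mult_left_mono, rule nn_integral_mono)
    fix s :: real
    show "k t (exp (-s)) * k t' (exp (-s)) * ennreal (exp (- (2 * s)))
       \<le> ennreal (1 / (4 * pi\<^sup>2) * m powr (- (2 * \<gamma>))) * ennreal (s powr (2 * \<gamma>) * indicator {0..m} s)"
    proof (cases "0 < s \<and> s < m")
      case True
      then have s: "0 < s" "s < m" by auto
      have "k t (exp (-s)) * k t' (exp (-s)) * ennreal (exp (- (2 * s)))
         = ennreal ((s / t) powr \<gamma> / (2 * pi * exp (-s))) * ennreal ((s / t') powr \<gamma> / (2 * pi * exp (-s))) * ennreal (exp (- (2 * s)))"
        using s m by (simp add: k_def)
      also have "\<dots> = ennreal ((s / t) powr \<gamma> / (2 * pi * exp (-s)) * ((s / t') powr \<gamma> / (2 * pi * exp (-s))) * exp (- (2 * s)))"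
        by (simp flip: ennreal_mult)
      also have "(s / t) powr \<gamma> / (2 * pi * exp (-s)) * ((s / t') powr \<gamma> / (2 * pi * exp (-s))) * exp (- (2 * s))
        = (s / t) powr \<gamma> * (s / t') powr \<gamma> / (4 * pi\<^sup>2)"
      proof -
        have "exp (- (2 * s)) = exp (-s) * exp (-s)" by (simp flip: exp_add)
        then show ?thesis by (simp add: power2_eq_square)
      qed
      also have "\<dots> \<le> (s / m) powr \<gamma> * (s / m) powr \<gamma> / (4 * pi\<^sup>2)"
        using s m t \<gamma> by (intro divide_right_mono mult_mono powr_mono2 divide_left_mono) auto
      also have "\<dots> = 1 / (4 * pi\<^sup>2) * m powr (- (2 * \<gamma>)) * s powr (2 * \<gamma>)"
        using s m by (simp add: powr_divide powr_minus_divide flip: powr_add)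
      finally show ?thesis using s
        by (simp add: ennreal_leI flip: ennreal_mult)
    next
      case False
      have "k t (exp (-s)) * k t' (exp (-s)) = 0"
        using False by (auto simp: k_def m_def)
      then show ?thesis by (simp only: mult_zero_left zero_le)
    qed
  qed simp
  also have "(\<integral>\<^sup>+s. ennreal (1 / (4 * pi\<^sup>2) * m powr (- (2 * \<gamma>))) * ennreal (s powr (2 * \<gamma>) * indicator {0..m} s) \<partial>lborel)
     = ennreal (1 / (4 * pi\<^sup>2) * m powr (- (2 * \<gamma>))) * (\<integral>\<^sup>+s. ennreal (s powr (2 * \<gamma>) * indicator {0..m} s) \<partial>lborel)"
    by (rule nn_integral_cmult) measurable
  also have "(\<integral>\<^sup>+s. ennreal (s powr (2 * \<gamma>) * indicator {0..m} s) \<partial>lborel)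
     = (\<integral>\<^sup>+s. ennreal (s powr (2 * \<gamma>)) * indicator {0..m} s \<partial>lborel)"
    by (intro nn_integral_cong) (auto split: split_indicator)
  also have "\<dots> = ennreal (m powr (2 * \<gamma> + 1) / (2 * \<gamma> + 1))"
    by (rule nn_integral_has_integral_lebesgue'[OF _ has_integral_powr_from_0]) (use \<gamma> m in auto)
  also have "ennreal (2 * pi) * (ennreal (1 / (4 * pi\<^sup>2) * m powr (- (2 * \<gamma>))) * ennreal (m powr (2 * \<gamma> + 1) / (2 * \<gamma> + 1)))
     = ennreal (2 * pi * (1 / (4 * pi\<^sup>2) * m powr (- (2 * \<gamma>)) * (m powr (2 * \<gamma> + 1) / (2 * \<gamma> + 1))))"
    using \<gamma> by (simp flip: ennreal_mult)
  also have "2 * pi * (1 / (4 * pi\<^sup>2) * m powr (- (2 * \<gamma>)) * (m powr (2 * \<gamma> + 1) / (2 * \<gamma> + 1)))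
     = 1 / (2 * pi * (2 * \<gamma> + 1)) * (m powr (- (2 * \<gamma>)) * m powr (2 * \<gamma> + 1))"
    by (simp add: power2_eq_square)
  also have "m powr (- (2 * \<gamma>)) * m powr (2 * \<gamma> + 1) = m"
    using m by (simp flip: powr_add)
  also have "ennreal (1 / (2 * pi * (2 * \<gamma> + 1)) * m) \<le> ennreal (1 / (2 * pi * (2 * \<gamma> + 1)) * t)"
    using m \<gamma> by (intro ennreal_leI mult_left_mono) auto
  also have "\<dots> = ennreal (1 / (2 * pi * (2 * \<gamma> + 1))) * ennreal t"
    by (rule ennreal_mult') (use \<gamma> in simp)
  also have "t = - ln (norm (x - 0)) + 0" by (simp add: t_def)
  finally show ?thesis .
qed (auto simp: hardy_kernel_def)

text \<open>\<open>\<phi>\<close> need not be radial, but on every ray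
  \<open>weighted_representation_ray\<close> applies with the same weight, and membership in
  \<open>E\<close> depends on the radius alone. Exchanging the two integrals along the ray reveals
  the kernel integrated over all of \<open>E\<close>, and integration over directions gives the
  statement in the plane.\<close>

lemma hardy_kernel_representation:
  assumes \<phi>: "\<phi> \<in> test_functions (unit_disc - {0})" and S [measurable]: "S \<in> sets borel"
    and E: "E = {x \<in> unit_disc. norm x \<in> S}"
  shows "(\<integral>\<^sup>+x. indicator E x * ennreal \<bar>\<phi> x\<bar> \<partial>lborel)
    \<le> (\<integral>\<^sup>+y. (\<integral>\<^sup>+x. indicator E x * hardy_kernel \<gamma> x y \<partial>lborel) *
         (indicator unit_disc y * ennreal \<bar>hardy_factor \<gamma> \<phi> (gradient \<phi>) y\<bar>) \<partial>lborel)"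
proof -
  obtain a b where ab: "0 < a" "a < b" "\<And>x. \<phi> x \<noteq> 0 \<or> gradient \<phi> x \<noteq> 0 \<Longrightarrow> exp (-b) < norm x \<and> norm x < exp (-a)"
    using test_functions_annulus[OF \<phi>] by blast
  note [measurable] = test_functionsD(5,6)[OF \<phi>]
  have [measurable]: "E \<in> sets borel" unfolding E by measurable
  define L where "L x = indicator E x * ennreal \<bar>\<phi> x\<bar>" for x
  define K where "K y = (\<integral>\<^sup>+x. indicator E x * hardy_kernel \<gamma> x y \<partial>lborel)" for y
  define R where "R y = K y * (indicator unit_disc y * ennreal \<bar>hardy_factor \<gamma> \<phi> (gradient \<phi>) y\<bar>)" for y
  have [measurable]: "Measurable.pred borel (\<lambda>t. s \<in> {0<..<t})" for s :: real
    unfolding greaterThanLessThan_iff by measurable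
  have LR [measurable]: "L \<in> borel_measurable borel" "R \<in> borel_measurable borel"
    unfolding L_def R_def K_def by measurable
  define q where "q t = indicator (S \<inter> {..<1}) (exp (-t)) * ennreal (exp (- (2 * t)))" for t :: real
  have [measurable]: "q \<in> borel_measurable borel" unfolding q_def by measurable
  define kk where "kk s r = (if 0 < r \<and> r < exp (-s) \<and> exp (-s) < (1::real) then ennreal ((-s / ln r) powr \<gamma> / (2 * pi * exp (-s))) else 0)" for s r :: real
  have [measurable]: "kk s \<in> borel_measurable borel" for s unfolding kk_def by measurable
  have ray: "(\<integral>\<^sup>+t. L (exp (-t) *\<^sub>R e) * ennreal (exp (- (2 * t))) \<partial>lborel)
      \<le> (\<integral>\<^sup>+t. R (exp (-t) *\<^sub>R e) * ennreal (exp (- (2 * t))) \<partial>lborel)" if e: "norm e = 1" for e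
  proof -
    define w w' where "w t = \<phi> (exp (-t) *\<^sub>R e)" and "w' t = - (exp (-t) *\<^sub>R e) \<bullet> gradient \<phi> (exp (-t) *\<^sub>R e)" for t
    have w: "(w has_real_derivative w' t) (at t)" for t
      unfolding w_def[abs_def] w'_def by (rule ray_derivative[OF \<phi>])
    have w': "continuous_on T w'" for T
      unfolding w'_def[abs_def] by (rule ray_derivative[OF \<phi>])
    have [measurable]: "w \<in> borel_measurable borel" "w' \<in> borel_measurable borel"
      unfolding w_def[abs_def] w'_def[abs_def] by measurable
    have out: "w t = 0" if "t \<le> a" for t
      using ab(3)[of "exp (-t) *\<^sub>R e"] that e by (auto simp: w_def)
    define D where "D s = ennreal \<bar>w' s + \<gamma> * w s / s\<bar>" for s
    have [measurable]: "D \<in> borel_measurable borel" unfolding D_def by measurable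
    \<comment> \<open>The kernel depends on the two norms only, so its integral over the rotation
      invariant \<open>E\<close> is one-dimensional with the density \<open>q\<close>. The angle 2
      pi cancels the normalisation of the kernel.\<close>
    have K: "K (exp (-s) *\<^sub>R e) = (\<integral>\<^sup>+t. q t * (indicator {0<..<t} s * ennreal ((s / t) powr \<gamma>)) \<partial>lborel) * ennreal (exp s)" if s: "s > 0" for s
    proof -
      have "K (exp (-s) *\<^sub>R e) = (\<integral>\<^sup>+x. indicator (S \<inter> {..<1}) (norm x) * kk s (norm (x::real^2)) \<partial>lborel)"
        unfolding K_def using e by (intro nn_integral_cong) (auto simp: E hardy_kernel_def kk_def split: split_indicator)
      also have "\<dots> = ennreal (2 * pi) * (\<integral>\<^sup>+t. indicator (S \<inter> {..<1}) (exp (-t)) * kk s (exp (-t)) * ennreal (exp (- (2 * t))) \<partial>lborel)"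
        by (rule nn_integral_radial) measurable
      also have "(\<integral>\<^sup>+t. indicator (S \<inter> {..<1}) (exp (-t)) * kk s (exp (-t)) * ennreal (exp (- (2 * t))) \<partial>lborel)
        = (\<integral>\<^sup>+t. (q t * (indicator {0<..<t} s * ennreal ((s / t) powr \<gamma>))) * ennreal (exp s / (2 * pi)) \<partial>lborel)"
      proof (rule nn_integral_cong)
        fix t :: real
        have "kk s (exp (-t)) = indicator {0<..<t} s * ennreal ((s / t) powr \<gamma> * (exp s / (2 * pi)))"
        proof -
          have "x / (2 * pi * exp (-s)) = x * (exp s / (2 * pi))" for x
            by (simp add: exp_minus field_simps)
          then show ?thesis using s by (auto simp: kk_def split: split_indicator)
        qed
        then show "indicator (S \<inter> {..<1}) (exp (-t)) * kk s (exp (-t)) * ennreal (exp (- (2 * t)))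
          = q t * (indicator {0<..<t} s * ennreal ((s / t) powr \<gamma>)) * ennreal (exp s / (2 * pi))"
          by (simp add: q_def ennreal_mult mult_ac del: times_divide_eq_right)
      qed
      also have "\<dots> = (\<integral>\<^sup>+t. q t * (indicator {0<..<t} s * ennreal ((s / t) powr \<gamma>)) \<partial>lborel) * ennreal (exp s / (2 * pi))"
        by (rule nn_integral_multc) measurable
      also have "ennreal (2 * pi) * (I * ennreal (exp s / (2 * pi))) = I * ennreal (exp s)" for I
      proof -
        have "ennreal (2 * pi) * ennreal (exp s / (2 * pi)) = ennreal (exp s)" by (simp flip: ennreal_mult)
        then show ?thesis by (metis mult.left_commute)
      qed
      finally show ?thesis .
    qed
    have "(\<integral>\<^sup>+t. L (exp (-t) *\<^sub>R e) * ennreal (exp (- (2 * t))) \<partial>lborel)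
      \<le> (\<integral>\<^sup>+t. q t * (\<integral>\<^sup>+s. indicator {0<..<t} s * ennreal ((s / t) powr \<gamma>) * D s \<partial>lborel) \<partial>lborel)"
    proof (rule nn_integral_mono)
      fix t :: real
      have "L (exp (-t) *\<^sub>R e) * ennreal (exp (- (2 * t))) = q t * ennreal \<bar>w t\<bar>"
        using e by (auto simp: L_def q_def w_def E mult.commute split: split_indicator)
      also have "\<dots> \<le> q t * (\<integral>\<^sup>+s. indicator {0<..<t} s * ennreal ((s / t) powr \<gamma>) * D s \<partial>lborel)"
        unfolding D_def by (intro mult_left_mono weighted_representation_ray[OF ab(1) w w' out]) auto
      finally show "L (exp (-t) *\<^sub>R e) * ennreal (exp (- (2 * t))) \<le> q t * (\<integral>\<^sup>+s. indicator {0<..<t} s * ennreal ((s / t) powr \<gamma>) * D s \<partial>lborel)" .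
    qed
    also have "\<dots> = (\<integral>\<^sup>+t. (\<integral>\<^sup>+s. q t * (indicator {0<..<t} s * ennreal ((s / t) powr \<gamma>)) * D s \<partial>lborel) \<partial>lborel)"
    proof (rule nn_integral_cong)
      fix t
      have "q t * (\<integral>\<^sup>+s. indicator {0<..<t} s * ennreal ((s / t) powr \<gamma>) * D s \<partial>lborel)
        = (\<integral>\<^sup>+s. q t * (indicator {0<..<t} s * ennreal ((s / t) powr \<gamma>) * D s) \<partial>lborel)"
        by (rule nn_integral_cmult[symmetric]) measurable
      then show "q t * (\<integral>\<^sup>+s. indicator {0<..<t} s * ennreal ((s / t) powr \<gamma>) * D s \<partial>lborel)
        = (\<integral>\<^sup>+s. q t * (indicator {0<..<t} s * ennreal ((s / t) powr \<gamma>)) * D s \<partial>lborel)"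
        by (simp add: mult.assoc)
    qed
    also have "\<dots> = (\<integral>\<^sup>+s. (\<integral>\<^sup>+t. q t * (indicator {0<..<t} s * ennreal ((s / t) powr \<gamma>)) * D s \<partial>lborel) \<partial>lborel)"
    proof (rule lborel_pair.Fubini')
      have "(\<lambda>p. q (snd p) * (indicator {p. 0 < fst p \<and> fst p < snd p} p * ennreal ((fst p / snd p) powr \<gamma>)) * D (fst p)) \<in> borel_measurable (lborel \<Otimes>\<^sub>M lborel)"
        by measurable
      also have "(\<lambda>p. q (snd p) * (indicator {p. 0 < fst p \<and> fst p < snd p} p * ennreal ((fst p / snd p) powr \<gamma>)) * D (fst p))
        = (\<lambda>(s, t). q t * (indicator {0<..<t} s * ennreal ((s / t) powr \<gamma>)) * D s)"
        by (auto simp: fun_eq_iff split: split_indicator)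
      finally show "(\<lambda>(s, t). q t * (indicator {0<..<t} s * ennreal ((s / t) powr \<gamma>)) * D s) \<in> borel_measurable (lborel \<Otimes>\<^sub>M lborel)" .
    qed
    also have "\<dots> = (\<integral>\<^sup>+s. R (exp (-s) *\<^sub>R e) * ennreal (exp (- (2 * s))) \<partial>lborel)"
    proof (rule nn_integral_cong)
      fix s :: real
      show "(\<integral>\<^sup>+t. q t * (indicator {0<..<t} s * ennreal ((s / t) powr \<gamma>)) * D s \<partial>lborel) = R (exp (-s) *\<^sub>R e) * ennreal (exp (- (2 * s)))"
      proof (cases "s > 0")
        case True
        \<comment> \<open>The factor exp s is the one left over in \<open>K\<close>. Together with
          the area density exp (- 2 s) it makes up the exp (- s) of
          \<open>hardy_factor_ray\<close>.\<close>
        have "D s = ennreal (exp s) * ennreal \<bar>hardy_factor \<gamma> \<phi> (gradient \<phi>) (exp (-s) *\<^sub>R e)\<bar> * ennreal (exp (- (2 * s)))"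
        proof -
          have 1: "exp s * exp (- (2 * s)) = exp (-s)" by (simp flip: exp_add)
          let ?h = "\<bar>hardy_factor \<gamma> \<phi> (gradient \<phi>) (exp (-s) *\<^sub>R e)\<bar>"
          have "D s = ennreal (exp (-s) * ?h)"
            unfolding D_def w_def w'_def hardy_factor_ray[OF e True] ..
          also have "exp (-s) * ?h = exp s * ?h * exp (- (2 * s))"
            unfolding 1[symmetric] by (simp only: mult_ac)
          finally show ?thesis by (simp add: ennreal_mult)
        qed
        moreover have "(\<integral>\<^sup>+t. q t * (indicator {0<..<t} s * ennreal ((s / t) powr \<gamma>)) * D s \<partial>lborel)
          = (\<integral>\<^sup>+t. q t * (indicator {0<..<t} s * ennreal ((s / t) powr \<gamma>)) \<partial>lborel) * D s"
          by (rule nn_integral_multc) measurable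
        ultimately show ?thesis
          using True e unfolding R_def K[OF True] by (simp add: mult.assoc)
      next
        case False
        then have "indicator unit_disc (exp (-s) *\<^sub>R e) = (0::ennreal)" using e by (auto split: split_indicator)
        moreover have "indicator {0<..<t} s = (0::ennreal)" for t using False by (auto split: split_indicator)
        ultimately show ?thesis unfolding R_def by simp
      qed
    qed
    finally show ?thesis .
  qed
  have "(\<integral>\<^sup>+y. L y \<partial>lborel) \<le> (\<integral>\<^sup>+y. R y \<partial>lborel)"
    unfolding log_polar[OF LR(1)] log_polar[OF LR(2)]
  proof (rule mult_left_mono, rule nn_integral_mono_AE)
    show "AE y in lborel. indicator unit_disc y * (\<integral>\<^sup>+t. L (exp (-t) *\<^sub>R (y /\<^sub>R norm y)) * ennreal (exp (- (2 * t))) \<partial>lborel)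
      \<le> indicator unit_disc y * (\<integral>\<^sup>+t. R (exp (-t) *\<^sub>R (y /\<^sub>R norm y)) * ennreal (exp (- (2 * t))) \<partial>lborel)"
      using AE_lborel_singleton[of "0::real^2"]
      by eventually_elim (intro mult_left_mono ray, auto)
  qed simp
  then show ?thesis unfolding L_def R_def K_def .
qed

section \<open>Passage of the factorised inequality to limits of test functions\<close>

lemma square_sum_young:
  fixes p q \<delta> :: real
  assumes "\<delta> > 0" shows "(p + q)\<^sup>2 \<le> (1 + \<delta>) * p\<^sup>2 + (1 + 1 / \<delta>) * q\<^sup>2"
proof -
  have "0 \<le> (\<delta> * p - q)\<^sup>2 / \<delta>" using assms by simp
  also have "\<dots> = \<delta> * p\<^sup>2 - 2 * p * q + q\<^sup>2 / \<delta>" using assms by (simp add: power2_eq_square field_simps)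
  finally show ?thesis using assms by (simp add: power2_eq_square algebra_simps)
qed

lemma hardy_factor_diff:
  "hardy_factor \<gamma> (\<lambda>x. v x - v' x) (\<lambda>x. g x - g' x) y = hardy_factor \<gamma> v g y - hardy_factor \<gamma> v' g' y"
  by (simp add: hardy_factor_def inner_diff_right add_divide_distrib diff_divide_distrib right_diff_distrib)

lemma hardy_energy_nonneg: "\<mu> \<ge> 0 \<Longrightarrow> hardy_energy \<mu> v g y \<ge> 0"
  by (auto simp: hardy_energy_def potential_def hardy_def)

text \<open>A crude pointwise bound for the difference between a function and its approximation,
  where any constant will do. The version without the 2 comes from integration along rays with
  vanishing boundary terms.\<close>

lemma hardy_factor_square_le:
  assumes "\<gamma> \<ge> 0" "y \<in> unit_disc"
  shows "(hardy_factor \<gamma> v g y)\<^sup>2 \<le> 2 * hardy_energy (\<gamma>\<^sup>2 + \<gamma>) v g y"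
proof (cases "y = 0")
  case True
  then show ?thesis using hardy_energy_nonneg[of "\<gamma>\<^sup>2 + \<gamma>" v g y] assms by (simp add: hardy_factor_def)
next
  case False
  have "(y \<bullet> g y / norm y)\<^sup>2 \<le> (norm (g y))\<^sup>2"
    using False Cauchy_Schwarz_ineq2[of y "g y"]
    by (intro power2_le_iff_abs_le[THEN iffD2]) (auto simp: abs_divide divide_le_eq mult.commute)
  moreover have "(\<gamma> * v y / ln (norm y) / norm y)\<^sup>2 = \<gamma>\<^sup>2 * (potential hardy y * (v y)\<^sup>2)"
    using False assms(2) by (simp add: potential_def hardy_def power_mult_distrib power_divide field_simps)
  moreover have "\<gamma>\<^sup>2 * (potential hardy y * (v y)\<^sup>2) \<le> (\<gamma>\<^sup>2 + \<gamma>) * (potential hardy y * (v y)\<^sup>2)"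
    using assms by (intro mult_right_mono mult_nonneg_nonneg) (auto simp: potential_def hardy_def)
  moreover have "hardy_factor \<gamma> v g y = y \<bullet> g y / norm y + \<gamma> * v y / ln (norm y) / norm y"
    by (simp add: hardy_factor_def add_divide_distrib)
  ultimately show ?thesis
    using square_sum_young[of 1 "y \<bullet> g y / norm y" "\<gamma> * v y / ln (norm y) / norm y"]
    by (simp add: hardy_energy_def mult.assoc)
qed

lemma hardy_energy_young:
  assumes "\<delta> > 0" "\<mu> \<ge> 0"
  shows "hardy_energy \<mu> v g y \<le> (1 + \<delta>) * hardy_energy \<mu> v' g' y + (1 + 1 / \<delta>) * hardy_energy \<mu> (\<lambda>x. v x - v' x) (\<lambda>x. g x - g' x) y"
proof -
  have "(norm (g y))\<^sup>2 \<le> (norm (g' y) + norm (g y - g' y))\<^sup>2"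
    by (intro power_mono norm_triangle_sub) simp
  also have "\<dots> \<le> (1 + \<delta>) * (norm (g' y))\<^sup>2 + (1 + 1 / \<delta>) * (norm (g y - g' y))\<^sup>2"
    by (rule square_sum_young[OF assms(1)])
  finally have 1: "(norm (g y))\<^sup>2 \<le> (1 + \<delta>) * (norm (g' y))\<^sup>2 + (1 + 1 / \<delta>) * (norm (g y - g' y))\<^sup>2" .
  have "(v y)\<^sup>2 \<le> (1 + \<delta>) * (v' y)\<^sup>2 + (1 + 1 / \<delta>) * (v y - v' y)\<^sup>2"
    using square_sum_young[OF assms(1), of "v' y" "v y - v' y"] by simp
  then have "\<mu> * potential hardy y * (v y)\<^sup>2 \<le> \<mu> * potential hardy y * ((1 + \<delta>) * (v' y)\<^sup>2 + (1 + 1 / \<delta>) * (v y - v' y)\<^sup>2)"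
    using assms by (intro mult_left_mono mult_nonneg_nonneg) (auto simp: potential_def hardy_def)
  with 1 show ?thesis by (simp add: hardy_energy_def algebra_simps)
qed

text \<open>The sharp \<open>hardy_factor_energy_le\<close> is available for test functions. Passing
  from \<open>u\<close> to \<open>\<phi> n\<close> and back costs a factor 1 + \<delta> each time,
  plus a multiple, depending on \<delta>, of the energy of the difference. Letting n tend to
  infinity for fixed \<delta> removes the latter, and then \<delta> tends to 0.\<close>

lemma hardy_factor_L2_le_1:
  assumes \<gamma>: "\<gamma> \<ge> 0" and \<mu>: "\<mu> = \<gamma>\<^sup>2 + \<gamma>"
    and u [measurable]: "u \<in> borel_measurable borel" "g \<in> borel_measurable borel"
    and \<phi>: "\<And>n::nat. \<phi> n \<in> test_functions (unit_disc - {0})"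
    and lim: "(\<lambda>n. \<integral>\<^sup>+y. indicator unit_disc y * ennreal (hardy_energy \<mu> (\<lambda>x. \<phi> n x - u x) (\<lambda>x. gradient (\<phi> n) x - g x) y) \<partial>lborel) \<longlonglongrightarrow> 0"
    and le1: "(\<integral>\<^sup>+y. indicator unit_disc y * ennreal (hardy_energy \<mu> u g y) \<partial>lborel) \<le> 1"
  shows "(\<integral>\<^sup>+y. indicator unit_disc y * ennreal ((hardy_factor \<gamma> u g y)\<^sup>2) \<partial>lborel) \<le> 1" (is "?A \<le> 1")
proof -
  note [measurable] = test_functionsD(5,6)[OF \<phi>]
  have \<mu>0: "\<mu> \<ge> 0" using \<gamma> \<mu> by simp
  let ?e = "\<lambda>n. \<integral>\<^sup>+y. indicator unit_disc y * ennreal (hardy_energy \<mu> (\<lambda>x. \<phi> n x - u x) (\<lambda>x. gradient (\<phi> n) x - g x) y) \<partial>lborel"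
  have main: "?A \<le> ennreal ((1 + \<delta>)\<^sup>2)" if \<delta>: "\<delta> > 0" for \<delta>
  proof -
    define c where "c = 1 + 1 / \<delta>"
    have c: "c \<ge> 0" using \<delta> by (simp add: c_def)
    have step: "?A \<le> ennreal ((1 + \<delta>)\<^sup>2) + ennreal ((1 + \<delta>) * c + 2 * c) * ?e n" for n
    proof -
      let ?C = "\<integral>\<^sup>+y. indicator unit_disc y * ennreal (hardy_energy \<mu> (\<phi> n) (gradient (\<phi> n)) y) \<partial>lborel"
      have "?A \<le> (\<integral>\<^sup>+y. ennreal (1 + \<delta>) * (indicator unit_disc y * ennreal ((hardy_factor \<gamma> (\<phi> n) (gradient (\<phi> n)) y)\<^sup>2))
         + ennreal (2 * c) * (indicator unit_disc y * ennreal (hardy_energy \<mu> (\<lambda>x. \<phi> n x - u x) (\<lambda>x. gradient (\<phi> n) x - g x) y)) \<partial>lborel)"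
      proof (rule nn_integral_mono)
        fix y
        show "indicator unit_disc y * ennreal ((hardy_factor \<gamma> u g y)\<^sup>2)
          \<le> ennreal (1 + \<delta>) * (indicator unit_disc y * ennreal ((hardy_factor \<gamma> (\<phi> n) (gradient (\<phi> n)) y)\<^sup>2))
         + ennreal (2 * c) * (indicator unit_disc y * ennreal (hardy_energy \<mu> (\<lambda>x. \<phi> n x - u x) (\<lambda>x. gradient (\<phi> n) x - g x) y))"
        proof (cases "y \<in> unit_disc")
          case True
          let ?d = "hardy_factor \<gamma> (\<lambda>x. \<phi> n x - u x) (\<lambda>x. gradient (\<phi> n) x - g x) y"
          let ?h = "hardy_energy \<mu> (\<lambda>x. \<phi> n x - u x) (\<lambda>x. gradient (\<phi> n) x - g x) y"
          have "(hardy_factor \<gamma> u g y)\<^sup>2 = (hardy_factor \<gamma> (\<phi> n) (gradient (\<phi> n)) y + - ?d)\<^sup>2"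
            by (simp add: hardy_factor_diff)
          also have "\<dots> \<le> (1 + \<delta>) * (hardy_factor \<gamma> (\<phi> n) (gradient (\<phi> n)) y)\<^sup>2 + c * (- ?d)\<^sup>2"
            unfolding c_def by (rule square_sum_young[OF \<delta>])
          also have "c * (- ?d)\<^sup>2 \<le> c * (2 * ?h)"
            using hardy_factor_square_le[OF \<gamma> True] c unfolding \<mu> power2_minus by (rule mult_left_mono)
          finally have "ennreal ((hardy_factor \<gamma> u g y)\<^sup>2) \<le> ennreal ((1 + \<delta>) * (hardy_factor \<gamma> (\<phi> n) (gradient (\<phi> n)) y)\<^sup>2 + c * (2 * ?h))"
            by (intro ennreal_leI) simp
          also have "\<dots> = ennreal ((1 + \<delta>) * (hardy_factor \<gamma> (\<phi> n) (gradient (\<phi> n)) y)\<^sup>2) + ennreal (2 * c * ?h)"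
            using \<delta> c hardy_energy_nonneg[OF \<mu>0] by (subst ennreal_plus[symmetric]) (auto simp: mult_ac)
          also have "ennreal ((1 + \<delta>) * (hardy_factor \<gamma> (\<phi> n) (gradient (\<phi> n)) y)\<^sup>2) = ennreal (1 + \<delta>) * ennreal ((hardy_factor \<gamma> (\<phi> n) (gradient (\<phi> n)) y)\<^sup>2)"
            by (rule ennreal_mult') (use \<delta> in simp)
          also have "ennreal (2 * c * ?h) = ennreal (2 * c) * ennreal ?h"
            by (rule ennreal_mult') (use c in simp)
          finally show ?thesis using True by simp
        qed simp
      qed
      also have "\<dots> = ennreal (1 + \<delta>) * (\<integral>\<^sup>+y. indicator unit_disc y * ennreal ((hardy_factor \<gamma> (\<phi> n) (gradient (\<phi> n)) y)\<^sup>2) \<partial>lborel) + ennreal (2 * c) * ?e n"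
        by (subst nn_integral_add, measurable, subst nn_integral_cmult, measurable, subst nn_integral_cmult, measurable)
      also have "\<dots> \<le> ennreal (1 + \<delta>) * ?C + ennreal (2 * c) * ?e n"
        unfolding \<mu> by (intro add_right_mono mult_left_mono hardy_factor_energy_le \<phi> \<gamma>) simp
      also have "?C \<le> (\<integral>\<^sup>+y. ennreal (1 + \<delta>) * (indicator unit_disc y * ennreal (hardy_energy \<mu> u g y))
         + ennreal c * (indicator unit_disc y * ennreal (hardy_energy \<mu> (\<lambda>x. \<phi> n x - u x) (\<lambda>x. gradient (\<phi> n) x - g x) y)) \<partial>lborel)"
      proof (rule nn_integral_mono)
        fix y
        let ?h = "hardy_energy \<mu> (\<lambda>x. \<phi> n x - u x) (\<lambda>x. gradient (\<phi> n) x - g x) y"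
        have "ennreal (hardy_energy \<mu> (\<phi> n) (gradient (\<phi> n)) y) \<le> ennreal ((1 + \<delta>) * hardy_energy \<mu> u g y + c * ?h)"
          unfolding c_def by (intro ennreal_leI hardy_energy_young \<delta> \<mu>0)
        also have "\<dots> = ennreal ((1 + \<delta>) * hardy_energy \<mu> u g y) + ennreal (c * ?h)"
          using \<delta> c hardy_energy_nonneg[OF \<mu>0] by (intro ennreal_plus) auto
        also have "ennreal ((1 + \<delta>) * hardy_energy \<mu> u g y) = ennreal (1 + \<delta>) * ennreal (hardy_energy \<mu> u g y)"
          by (rule ennreal_mult') (use \<delta> in simp)
        also have "ennreal (c * ?h) = ennreal c * ennreal ?h"
          by (rule ennreal_mult'[OF c])
        finally show "indicator unit_disc y * ennreal (hardy_energy \<mu> (\<phi> n) (gradient (\<phi> n)) y)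
          \<le> ennreal (1 + \<delta>) * (indicator unit_disc y * ennreal (hardy_energy \<mu> u g y)) + ennreal c * (indicator unit_disc y * ennreal ?h)"
          by (auto split: split_indicator)
      qed
      also have "\<dots> = ennreal (1 + \<delta>) * (\<integral>\<^sup>+y. indicator unit_disc y * ennreal (hardy_energy \<mu> u g y) \<partial>lborel) + ennreal c * ?e n"
        by (subst nn_integral_add, measurable, subst nn_integral_cmult, measurable, subst nn_integral_cmult, measurable)
      also have "\<dots> \<le> ennreal (1 + \<delta>) * 1 + ennreal c * ?e n"
        by (intro add_right_mono mult_left_mono le1) simp
      also have "ennreal (1 + \<delta>) * (ennreal (1 + \<delta>) * 1 + ennreal c * ?e n) + ennreal (2 * c) * ?e n
         = ennreal ((1 + \<delta>)\<^sup>2) + ennreal ((1 + \<delta>) * c + 2 * c) * ?e n"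
      proof -
        have "ennreal ((1 + \<delta>)\<^sup>2) = ennreal (1 + \<delta>) * ennreal (1 + \<delta>)"
          using \<delta> by (simp add: power2_eq_square ennreal_mult' del: ennreal_plus)
        moreover have "ennreal ((1 + \<delta>) * c + 2 * c) = ennreal (1 + \<delta>) * ennreal c + ennreal (2 * c)"
          using \<delta> c by (subst ennreal_plus) (auto simp: ennreal_mult' simp del: ennreal_plus)
        ultimately show ?thesis by (simp add: distrib_left distrib_right mult.assoc add.assoc del: ennreal_plus)
      qed
      finally show ?thesis by (simp add: add_mono mult_left_mono)
    qed
    have "(\<lambda>n. ennreal ((1 + \<delta>)\<^sup>2) + ennreal ((1 + \<delta>) * c + 2 * c) * ?e n) \<longlonglongrightarrow> ennreal ((1 + \<delta>)\<^sup>2) + ennreal ((1 + \<delta>) * c + 2 * c) * 0"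
      by (intro tendsto_add tendsto_const ennreal_tendsto_cmult lim) simp
    then show ?thesis using step by (intro LIMSEQ_le_const) auto
  qed
  have "(\<lambda>n. ennreal ((1 + 1 / real (Suc n))\<^sup>2)) \<longlonglongrightarrow> ennreal ((1 + 0)\<^sup>2)"
    using LIMSEQ_inverse_real_of_nat by (intro tendsto_ennrealI tendsto_intros) (simp add: inverse_eq_divide)
  then show ?thesis by (intro LIMSEQ_le_const[where X = "\<lambda>n. ennreal ((1 + 1 / real (Suc n))\<^sup>2)"]) (auto intro!: exI main)
qed

text \<open>The exponent is 2 c with c = 2 pi (2 \<gamma> + 1). The constant 2 is that of
  \<open>nn_integral_log_le\<close>; \<open>hardy_kernel_gram\<close> adds nothing to it.\<close>

lemma radial_moser_upper:
  assumes \<mu>: "\<mu> > 0" and V: "continuous_on {0<..<1} V" and V1: "\<forall>r\<in>{0<..<1}. V r \<ge> 1 / (r\<^sup>2 * (- ln r)\<^sup>2)"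
    and u: "u \<in> H_space V \<mu>" and n1: "H_norm V \<mu> u \<le> 1" and rad: "radial u"
  shows "exp_integral (m_crit \<mu>) u \<le> ennreal (critical_const 2)"
proof (rule H_space_unit_ball_approx[OF \<mu> V V1 u n1])
  fix u0 g \<phi>
  assume u0: "u0 \<in> borel_measurable borel" and g: "g \<in> borel_measurable borel"
    and eq0: "AE x in lborel. x \<in> unit_disc \<longrightarrow> u x = u0 x"
    and \<phi>: "\<And>n::nat. \<phi> n \<in> test_functions (unit_disc - {0})"
    and lim1: "(\<lambda>n. \<integral>\<^sup>+x. indicator unit_disc x * ennreal ((norm (gradient (\<phi> n) x - g x))\<^sup>2) \<partial>lborel) \<longlonglongrightarrow> 0"
    and lim2: "(\<lambda>n. \<integral>\<^sup>+x. indicator unit_disc x * ennreal (potential hardy x * (\<phi> n x - u0 x)\<^sup>2) \<partial>lborel) \<longlonglongrightarrow> 0"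
    and le1: "(\<integral>\<^sup>+x. indicator unit_disc x * ennreal ((norm (g x))\<^sup>2 + \<mu> * potential hardy x * (u0 x)\<^sup>2) \<partial>lborel) \<le> 1"
  obtain \<rho> where "AE x in lebesgue. x \<in> unit_disc \<longrightarrow> u x = \<rho> (norm x)"
    using rad unfolding radial_def by blast
  then have "AE x in lborel. x \<in> unit_disc \<longrightarrow> u x = \<rho> (norm x)" unfolding AE_completion_iff .
  with eq0 have "AE x in lborel. x \<in> unit_disc \<longrightarrow> u0 x = \<rho> (norm x)" by eventually_elim auto
  then obtain h where h: "h \<in> borel_measurable borel" and u0h: "AE x in lborel. x \<in> unit_disc \<longrightarrow> u0 (x::real^2) = h (norm x)"
    using radial_borel[OF u0] by blast
  \<comment> \<open>\<open>u'\<close> is a function of the norm everywhere, not only almost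
    everywhere, so its superlevel sets are exactly rotation invariant. The representative
    \<open>g\<close> of the gradient is kept.\<close>
  define u' where "u' x = h (norm x)" for x :: "real^2"
  note [measurable] = u0 g h test_functionsD(5,6)[OF \<phi>]
  have u' [measurable]: "u' \<in> borel_measurable borel" unfolding u'_def by measurable
  have eq: "AE x in lborel. x \<in> unit_disc \<longrightarrow> u x = u' x"
    using eq0 u0h by eventually_elim (auto simp: u'_def)
  \<comment> \<open>The nonnegative root of \<gamma>^2 + \<gamma> = \<mu>, for which the
    factorisation reproduces the given energy.\<close>
  define \<gamma> where "\<gamma> = (sqrt (1 + 4 * \<mu>) - 1) / 2"
  have \<gamma>: "\<gamma> \<ge> 0" "\<mu> = \<gamma>\<^sup>2 + \<gamma>" "2 * \<gamma> + 1 = sqrt (1 + 4 * \<mu>)"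
  proof -
    show "\<gamma> \<ge> 0" using \<mu> by (simp add: \<gamma>_def)
    show k: "2 * \<gamma> + 1 = sqrt (1 + 4 * \<mu>)"
    proof -
      have "2 * ((s - 1) / 2) + 1 = s" for s :: real by (simp add: field_simps)
      then show ?thesis unfolding \<gamma>_def .
    qed
    have "(2 * \<gamma> + 1)\<^sup>2 = 1 + 4 * \<mu>" unfolding k using \<mu> by simp
    then show "\<mu> = \<gamma>\<^sup>2 + \<gamma>" by (simp add: power2_eq_square algebra_simps)
  qed
  have \<mu>0: "\<mu> \<ge> 0" using \<mu> by simp
  have h0: "0 \<le> potential hardy x" for x by (auto simp: potential_def hardy_def)
  have ind_cong: "AE x in lborel. indicator unit_disc x * F (u0 x) x = indicator unit_disc x * F (u' x) x" for F :: "real \<Rightarrow> real^2 \<Rightarrow> ennreal"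
    using u0h by eventually_elim (auto simp: u'_def split: split_indicator)
  have lim2': "(\<lambda>n. \<integral>\<^sup>+x. indicator unit_disc x * ennreal (potential hardy x * (\<phi> n x - u' x)\<^sup>2) \<partial>lborel) \<longlonglongrightarrow> 0"
    using lim2 unfolding nn_integral_cong_AE[OF ind_cong[of "\<lambda>v x. ennreal (potential hardy x * (\<phi> _ x - v)\<^sup>2)"]] .
  have le1': "(\<integral>\<^sup>+y. indicator unit_disc y * ennreal (hardy_energy \<mu> u' g y) \<partial>lborel) \<le> 1"
    using le1 unfolding nn_integral_cong_AE[OF ind_cong[of "\<lambda>v x. ennreal ((norm (g x))\<^sup>2 + \<mu> * potential hardy x * v\<^sup>2)"]] hardy_energy_def .
  have lim: "(\<lambda>n. \<integral>\<^sup>+y. indicator unit_disc y * ennreal (hardy_energy \<mu> (\<lambda>x. \<phi> n x - u' x) (\<lambda>x. gradient (\<phi> n) x - g x) y) \<partial>lborel) \<longlonglongrightarrow> 0"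
  proof -
    have "(\<integral>\<^sup>+y. indicator unit_disc y * ennreal (hardy_energy \<mu> (\<lambda>x. \<phi> n x - u' x) (\<lambda>x. gradient (\<phi> n) x - g x) y) \<partial>lborel)
      = (\<integral>\<^sup>+x. indicator unit_disc x * ennreal ((norm (gradient (\<phi> n) x - g x))\<^sup>2) \<partial>lborel)
        + ennreal \<mu> * (\<integral>\<^sup>+x. indicator unit_disc x * ennreal (potential hardy x * (\<phi> n x - u' x)\<^sup>2) \<partial>lborel)" for n
    proof -
      have "(\<integral>\<^sup>+y. indicator unit_disc y * ennreal (hardy_energy \<mu> (\<lambda>x. \<phi> n x - u' x) (\<lambda>x. gradient (\<phi> n) x - g x) y) \<partial>lborel)
        = (\<integral>\<^sup>+x. indicator unit_disc x * ennreal ((norm (gradient (\<phi> n) x - g x))\<^sup>2)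
          + ennreal \<mu> * (indicator unit_disc x * ennreal (potential hardy x * (\<phi> n x - u' x)\<^sup>2)) \<partial>lborel)"
        using h0 \<mu>0 by (intro nn_integral_cong)
          (auto simp: hardy_energy_def ennreal_mult'[symmetric] mult.assoc split: split_indicator)
      also have "\<dots> = (\<integral>\<^sup>+x. indicator unit_disc x * ennreal ((norm (gradient (\<phi> n) x - g x))\<^sup>2) \<partial>lborel)
        + ennreal \<mu> * (\<integral>\<^sup>+x. indicator unit_disc x * ennreal (potential hardy x * (\<phi> n x - u' x)\<^sup>2) \<partial>lborel)"
        by (subst nn_integral_add, measurable, subst nn_integral_cmult, measurable)
      finally show ?thesis .
    qed
    moreover have "(\<lambda>n. (\<integral>\<^sup>+x. indicator unit_disc x * ennreal ((norm (gradient (\<phi> n) x - g x))\<^sup>2) \<partial>lborel)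
        + ennreal \<mu> * (\<integral>\<^sup>+x. indicator unit_disc x * ennreal (potential hardy x * (\<phi> n x - u' x)\<^sup>2) \<partial>lborel)) \<longlonglongrightarrow> 0 + ennreal \<mu> * 0"
      by (intro tendsto_add ennreal_tendsto_cmult lim1 lim2') simp
    ultimately show ?thesis by simp
  qed
  have L2: "(\<lambda>n. \<integral>\<^sup>+x. indicator unit_disc x * ennreal ((\<phi> n x - u' x)\<^sup>2) \<partial>lborel) \<longlonglongrightarrow> 0"
  proof (rule tendsto_sandwich[OF _ _ tendsto_const lim2'])
    show "\<forall>\<^sub>F n in sequentially. (\<integral>\<^sup>+x. indicator unit_disc x * ennreal ((\<phi> n x - u' x)\<^sup>2) \<partial>lborel)
       \<le> (\<integral>\<^sup>+x. indicator unit_disc x * ennreal (potential hardy x * (\<phi> n x - u' x)\<^sup>2) \<partial>lborel)"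
      by (intro always_eventually allI L2_le_hardy)
  qed simp
  let ?d = "\<lambda>n. hardy_factor \<gamma> (\<lambda>x. \<phi> n x - u' x) (\<lambda>x. gradient (\<phi> n) x - g x)"
  have "(\<integral>\<^sup>+x. indicator unit_disc x * ennreal (exp (2 * (2 * pi * (2 * \<gamma> + 1)) * (u' x)\<^sup>2)) \<partial>lborel) \<le> ennreal (critical_const 2)"
  proof (rule moser_bound_from_kernel[where \<phi> = \<phi> and k = "hardy_kernel \<gamma>" and f = "\<lambda>y. indicator unit_disc y * ennreal \<bar>hardy_factor \<gamma> u' g y\<bar>"
        and r = "\<lambda>n y. indicator unit_disc y * ennreal \<bar>?d n y\<bar>"
        and F = "\<lambda>n y. indicator unit_disc y * ennreal \<bar>hardy_factor \<gamma> (\<phi> n) (gradient (\<phi> n)) y\<bar>", OF u' _ hardy_kernel_measurable _ _ _ _ _ L2])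
    have sq: "(\<integral>\<^sup>+y. (indicator unit_disc y * ennreal \<bar>F y\<bar>)\<^sup>2 \<partial>lborel) = (\<integral>\<^sup>+y. indicator unit_disc y * ennreal ((F y)\<^sup>2) \<partial>lborel)" for F :: "real^2 \<Rightarrow> real"
      by (intro nn_integral_cong) (auto simp: ennreal_power split: split_indicator)
    show "(\<integral>\<^sup>+y. (indicator unit_disc y * ennreal \<bar>hardy_factor \<gamma> u' g y\<bar>)\<^sup>2 \<partial>lborel) \<le> 1"
      unfolding sq by (rule hardy_factor_L2_le_1[OF \<gamma>(1,2) u' g \<phi> lim le1'])
    show "(\<lambda>n. \<integral>\<^sup>+y. (indicator unit_disc y * ennreal \<bar>?d n y\<bar>)\<^sup>2 \<partial>lborel) \<longlonglongrightarrow> 0"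
      unfolding sq
    proof (rule tendsto_sandwich[OF _ _ tendsto_const])
      let ?e = "\<lambda>n. \<integral>\<^sup>+y. indicator unit_disc y * ennreal (hardy_energy \<mu> (\<lambda>x. \<phi> n x - u' x) (\<lambda>x. gradient (\<phi> n) x - g x) y) \<partial>lborel"
      show "(\<lambda>n. 2 * ?e n) \<longlonglongrightarrow> 0"
        using ennreal_tendsto_cmult[OF _ lim, of 2] by simp
      show "\<forall>\<^sub>F n in sequentially. (\<integral>\<^sup>+y. indicator unit_disc y * ennreal ((?d n y)\<^sup>2) \<partial>lborel) \<le> 2 * ?e n"
      proof (rule always_eventually, rule allI)
        fix n
        have "(\<integral>\<^sup>+y. indicator unit_disc y * ennreal ((?d n y)\<^sup>2) \<partial>lborel)
          \<le> (\<integral>\<^sup>+y. 2 * (indicator unit_disc y * ennreal (hardy_energy \<mu> (\<lambda>x. \<phi> n x - u' x) (\<lambda>x. gradient (\<phi> n) x - g x) y)) \<partial>lborel)"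
        proof (rule nn_integral_mono)
          fix y
          let ?h = "hardy_energy \<mu> (\<lambda>x. \<phi> n x - u' x) (\<lambda>x. gradient (\<phi> n) x - g x) y"
          show "indicator unit_disc y * ennreal ((?d n y)\<^sup>2) \<le> 2 * (indicator unit_disc y * ennreal ?h)"
          proof (cases "y \<in> unit_disc")
            case True
            have "ennreal ((?d n y)\<^sup>2) \<le> ennreal (2 * ?h)"
              using hardy_factor_square_le[OF \<gamma>(1) True] unfolding \<gamma>(2) by (rule ennreal_leI)
            also have "\<dots> = ennreal 2 * ennreal ?h" by (rule ennreal_mult') simp
            finally show ?thesis using True by simp
          qed simp
        qed
        also have "\<dots> = 2 * ?e n" by (rule nn_integral_cmult) measurable
        finally show "(\<integral>\<^sup>+y. indicator unit_disc y * ennreal ((?d n y)\<^sup>2) \<partial>lborel) \<le> 2 * ?e n" .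
      qed
    qed simp
    show "indicator unit_disc y * ennreal \<bar>hardy_factor \<gamma> (\<phi> n) (gradient (\<phi> n)) y\<bar>
      \<le> indicator unit_disc y * ennreal \<bar>hardy_factor \<gamma> u' g y\<bar> + indicator unit_disc y * ennreal \<bar>?d n y\<bar>" for n y
      by (auto simp: hardy_factor_diff split: split_indicator simp flip: ennreal_plus intro!: ennreal_leI)
    show "(\<integral>\<^sup>+x. indicator E x * ennreal \<bar>\<phi> n x\<bar> \<partial>lborel) \<le> (\<integral>\<^sup>+y. (\<integral>\<^sup>+x. indicator E x * hardy_kernel \<gamma> x y \<partial>lborel) *
        (indicator unit_disc y * ennreal \<bar>hardy_factor \<gamma> (\<phi> n) (gradient (\<phi> n)) y\<bar>) \<partial>lborel)"
      if E: "E = {x \<in> unit_disc. \<tau> < \<bar>u' x\<bar>}" for n E \<tau>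
    proof (rule hardy_kernel_representation[OF \<phi>, where S = "{r. \<tau> < \<bar>h r\<bar>}"])
      show "{r. \<tau> < \<bar>h r\<bar>} \<in> sets borel" by measurable
      show "E = {x \<in> unit_disc. norm x \<in> {r. \<tau> < \<bar>h r\<bar>}}" by (auto simp: E u'_def)
    qed
    show "(\<integral>\<^sup>+y. (\<integral>\<^sup>+x. indicator E x * hardy_kernel \<gamma> x y \<partial>lborel) * (\<integral>\<^sup>+x. indicator F x * hardy_kernel \<gamma> x y \<partial>lborel) \<partial>lborel)
      \<le> emeasure lborel E * emeasure lborel F * ennreal ((T + 2) / (2 * pi * (2 * \<gamma> + 1)))"
      if [measurable]: "E \<in> sets borel" "F \<in> sets borel" and sub: "E \<subseteq> unit_disc" "F \<subseteq> unit_disc"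
        and T: "T \<ge> 0" "emeasure lborel E = ennreal (pi * exp (- (2 * T)))" for E F T
    proof -
      define c where "c = 1 / (2 * pi * (2 * \<gamma> + 1))"
      have c: "c \<ge> 0" using \<gamma> by (simp add: c_def)
      have "(\<integral>\<^sup>+y. (\<integral>\<^sup>+x. indicator E x * hardy_kernel \<gamma> x y \<partial>lborel) * (\<integral>\<^sup>+x. indicator F x * hardy_kernel \<gamma> x y \<partial>lborel) \<partial>lborel)
        \<le> (ennreal c * (emeasure lborel E * ennreal (T + 0 + 2))) * emeasure lborel F"
      proof (rule gram_Fubini_le[where h = "\<lambda>x x'. ennreal c * ennreal (- ln (norm (x - 0)) + 0)", OF hardy_kernel_measurable])
        fix x' assume "x' \<in> F"
        have "(\<integral>\<^sup>+x. indicator E x * (ennreal c * ennreal (- ln (norm (x - 0)) + 0)) \<partial>lborel)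
          = ennreal c * (\<integral>\<^sup>+x. indicator E x * ennreal (- ln (norm (x - 0)) + 0) \<partial>lborel)"
          by (subst nn_integral_cmult[symmetric], measurable) (simp only: mult_ac)
        also have "\<dots> \<le> ennreal c * (emeasure lborel E * ennreal (T + 0 + 2))"
          using T by (intro mult_left_mono nn_integral_log_le) auto
        finally show "(\<integral>\<^sup>+x. indicator E x * (ennreal c * ennreal (- ln (norm (x - 0)) + 0)) \<partial>lborel)
          \<le> ennreal c * (emeasure lborel E * ennreal (T + 0 + 2))" .
      next
        show "(\<integral>\<^sup>+y. hardy_kernel \<gamma> x y * hardy_kernel \<gamma> x' y \<partial>lborel)
          \<le> ennreal c * ennreal (- ln (norm (x - 0)) + 0)" if "x \<in> E" "x' \<in> F" "x \<noteq> x'" for x x'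
          unfolding c_def using hardy_kernel_gram[of x x' \<gamma>] that sub \<gamma>(1) by blast
      qed measurable
      also have "\<dots> = emeasure lborel E * emeasure lborel F * (ennreal c * ennreal (T + 0 + 2))"
        by (simp only: mult_ac)
      also have "ennreal c * ennreal (T + 0 + 2) = ennreal ((T + 2) / (2 * pi * (2 * \<gamma> + 1)))"
      proof -
        have "(T + 2) / (2 * pi * (2 * \<gamma> + 1)) = c * (T + 0 + 2)" by (simp add: c_def)
        then show ?thesis by (simp only:) (rule ennreal_mult'[symmetric, OF c])
      qed
      finally show ?thesis .
    qed
    show "\<phi> n \<in> borel_measurable borel" for n by measurable
    show "(\<lambda>y. indicator unit_disc y * ennreal \<bar>hardy_factor \<gamma> u' g y\<bar>) \<in> borel_measurable borel" by measurable
    show "(\<lambda>y. indicator unit_disc y * ennreal \<bar>?d n y\<bar>) \<in> borel_measurable borel" for n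
      by measurable
    show "0 < 2 * pi * (2 * \<gamma> + 1)" using \<gamma>(1) by (intro mult_pos_pos) auto
  qed simp_all
  then show ?thesis by (simp add: exp_integral_eq[OF eq] m_crit_def \<gamma>(3) mult.assoc)
qed

section \<open>Concentrating sequences\<close>

lemma nn_integral_exp_abs:
  assumes "c > 0"
  shows "(\<integral>\<^sup>+t. ennreal (exp (- (c * \<bar>t\<bar>))) \<partial>lborel) = ennreal (2 / c)"
proof -
  have "(\<integral>\<^sup>+t. ennreal (exp (- (c * \<bar>t\<bar>))) \<partial>lborel)
    = (\<integral>\<^sup>+t. indicator {0<..} t * ennreal (exp (- (c * t))) + indicator {..<0} t * ennreal (exp (c * t)) \<partial>lborel)"
    by (rule nn_integral_lborel_cong_except[where a = 0]) (auto split: split_indicator)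
  also have "\<dots> = ennreal (1 / c) + ennreal (1 / c)"
    using assms by (subst nn_integral_add) (auto simp: nn_integral_exp_greaterThan nn_integral_exp_lessThan)
  also have "\<dots> = ennreal (2 / c)" using assms by (simp flip: ennreal_plus)
  finally show ?thesis .
qed

text \<open>With p = 1 / s the upper bound reads p^2 \<le> 2 exp p. As \<open>flat 2\<close> is the
  derivative of \<open>flat 0\<close>, this controls the slope of the cutoff.\<close>

lemma flat_2_le: "0 \<le> flat 2 s" "flat 2 s \<le> 2"
proof -
  show "0 \<le> flat 2 s" by (simp add: flat_def)
  show "flat 2 s \<le> 2"
  proof (cases "s > 0")
    case True
    have "(1 / s)\<^sup>2 \<le> 2 * exp (1 / s)"
    proof -
      have p: "1 / s > 0" using True by simp
      then show ?thesis using exp_lower_Taylor_quadratic[of "1 / s"] by linarith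
    qed
    then have "(1 / s)\<^sup>2 * exp (- (1 / s)) \<le> 2 * exp (1 / s) * exp (- (1 / s))"
      by (rule mult_right_mono) simp
    also have "\<dots> = 2" by (simp flip: exp_add)
    finally show ?thesis using True by (simp add: flat_def power_divide)
  qed (simp add: flat_def)
qed

lemma Ck_on_sqrt: "open S \<Longrightarrow> S \<subseteq> {0<..} \<Longrightarrow> Ck_on k sqrt S"
proof -
  assume S: "open S" "S \<subseteq> {0<..}"
  have "Ck_on k (\<lambda>x. exp (1/2 * ln x)) S"
    by (rule Ck_on_compose[OF S(1) open_UNIV Ck_on_mult[OF S(1) Ck_on_const[OF S(1)] Ck_on_ln[OF S]] Ck_on_exp[OF open_UNIV]]) simp
  then show "Ck_on k sqrt S"
  proof (rule Ck_on_cong[OF S(1), rotated])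
    fix x assume "x \<in> S"
    then show "exp (1/2 * ln x) = sqrt x" using S(2) powr_half_sqrt[of x] by (auto simp: powr_def)
  qed
qed

text \<open>The minimiser \<open>exp (- \<kappa> \<bar>\<tau>\<bar> / 2)\<close> of the limit problem is smoothed at the origin and cut off at
  distance \<open>m\<close>; its derivative is controlled by \<open>\<kappa> / 2\<close> times itself, which is why both halves of
  the energy contribute \<open>\<kappa> / 2\<close>.\<close>

lemma near_optimal_profile:
  assumes \<nu>: "\<nu> > 0" and \<kappa>': "\<kappa>' > sqrt (1 + 4 * \<nu>)"
  obtains Z :: "real \<Rightarrow> real" and m :: real where "\<And>k. Ck_on k Z UNIV" "m > 0" "\<And>\<tau>. \<bar>\<tau>\<bar> \<ge> m \<Longrightarrow> Z \<tau> = 0" "Z 0 = 1"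
    "(\<integral>\<^sup>+\<tau>. indicator {-m..m} \<tau> * ennreal ((deriv Z \<tau> + Z \<tau> / 2)\<^sup>2 + \<nu> * (Z \<tau>)\<^sup>2) \<partial>lborel) \<le> ennreal \<kappa>'"
proof -
  define \<kappa> where "\<kappa> = sqrt (1 + 4 * \<nu>)"
  have \<kappa>: "\<kappa> > 0" "\<kappa>\<^sup>2 = 1 + 4 * \<nu>" "\<kappa> < \<kappa>'" using \<nu> \<kappa>' by (auto simp: \<kappa>_def)
  \<comment> \<open>\<open>L / m\<close> will bound the slope of the cutoff: exp 1 is its
    normalisation, 2 bounds \<open>flat 2\<close>, and the inner derivative is at most 2 /
    m.\<close>
  define L :: real where "L = 4 * exp 1"
  \<comment> \<open>The energy bound obtained at the end of the proof. The single parameter m is the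
    cutoff radius, and 1 / m is both the smoothing length and the weight in
    \<open>square_sum_young\<close>; all losses vanish as m grows.\<close>
  have "((\<lambda>m. exp (\<kappa> / m) * ((2 + 1 / m) * \<kappa>\<^sup>2 / 4 + (1 + m) * L\<^sup>2 / m\<^sup>2) * (2 / \<kappa>)) \<longlongrightarrow> \<kappa>) at_top"
  proof -
    have "((\<lambda>m::real. exp (\<kappa> / m) * ((2 + 1 / m) * \<kappa>\<^sup>2 / 4 + (1 + m) * L\<^sup>2 / m\<^sup>2) * (2 / \<kappa>)) \<longlongrightarrow> exp 0 * ((2 + 0) * \<kappa>\<^sup>2 / 4 + L\<^sup>2 * 0) * (2 / \<kappa>)) at_top"
    proof (intro tendsto_intros)
      show "((\<lambda>m. \<kappa> / m) \<longlongrightarrow> 0) at_top" by real_asymp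
      show "((\<lambda>m::real. 1 / m) \<longlongrightarrow> 0) at_top" by real_asymp
      have "((\<lambda>m::real. (1 + m) / m\<^sup>2) \<longlongrightarrow> 0) at_top" by real_asymp
      from tendsto_mult[OF tendsto_const[of "L\<^sup>2"] this]
      show "((\<lambda>m. (1 + m) * L\<^sup>2 / m\<^sup>2) \<longlongrightarrow> L\<^sup>2 * 0) at_top" by (simp add: mult.commute)
    qed simp
    then show ?thesis using \<kappa> by (simp add: power2_eq_square)
  qed
  then have "\<forall>\<^sub>F m in at_top. exp (\<kappa> / m) * ((2 + 1 / m) * \<kappa>\<^sup>2 / 4 + (1 + m) * L\<^sup>2 / m\<^sup>2) * (2 / \<kappa>) < \<kappa>'"
    using \<kappa>(3) by (rule order_tendstoD)
  then have "\<forall>\<^sub>F m in at_top. exp (\<kappa> / m) * ((2 + 1 / m) * \<kappa>\<^sup>2 / 4 + (1 + m) * L\<^sup>2 / m\<^sup>2) * (2 / \<kappa>) < \<kappa>' \<and> m > 0"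
    using eventually_gt_at_top[of 0] by eventually_elim auto
  then obtain m where m: "exp (\<kappa> / m) * ((2 + 1 / m) * \<kappa>\<^sup>2 / 4 + (1 + m) * L\<^sup>2 / m\<^sup>2) * (2 / \<kappa>) < \<kappa>'" "m > 0"
    using eventually_happens'[OF trivial_limit_at_top_linorder] by blast
  \<comment> \<open>A smooth majorant of |\<tau>| with r 0 = 1 / m. Subtracting 1 / m in
    \<open>A\<close> gives A 0 = 1, and the factor exp 1 in \<open>B\<close> gives B 0 = 1.\<close>
  define r where "r \<tau> = sqrt (\<tau>\<^sup>2 + (1/m)\<^sup>2)" for \<tau> :: real
  have r: "r \<tau> > 0" "\<bar>\<tau>\<bar> \<le> r \<tau>" for \<tau>
    using m by (auto simp: r_def add_nonneg_pos real_le_rsqrt)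
  define A where "A \<tau> = exp (- (\<kappa>/2) * (r \<tau> - 1/m))" for \<tau>
  define B where "B \<tau> = exp 1 * flat 0 (1 - (\<tau>/m)\<^sup>2)" for \<tau>
  define A' where "A' \<tau> = A \<tau> * (- (\<kappa>/2) * (\<tau> / r \<tau>))" for \<tau>
  define B' where "B' \<tau> = exp 1 * (flat 2 (1 - (\<tau>/m)\<^sup>2) * (- (2 * \<tau> / m\<^sup>2)))" for \<tau>
  define Z where "Z \<tau> = A \<tau> * B \<tau>" for \<tau>
  have dr: "(r has_real_derivative \<tau> / r \<tau>) (at \<tau>)" for \<tau>
  proof -
    have pos: "\<tau>\<^sup>2 + (1/m)\<^sup>2 > 0" using m by (intro add_nonneg_pos) auto
    have i: "((\<lambda>\<tau>. \<tau>\<^sup>2 + (1/m)\<^sup>2) has_real_derivative 2 * \<tau>) (at \<tau>)"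
      by (auto intro!: derivative_eq_intros)
    have "(r has_real_derivative inverse (r \<tau>) / 2 * (2 * \<tau>)) (at \<tau>)"
      unfolding r_def[abs_def] by (rule DERIV_chain2[OF DERIV_real_sqrt[OF pos] i])
    moreover have "inverse c / 2 * (2 * \<tau>) = \<tau> / c" for c :: real by (simp add: field_simps)
    ultimately show ?thesis by (simp only:)
  qed
  have dA: "(A has_real_derivative A' \<tau>) (at \<tau>)" for \<tau>
    unfolding A_def[abs_def] A'_def by (auto intro!: derivative_eq_intros dr simp: A_def)
  have dB: "(B has_real_derivative B' \<tau>) (at \<tau>)" for \<tau>
  proof -
    have "((\<lambda>\<tau>. 1 - (\<tau>/m)\<^sup>2) has_real_derivative - (2 * \<tau> / m\<^sup>2)) (at \<tau>)"
    proof -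
      have "((\<lambda>\<tau>. 1 - (1 / m\<^sup>2) * \<tau>\<^sup>2) has_real_derivative 0 - (1 / m\<^sup>2) * (2 * \<tau>)) (at \<tau>)"
        by (intro DERIV_diff DERIV_const DERIV_cmult) (auto intro!: derivative_eq_intros)
      then show ?thesis by (simp add: power_divide)
    qed
    from DERIV_chain2[OF flat_DERIV[of 0] this]
    have "((\<lambda>\<tau>. flat 0 (1 - (\<tau>/m)\<^sup>2)) has_real_derivative flat 2 (1 - (\<tau>/m)\<^sup>2) * (- (2 * \<tau> / m\<^sup>2))) (at \<tau>)" by (simp add: numeral_2_eq_2)
    then show ?thesis unfolding B_def[abs_def] B'_def by (rule DERIV_cmult)
  qed
  have dZ: "(Z has_real_derivative A' \<tau> * B \<tau> + B' \<tau> * A \<tau>) (at \<tau>)" for \<tau>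
    unfolding Z_def[abs_def] by (rule DERIV_mult[OF dA dB])
  have derivZ: "deriv Z = (\<lambda>\<tau>. A' \<tau> * B \<tau> + B' \<tau> * A \<tau>)" using dZ by (auto intro: DERIV_imp_deriv)
  have smZ: "Ck_on k Z UNIV" for k
  proof -
    have p: "Ck_on k (\<lambda>\<tau>. c * (\<tau> * \<tau>) + d) UNIV" for c d by (intro Ck_on_add Ck_on_mult Ck_on_id Ck_on_const) auto
    have "Ck_on k (\<lambda>\<tau>. sqrt (1 * (\<tau> * \<tau>) + (1/m)\<^sup>2)) UNIV"
      by (rule Ck_on_compose[OF open_UNIV open_greaterThan p Ck_on_sqrt[OF open_greaterThan order_refl]])
         (use m in \<open>auto intro!: add_nonneg_pos\<close>)
    then have 1: "Ck_on k r UNIV" unfolding r_def[abs_def] by (simp add: power2_eq_square)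
    have "Ck_on k (\<lambda>\<tau>. - (\<kappa>/2) * (r \<tau> + - (1/m))) UNIV"
      by (intro Ck_on_mult Ck_on_add Ck_on_const 1) auto
    then have "Ck_on k (\<lambda>\<tau>. exp (- (\<kappa>/2) * (r \<tau> + - (1/m)))) UNIV"
      by (rule Ck_on_compose[OF open_UNIV open_UNIV _ Ck_on_exp[OF open_UNIV]]) simp
    then have 2: "Ck_on k A UNIV" unfolding A_def[abs_def] by simp
    have "Ck_on k (\<lambda>\<tau>. flat 0 (- (1 / m\<^sup>2) * (\<tau> * \<tau>) + 1)) UNIV"
      by (rule Ck_on_compose[OF open_UNIV open_UNIV p Ck_on_flat]) simp
    then have "Ck_on k (\<lambda>\<tau>. exp 1 * flat 0 (- (1 / m\<^sup>2) * (\<tau> * \<tau>) + 1)) UNIV"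
      by (intro Ck_on_mult Ck_on_const) auto
    then have "Ck_on k B UNIV"
      unfolding B_def[abs_def] by (simp add: power2_eq_square)
    then show ?thesis unfolding Z_def[abs_def] by (rule Ck_on_mult[OF open_UNIV 2])
  qed
  have Bb: "0 \<le> B \<tau>" "B \<tau> \<le> 1" for \<tau>
  proof -
    show "0 \<le> B \<tau>" by (simp add: B_def flat_le_1)
    have "flat 0 s \<le> exp (-1)" if "s \<le> 1" for s
      using that by (auto simp: flat_def field_simps)
    from this[of "1 - (\<tau>/m)\<^sup>2"] have "B \<tau> \<le> exp 1 * exp (-1)"
      unfolding B_def by (intro mult_left_mono) auto
    then show "B \<tau> \<le> 1" by (simp flip: exp_add)
  qed
  have supp: "Z \<tau> = 0" "B' \<tau> = 0" if "\<bar>\<tau>\<bar> \<ge> m" for \<tau>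
  proof -
    have "1 \<le> \<bar>\<tau> / m\<bar>" using that m by simp
    then have "1\<^sup>2 \<le> \<bar>\<tau> / m\<bar>\<^sup>2" by (intro power_mono) auto
    then have "1 - (\<tau>/m)\<^sup>2 \<le> 0" unfolding power2_abs by simp
    then show "Z \<tau> = 0" "B' \<tau> = 0" unfolding Z_def B_def B'_def flat_def by auto
  qed
  have A0: "A \<tau> > 0" for \<tau> by (simp add: A_def)
  have A'b: "\<bar>A' \<tau>\<bar> \<le> \<kappa>/2 * A \<tau>" for \<tau>
  proof -
    have "\<bar>\<tau> / r \<tau>\<bar> \<le> 1" using r[of \<tau>] by (simp add: abs_divide)
    then have "A \<tau> * (\<kappa>/2 * \<bar>\<tau> / r \<tau>\<bar>) \<le> A \<tau> * (\<kappa>/2 * 1)"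
      using A0[of \<tau>] \<kappa> by (intro mult_left_mono) auto
    then show ?thesis using A0[of \<tau>] \<kappa> r(1)[of \<tau>] by (simp add: A'_def abs_mult mult.commute)
  qed
  have B'b: "\<bar>B' \<tau>\<bar> \<le> L / m" for \<tau>
  proof (cases "\<bar>\<tau>\<bar> \<ge> m")
    case False
    have "\<bar>B' \<tau>\<bar> = exp 1 * (flat 2 (1 - (\<tau>/m)\<^sup>2) * (2 * \<bar>\<tau>\<bar> / m\<^sup>2))"
      using flat_2_le by (simp add: B'_def abs_mult)
    also have "\<dots> \<le> exp 1 * (2 * (2 * m / m\<^sup>2))"
      using flat_2_le False m by (intro mult_left_mono mult_mono divide_right_mono) auto
    also have "\<dots> = L / m" using m by (simp add: L_def power2_eq_square)
    finally show ?thesis .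
  qed (use supp m in \<open>auto simp: L_def\<close>)
  define E where "E = (2 + 1 / m) * \<kappa>\<^sup>2 / 4 + (1 + m) * L\<^sup>2 / m\<^sup>2"
  have E: "E \<ge> 0" unfolding E_def using m by (intro add_nonneg_nonneg) auto
  have Qb: "(deriv Z \<tau>)\<^sup>2 + \<kappa>\<^sup>2 / 4 * (Z \<tau>)\<^sup>2 \<le> exp (\<kappa> / m) * E * exp (- (\<kappa> * \<bar>\<tau>\<bar>))" for \<tau>
  proof -
    have "(deriv Z \<tau>)\<^sup>2 \<le> (1 + 1/m) * (A' \<tau> * B \<tau>)\<^sup>2 + (1 + 1 / (1/m)) * (B' \<tau> * A \<tau>)\<^sup>2"
      unfolding derivZ using m by (intro square_sum_young) simp
    also have "\<dots> \<le> (1 + 1/m) * (\<kappa>/2 * A \<tau>)\<^sup>2 + (1 + 1 / (1/m)) * (L / m * A \<tau>)\<^sup>2"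
    proof (intro add_mono mult_left_mono)
      have "\<bar>A' \<tau> * B \<tau>\<bar> \<le> (\<kappa>/2 * A \<tau>) * 1"
        unfolding abs_mult using A'b Bb A0[of \<tau>] \<kappa> by (intro mult_mono) auto
      then show "(A' \<tau> * B \<tau>)\<^sup>2 \<le> (\<kappa>/2 * A \<tau>)\<^sup>2" 
        using power_mono[of "\<bar>A' \<tau> * B \<tau>\<bar>" "\<kappa>/2 * A \<tau>" 2] by (simp only: power2_abs mult_1_right abs_ge_zero)
      have "\<bar>B' \<tau> * A \<tau>\<bar> \<le> L / m * A \<tau>"
        unfolding abs_mult using B'b A0[of \<tau>] by (intro mult_mono) (auto intro: order_trans[OF abs_ge_zero])
      then show "(B' \<tau> * A \<tau>)\<^sup>2 \<le> (L / m * A \<tau>)\<^sup>2" 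
        using power_mono[of "\<bar>B' \<tau> * A \<tau>\<bar>" "L / m * A \<tau>" 2] by (simp only: power2_abs abs_ge_zero)
    qed (use m in auto)
    finally have 1: "(deriv Z \<tau>)\<^sup>2 \<le> ((1 + 1/m) * (\<kappa>\<^sup>2/4) + (1 + m) * L\<^sup>2 / m\<^sup>2) * (A \<tau>)\<^sup>2"
      by (simp add: power_mult_distrib power_divide algebra_simps)
    have A2: "(A \<tau>)\<^sup>2 \<le> exp (\<kappa> / m) * exp (- (\<kappa> * \<bar>\<tau>\<bar>))"
    proof -
      have "(A \<tau>)\<^sup>2 = exp (\<kappa> / m - \<kappa> * r \<tau>)"
        by (simp add: A_def power2_eq_square algebra_simps flip: exp_add)
      also have "\<dots> \<le> exp (\<kappa> / m - \<kappa> * \<bar>\<tau>\<bar>)" using r(2)[of \<tau>] \<kappa> by simp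
      finally show ?thesis by (simp add: exp_diff exp_minus field_simps)
    qed
    have "(Z \<tau>)\<^sup>2 \<le> (A \<tau>)\<^sup>2"
    proof -
      have "Z \<tau> \<le> A \<tau> * 1" unfolding Z_def using A0[of \<tau>] Bb by (intro mult_left_mono) auto
      then show ?thesis using A0[of \<tau>] Bb by (intro power_mono) (auto simp: Z_def)
    qed
    then have "\<kappa>\<^sup>2 / 4 * (Z \<tau>)\<^sup>2 \<le> \<kappa>\<^sup>2 / 4 * (A \<tau>)\<^sup>2" by (intro mult_left_mono) auto
    moreover have "E = ((1 + 1/m) * (\<kappa>\<^sup>2/4) + (1 + m) * L\<^sup>2 / m\<^sup>2) + \<kappa>\<^sup>2 / 4"
      by (simp add: E_def field_simps)
    ultimately have "(deriv Z \<tau>)\<^sup>2 + \<kappa>\<^sup>2 / 4 * (Z \<tau>)\<^sup>2 \<le> E * (A \<tau>)\<^sup>2"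
      using 1 by (simp only: distrib_right add_mono)
    also have "\<dots> \<le> E * (exp (\<kappa> / m) * exp (- (\<kappa> * \<bar>\<tau>\<bar>)))"
      by (rule mult_left_mono[OF A2 E])
    finally show ?thesis by (simp only: mult_ac)
  qed
  have cZ: "continuous_on S Z" "continuous_on S (deriv Z)" for S
    using Ck_on_continuous_on[OF smZ[of 0]] smZ[of "Suc 0"] Ck_on_continuous_on[of 0 "deriv Z" UNIV] by (auto intro: continuous_on_subset)
  \<comment> \<open>The cross term Z Z' is the derivative of Z^2 / 2 and drops out; the coefficients
    of Z^2 add up to \<nu> + 1 / 4 = \<kappa>^2 / 4.\<close>
  have "(\<integral>\<^sup>+\<tau>. indicator {-m..m} \<tau> * ennreal ((deriv Z \<tau> + Z \<tau> / 2)\<^sup>2 + \<nu> * (Z \<tau>)\<^sup>2) \<partial>lborel)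
     = (\<integral>\<^sup>+\<tau>. indicator {-m..m} \<tau> * ennreal ((deriv Z \<tau>)\<^sup>2 + \<kappa>\<^sup>2 / 4 * (Z \<tau>)\<^sup>2) \<partial>lborel)"
  proof (rule nn_integral_Icc_eq_up_to_exact[where R = "\<lambda>\<tau>. Z \<tau> * deriv Z \<tau>" and G = "\<lambda>\<tau>. (Z \<tau>)\<^sup>2 / 2"])
    show "(deriv Z t + Z t / 2)\<^sup>2 + \<nu> * (Z t)\<^sup>2 = (deriv Z t)\<^sup>2 + \<kappa>\<^sup>2 / 4 * (Z t)\<^sup>2 + Z t * deriv Z t" for t
      unfolding \<kappa>(2) by (simp add: power2_eq_square field_simps)
    show "((\<lambda>\<tau>. (Z \<tau>)\<^sup>2 / 2) has_real_derivative Z t * deriv Z t) (at t)" for t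
      using dZ[of t] unfolding derivZ by (auto intro!: derivative_eq_intros)
  qed (use m \<nu> supp in \<open>auto intro!: continuous_intros cZ\<close>)
  also have "\<dots> \<le> (\<integral>\<^sup>+\<tau>. ennreal (exp (\<kappa> / m) * E) * ennreal (exp (- (\<kappa> * \<bar>\<tau>\<bar>))) \<partial>lborel)"
  proof (rule nn_integral_mono)
    fix \<tau>
    show "indicator {-m..m} \<tau> * ennreal ((deriv Z \<tau>)\<^sup>2 + \<kappa>\<^sup>2 / 4 * (Z \<tau>)\<^sup>2) \<le> ennreal (exp (\<kappa> / m) * E) * ennreal (exp (- (\<kappa> * \<bar>\<tau>\<bar>)))"
      using ennreal_leI[OF Qb[of \<tau>]] E by (auto simp: ennreal_mult split: split_indicator)
  qed
  also have "\<dots> = ennreal (exp (\<kappa> / m) * E) * ennreal (2 / \<kappa>)"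
    by (subst nn_integral_cmult) (auto simp: nn_integral_exp_abs \<kappa>)
  also have "\<dots> = ennreal (exp (\<kappa> / m) * E * (2 / \<kappa>))"
    using E \<kappa> by (intro ennreal_mult[symmetric]) auto
  also have "\<dots> \<le> ennreal \<kappa>'" using m(1) unfolding E_def by (intro ennreal_leI) simp
  finally have fin: "(\<integral>\<^sup>+\<tau>. indicator {-m..m} \<tau> * ennreal ((deriv Z \<tau> + Z \<tau> / 2)\<^sup>2 + \<nu> * (Z \<tau>)\<^sup>2) \<partial>lborel) \<le> ennreal \<kappa>'" .
  have Z0: "Z 0 = 1" using m by (simp add: Z_def A_def B_def r_def flat_def flip: exp_add)
  show thesis by (rule that[OF smZ m(2) supp(1) Z0 fin])
qed

text \<open>In the variable \<open>\<tau> = ln (t / T)\<close>, with \<open>t = - ln \<bar>x - x\<^sub>0\<bar>\<close>, the energy of \<open>sqrt t * Z \<tau>\<close> does not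
  depend on \<open>T\<close>. The junk value \<open>ln 0 = 0\<close> makes \<open>bump\<close> vanish at \<open>x\<^sub>0\<close>.\<close>

definition profile :: "(real \<Rightarrow> real) \<Rightarrow> real \<Rightarrow> real \<Rightarrow> real" where
  "profile Z T t = (if t > 0 then sqrt t * Z (ln (t / T)) else 0)"

definition bump :: "(real \<Rightarrow> real) \<Rightarrow> real \<Rightarrow> real \<Rightarrow> real^2 \<Rightarrow> real^2 \<Rightarrow> real" where
  "bump Z T c x\<^sub>0 x = c * profile Z T (- ln (norm (x - x\<^sub>0)))"

lemma profile_eq_0:
  assumes "T > 0" "\<And>\<tau>. \<bar>\<tau>\<bar> \<ge> m \<Longrightarrow> Z \<tau> = 0" and t: "t \<le> T * exp (-m) \<or> t \<ge> T * exp m"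
  shows "profile Z T t = 0"
proof (cases "t > 0")
  case True
  have "\<bar>ln (t / T)\<bar> \<ge> m"
    using t
  proof
    assume "t \<le> T * exp (-m)"
    then have "t / T \<le> exp (-m)" using assms(1) by (simp add: field_simps)
    then have "ln (t / T) \<le> -m" using True assms(1) by (metis ln_exp ln_le_cancel_iff exp_gt_zero divide_pos_pos)
    then show ?thesis by simp
  next
    assume "t \<ge> T * exp m"
    then have "exp m \<le> t / T" using assms(1) by (simp add: field_simps)
    then have "m \<le> ln (t / T)" using True assms(1) by (metis ln_exp ln_le_cancel_iff exp_gt_zero divide_pos_pos)
    then show ?thesis by simp
  qed
  then show ?thesis using assms(2) by (simp add: profile_def)
qed (simp add: profile_def)

section \<open>Smoothness, gradient and support of the bumps\<close>

lemma profile_DERIV: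
  assumes T: "T > 0" and Z: "\<And>\<tau>. (Z has_real_derivative deriv Z \<tau>) (at \<tau>)" and t: "t > 0"
  shows "(profile Z T has_real_derivative (deriv Z (ln (t / T)) + Z (ln (t / T)) / 2) / sqrt t) (at t)"
proof -
  have 1: "((\<lambda>t. ln (t / T)) has_real_derivative 1 / t) (at t)"
    using t T by (auto intro!: derivative_eq_intros)
  have "((\<lambda>t. sqrt t * Z (ln (t / T))) has_real_derivative
     inverse (sqrt t) / 2 * Z (ln (t / T)) + deriv Z (ln (t / T)) * (1 / t) * sqrt t) (at t)"
    by (rule DERIV_mult[OF DERIV_real_sqrt[OF t] DERIV_chain2[OF Z 1]])
  moreover have "inverse (sqrt t) / 2 * z + d * (1 / t) * sqrt t = (d + z / 2) / sqrt t" for z d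
  proof -
    have "1 / t * sqrt t = 1 / sqrt t"
      using real_div_sqrt[of t] t by (simp add: field_simps)
    then have 1: "d * (1 / t) * sqrt t = d * (1 / sqrt t)" by (simp only: mult.assoc)
    have "sqrt t > 0" using t by simp
    then show ?thesis unfolding 1 by (simp add: field_simps)
  qed
  ultimately have "((\<lambda>t. sqrt t * Z (ln (t / T))) has_real_derivative (deriv Z (ln (t / T)) + Z (ln (t / T)) / 2) / sqrt t) (at t)"
    by (simp only:)
  then show ?thesis
    by (rule has_field_derivative_transform_within_open[of _ _ _ "{0<..}"]) (use t in \<open>auto simp: profile_def\<close>)
qed

lemma bump_eq_0:
  assumes "T > 0" "\<And>\<tau>. \<bar>\<tau>\<bar> \<ge> m \<Longrightarrow> Z \<tau> = 0"
    and x: "\<not> (exp (- (T * exp m)) \<le> norm (x - x\<^sub>0) \<and> norm (x - x\<^sub>0) \<le> exp (- (T * exp (-m))))"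
  shows "bump Z T c x\<^sub>0 x = 0"
proof -
  define r where "r = norm (x - x\<^sub>0)"
  have "profile Z T (- ln r) = 0"
  proof (cases "r = 0")
    case False
    then have r: "r > 0" by (simp add: r_def)
    have "r < exp (- (T * exp m)) \<or> exp (- (T * exp (-m))) < r" using x by (auto simp: r_def)
    then have "ln r < - (T * exp m) \<or> - (T * exp (-m)) < ln r"
      using r by (metis ln_exp ln_less_cancel_iff exp_gt_zero)
    then show ?thesis using profile_eq_0[of T m Z "- ln r", OF assms(1,2)] by linarith
  qed (simp add: profile_def)
  then show ?thesis by (simp add: bump_def r_def)
qed

text \<open>The bump is a function \<open>F\<close> of the squared distance to
  \<open>x\<^sub>0\<close>, which unlike the distance is smooth at the centre. \<open>F\<close> is
  smooth on each of three open sets that cover the line: it vanishes on the outer two and is a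
  composition of smooth functions on (0, 1).\<close>

lemma bump_Ck:
  assumes T: "T > 0" and Z: "\<And>k. Ck_on k Z UNIV" and m: "\<And>\<tau>. \<bar>\<tau>\<bar> \<ge> m \<Longrightarrow> Z \<tau> = 0"
  shows "Ck k (bump Z T c x\<^sub>0)"
proof -
  define F where "F \<sigma> = (if \<sigma> > 0 then c * profile Z T (- (1/2) * ln \<sigma>) else 0)" for \<sigma>
  have "Ck_on k F ({..<exp (- 2 * (T * exp m))} \<union> {0<..<1} \<union> {exp (- 2 * (T * exp (-m)))<..})"
  proof (intro Ck_on_Un open_Un)
    have "F \<sigma> = 0" if "\<sigma> < exp (- 2 * (T * exp m))" for \<sigma>
    proof (cases "\<sigma> > 0")
      case True
      then have "ln \<sigma> < - 2 * (T * exp m)" using that by (metis ln_exp ln_less_cancel_iff exp_gt_zero)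
      then show ?thesis using profile_eq_0[of T m Z "- (1/2) * ln \<sigma>", OF T m] by (simp add: F_def)
    qed (simp add: F_def)
    then show "Ck_on k F {..<exp (- 2 * (T * exp m))}"
      by (intro Ck_on_cong[OF _ _ Ck_on_const[of _ k 0]]) auto
    have "F \<sigma> = 0" if "\<sigma> > exp (- 2 * (T * exp (-m)))" for \<sigma>
    proof -
      have "\<sigma> > 0" using that by (rule less_trans[OF exp_gt_zero])
      then have "ln \<sigma> > - 2 * (T * exp (-m))" using that by (metis ln_exp ln_less_cancel_iff exp_gt_zero)
      then show ?thesis using profile_eq_0[of T m Z "- (1/2) * ln \<sigma>", OF T m] by (simp add: F_def)
    qed
    then show "Ck_on k F {exp (- 2 * (T * exp (-m)))<..}"
      by (intro Ck_on_cong[OF _ _ Ck_on_const[of _ k 0]]) auto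
    have o: "open {0<..<1::real}" "open {0::real<..}" by auto
    have t: "Ck_on k (\<lambda>\<sigma>. - (1/2) * ln \<sigma>) {0<..<1}"
      by (intro Ck_on_mult Ck_on_const Ck_on_ln o) auto
    have tpos: "- (1/2) * ln \<sigma> \<in> {0<..}" if "\<sigma> \<in> {0<..<1}" for \<sigma> :: real
      using that by simp
    have "Ck_on k (\<lambda>t. t * (1 / T)) {0<..}" by (intro Ck_on_mult Ck_on_id Ck_on_const o)
    then have "Ck_on k (\<lambda>t. ln (t * (1 / T))) {0<..}"
      by (rule Ck_on_compose[OF o(2) o(2) _ Ck_on_ln[OF o(2) order_refl]]) (use T in auto)
    then have "Ck_on k (\<lambda>t. Z (ln (t * (1 / T)))) {0<..}"
      by (rule Ck_on_compose[OF o(2) open_UNIV _ Z]) simp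
    then have "Ck_on k (\<lambda>t. c * (sqrt t * Z (ln (t * (1 / T))))) {0<..}"
      using Ck_on_sqrt[OF o(2) order_refl] by (intro Ck_on_mult[OF o(2)] Ck_on_const[OF o(2)])
    then have "Ck_on k (\<lambda>\<sigma>. c * (sqrt (- (1/2) * ln \<sigma>) * Z (ln (- (1/2) * ln \<sigma> * (1 / T))))) {0<..<1}"
      by (rule Ck_on_compose[OF o t _ tpos])
    then show "Ck_on k F {0<..<1}"
    proof (rule Ck_on_cong[OF o(1), rotated])
      fix \<sigma> :: real assume "\<sigma> \<in> {0<..<1}"
      then show "c * (sqrt (- (1/2) * ln \<sigma>) * Z (ln (- (1/2) * ln \<sigma> * (1 / T)))) = F \<sigma>"
        using tpos[of \<sigma>] by (auto simp: F_def profile_def)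
    qed
  qed auto
  also have "{..<exp (- 2 * (T * exp m))} \<union> {0<..<1} \<union> {exp (- 2 * (T * exp (-m)))<..} = UNIV"
  proof -
    have "exp (- 2 * (T * exp (-m))) < 1" using T by simp
    moreover have "exp (- 2 * (T * exp m)) > 0" by (rule exp_gt_zero)
    moreover have "{..<l} \<union> {0<..<1} \<union> {h<..} = (UNIV :: real set)" if "h < 1" "l > 0" for l h :: real
    proof -
      have d: "x < l \<or> (0 < x \<and> x < 1) \<or> h < x" for x using that by linarith
      have "x \<in> {..<l} \<union> {0<..<1} \<union> {h<..}" for x using d[of x] by simp
      then show ?thesis by blast
    qed
    ultimately show ?thesis by blast
  qed
  finally have "Ck k (\<lambda>x. F ((norm (x - x\<^sub>0))\<^sup>2))"
    by (intro Ck_compose[where S = UNIV and F = F and P = "\<lambda>x. (norm (x - x\<^sub>0))\<^sup>2"] Ck_norm_square) auto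
  also have "(\<lambda>x. F ((norm (x - x\<^sub>0))\<^sup>2)) = bump Z T c x\<^sub>0"
  proof
    fix x
    show "F ((norm (x - x\<^sub>0))\<^sup>2) = bump Z T c x\<^sub>0 x"
    proof (cases "x = x\<^sub>0")
      case False
      then have "ln ((norm (x - x\<^sub>0))\<^sup>2) = 2 * ln (norm (x - x\<^sub>0))" by (simp add: ln_realpow)
      then show ?thesis using False by (simp add: F_def bump_def)
    qed (simp add: F_def bump_def profile_def)
  qed
  finally show ?thesis .
qed

text \<open>The bump depends on the distance r alone, and the derivative of - ln r supplies the
  factor 1 / r. It is this factor that cancels the area density in logarithmic coordinates.\<close>

lemma bump_gradient:
  assumes T: "T > 0" and Z: "\<And>\<tau>. (Z has_real_derivative deriv Z \<tau>) (at \<tau>)"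
    and x: "x \<noteq> x\<^sub>0" "norm (x - x\<^sub>0) < 1" and t: "t = - ln (norm (x - x\<^sub>0))"
  shows "(norm (gradient (bump Z T c x\<^sub>0) x))\<^sup>2 = c\<^sup>2 * ((deriv Z (ln (t / T)) + Z (ln (t / T)) / 2)\<^sup>2 / t) / (norm (x - x\<^sub>0))\<^sup>2"
proof -
  define r where "r = norm (x - x\<^sub>0)"
  have r: "r > 0" "r < 1" using x by (auto simp: r_def)
  have tpos: "t > 0" unfolding t using r by (simp add: r_def[symmetric])
  define U' where "U' = (deriv Z (ln (t / T)) + Z (ln (t / T)) / 2) / sqrt t"
  have "(norm has_derivative (\<lambda>h. h \<bullet> sgn (x - x\<^sub>0))) (at (x - x\<^sub>0))"
    using has_derivative_norm[of "x - x\<^sub>0"] x by simp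
  moreover have "((\<lambda>x. x - x\<^sub>0) has_derivative (\<lambda>h. h)) (at x)"
    by (auto intro!: derivative_eq_intros)
  ultimately have g: "GDERIV (\<lambda>x. norm (x - x\<^sub>0)) x :> sgn (x - x\<^sub>0)"
    unfolding gderiv_def by (rule has_derivative_compose[rotated])
  have "((\<lambda>r. - ln r) has_real_derivative - (1 / r)) (at r)"
    using r by (auto intro!: derivative_eq_intros)
  then have "((\<lambda>r. profile Z T (- ln r)) has_real_derivative U' * (- (1 / r))) (at r)"
    using profile_DERIV[OF T Z tpos] unfolding U'_def t r_def[symmetric] by (intro DERIV_chain2)
  then have "((\<lambda>r. c * profile Z T (- ln r)) has_real_derivative c * (U' * (- (1 / r)))) (at r)"
    by (rule DERIV_cmult)
  then have "GDERIV (bump Z T c x\<^sub>0) x :> (c * (U' * (- (1 / r)))) *\<^sub>R sgn (x - x\<^sub>0)"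
    unfolding bump_def[abs_def] r_def by (rule GDERIV_DERIV_compose[OF g])
  then have "gradient (bump Z T c x\<^sub>0) x = (c * (U' * (- (1 / r)))) *\<^sub>R sgn (x - x\<^sub>0)"
    by (rule gradient_eq)
  moreover have "norm (sgn (x - x\<^sub>0)) = 1" using x by (simp add: norm_sgn)
  ultimately have "(norm (gradient (bump Z T c x\<^sub>0) x))\<^sup>2 = (c * (U' * (- (1 / r))))\<^sup>2" by (simp add: power_divide)
  also have "\<dots> = c\<^sup>2 * U'\<^sup>2 / r\<^sup>2" by (simp add: power_mult_distrib power_divide)
  also have "U'\<^sup>2 = (deriv Z (ln (t / T)) + Z (ln (t / T)) / 2)\<^sup>2 / t"
    using tpos by (simp add: U'_def power_divide)
  finally show ?thesis by (simp add: r_def)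
qed

section \<open>Energy and exponential integral of the bumps\<close>

lemma nn_integral_log_substitution:
  fixes q :: "real \<Rightarrow> real"
  assumes T: "T > 0" and m: "m > 0" and q: "continuous_on UNIV q" "\<And>x. q x \<ge> 0"
  shows "(\<integral>\<^sup>+t. indicator {T * exp (-m)..T * exp m} t * ennreal (q (ln (t / T)) / t) \<partial>lborel)
    = (\<integral>\<^sup>+\<tau>. indicator {-m..m} \<tau> * ennreal (q \<tau>) \<partial>lborel)"
proof -
  define a b where "a = T * exp (-m)" and "b = T * exp m"
  have ab: "0 < a" "a \<le> b" using T m by (auto simp: a_def b_def)
  have g: "ln (a / T) = -m" "ln (b / T) = m" using T by (auto simp: a_def b_def)
  have [measurable]: "q \<in> borel_measurable borel" using q(1) by (rule borel_measurable_continuous_onI)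
  have "(\<integral>\<^sup>+x. ennreal (q x * indicator {ln (a / T)..ln (b / T)} x) \<partial>lborel)
    = (\<integral>\<^sup>+x. ennreal (q (ln (x / T)) * (1 / x) * indicator {a..b} x) \<partial>lborel)"
  proof (rule nn_integral_substitution)
    show "set_borel_measurable borel {ln (a / T)..ln (b / T)} q"
      unfolding set_borel_measurable_def by measurable
    show "((\<lambda>x. ln (x / T)) has_real_derivative 1 / x) (at x)" if "x \<in> {a..b}" for x
      using that ab T by (auto intro!: derivative_eq_intros)
    show "continuous_on {a..b} (\<lambda>x. 1 / x)" using ab by (intro continuous_intros) auto
  qed (use ab in auto)
  moreover have "ennreal (q x * indicator S x) = indicator S x * ennreal (q x)" for x S
    by (auto split: split_indicator)
  moreover have "ennreal (q (ln (x / T)) * (1 / x) * indicator {a..b} x) = indicator {a..b} x * ennreal (q (ln (x / T)) / x)" for x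
    by (auto split: split_indicator)
  ultimately show ?thesis unfolding g a_def[symmetric] b_def[symmetric] by simp
qed

lemma test_energy_eq:
  assumes "\<phi> \<in> test_functions U" "A \<subseteq> unit_disc"
  shows "energy V \<mu> A \<phi> = (\<integral>\<^sup>+x. indicator A x * ennreal ((norm (gradient \<phi> x))\<^sup>2 + \<mu> * potential V x * (\<phi> x)\<^sup>2) \<partial>lborel)"
  by (rule energy_eq[OF has_weak_gradient_smooth[OF test_functionsD(1)[OF assms(1)]] assms(2)]) auto

lemma test_functions_in_H_space:
  assumes "\<phi> \<in> test_functions (unit_disc - {0})"
  shows "\<phi> \<in> H_space V \<mu>"
proof -
  have g: "has_weak_gradient \<phi> (gradient \<phi>) unit_disc"
    using test_functionsD(1)[OF assms] by (rule has_weak_gradient_smooth)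
  have "energy V \<mu> unit_disc (\<lambda>x. \<phi> x - \<phi> x)
    = (\<integral>\<^sup>+x. indicator unit_disc x * ennreal ((norm (gradient \<phi> x - gradient \<phi> x))\<^sup>2 + \<mu> * potential V x * (\<phi> x - \<phi> x)\<^sup>2) \<partial>lborel)"
    by (rule energy_eq[OF has_weak_gradient_diff[OF g g]]) auto
  then have "(\<lambda>n::nat. energy V \<mu> unit_disc (\<lambda>x. \<phi> x - \<phi> x)) \<longlonglongrightarrow> 0" by simp
  then show ?thesis unfolding H_space_def using g assms by (auto intro!: exI[of _ "\<lambda>_. \<phi>"])
qed

lemma bump_test_functions:
  assumes T: "T > 0" and Z: "\<And>k. Ck_on k Z UNIV" and m: "\<And>\<tau>. \<bar>\<tau>\<bar> \<ge> m \<Longrightarrow> Z \<tau> = 0"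
    and near: "\<And>x. 0 < norm (x - x\<^sub>0) \<Longrightarrow> norm (x - x\<^sub>0) \<le> exp (- (T * exp (-m))) \<Longrightarrow> x \<in> U"
  shows "bump Z T c x\<^sub>0 \<in> test_functions U"
proof (rule test_functionsI[OF bump_Ck[OF T Z m]])
  let ?K = "{x. exp (- (T * exp m)) \<le> norm (x - x\<^sub>0) \<and> norm (x - x\<^sub>0) \<le> exp (- (T * exp (-m)))}"
  have "closed ?K"
    by (intro closed_Collect_conj closed_Collect_le continuous_intros)
  moreover have "?K \<subseteq> cball x\<^sub>0 (exp (- (T * exp (-m))))"
    by (auto simp: dist_norm norm_minus_commute)
  ultimately show "compact ?K"
    using bounded_subset[OF bounded_cball] by (auto simp: compact_eq_bounded_closed)
  show "?K \<subseteq> U"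
  proof
    fix x assume x: "x \<in> ?K"
    have "0 < exp (- (T * exp m))" by simp
    also have "\<dots> \<le> norm (x - x\<^sub>0)" using x by simp
    finally show "x \<in> U" using near[of x] x by simp
  qed
  show "bump Z T c x\<^sub>0 x = 0" if "x \<notin> ?K" for x
    using that by (intro bump_eq_0[OF T m]) auto
qed

lemma bump_support:
  assumes T: "T > 0" and Z: "\<And>k. Ck_on k Z UNIV" and m: "\<And>\<tau>. \<bar>\<tau>\<bar> \<ge> m \<Longrightarrow> Z \<tau> = 0"
    and x: "\<not> (exp (- (T * exp m)) \<le> norm (x - x\<^sub>0) \<and> norm (x - x\<^sub>0) \<le> exp (- (T * exp (-m))))"
  shows "bump Z T c x\<^sub>0 x = 0" "gradient (bump Z T c x\<^sub>0) x = 0"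
proof -
  show "bump Z T c x\<^sub>0 x = 0" by (rule bump_eq_0[OF T m x])
  let ?K = "{x. exp (- (T * exp m)) \<le> norm (x - x\<^sub>0) \<and> norm (x - x\<^sub>0) \<le> exp (- (T * exp (-m)))}"
  show "gradient (bump Z T c x\<^sub>0) x = 0"
  proof (rule GDERIV_zero_outside[where K = ?K and F = "bump Z T c x\<^sub>0" and G = "gradient (bump Z T c x\<^sub>0)"])
    show "GDERIV (bump Z T c x\<^sub>0) y :> gradient (bump Z T c x\<^sub>0) y" for y
      by (rule Ck_gradient[OF bump_Ck[OF T Z m]])
    show "closed ?K"
      by (intro closed_Collect_conj closed_Collect_le continuous_intros)
    show "bump Z T c x\<^sub>0 y = 0" if "y \<notin> ?K" for y
      using that by (intro bump_eq_0[OF T m]) auto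
  qed (use x in auto)
qed

text \<open>\<open>near\<close> replaces the potential by the Hardy weight centred at
  \<open>x\<^sub>0\<close>. The resulting bound is 2 pi c^2 times the one-dimensional energy of
  \<open>Z\<close>, whatever \<open>T\<close> is, because dt / t is invariant under scaling;
  \<open>c\<close> normalises it to 1.\<close>

lemma bump_energy_le_1:
  assumes T: "T > 0" and Z: "\<And>k. Ck_on k Z UNIV" and m: "m > 0" "\<And>\<tau>. \<bar>\<tau>\<bar> \<ge> m \<Longrightarrow> Z \<tau> = 0"
    and \<nu>: "\<nu> \<ge> 0" and \<mu>: "\<mu> \<ge> 0" and \<kappa>': "\<kappa>' > 0"
    and int: "(\<integral>\<^sup>+\<tau>. indicator {-m..m} \<tau> * ennreal ((deriv Z \<tau> + Z \<tau> / 2)\<^sup>2 + \<nu> * (Z \<tau>)\<^sup>2) \<partial>lborel) \<le> ennreal \<kappa>'"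
    and c: "c\<^sup>2 = 1 / (2 * pi * \<kappa>')"
    and near: "\<And>x. 0 < norm (x - x\<^sub>0) \<Longrightarrow> norm (x - x\<^sub>0) \<le> exp (- (T * exp (-m))) \<Longrightarrow>
      x \<in> unit_disc - {0} \<and> \<mu> * V (norm x) \<le> \<nu> * hardy (norm (x - x\<^sub>0))"
  shows "energy V \<mu> unit_disc (bump Z T c x\<^sub>0) \<le> 1"
proof -
  define u where "u = bump Z T c x\<^sub>0"
  define lo hi where "lo = exp (- (T * exp m))" and "hi = exp (- (T * exp (-m)))"
  have hi: "lo > 0" "hi < 1" using T by (auto simp: lo_def hi_def)
  define q where "q \<tau> = (deriv Z \<tau> + Z \<tau> / 2)\<^sup>2 + \<nu> * (Z \<tau>)\<^sup>2" for \<tau>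
  have dZ: "(Z has_real_derivative deriv Z \<tau>) (at \<tau>)" for \<tau>
    using Ck_on_Suc_DERIV[OF Z[of "Suc 0"]] by simp
  have cZ: "continuous_on UNIV Z" "continuous_on UNIV (deriv Z)"
    using Ck_on_continuous_on[OF Z[of 0]] Ck_on_continuous_on[of 0 "deriv Z" UNIV] Z[of "Suc 0"] by auto
  have q: "continuous_on UNIV q" "q \<tau> \<ge> 0" for \<tau>
    using \<nu> by (auto simp: q_def intro!: continuous_intros cZ)
  have [measurable]: "q \<in> borel_measurable borel" using q(1) by (rule borel_measurable_continuous_onI)
  define hh where "hh r = indicator {lo..hi} r * ennreal (c\<^sup>2 * (q (ln (- ln r / T)) / - ln r) / r\<^sup>2)" for r
  have [measurable]: "hh \<in> borel_measurable borel" unfolding hh_def by measurable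
  have u_test: "u \<in> test_functions (unit_disc - {0})"
    unfolding u_def using near by (intro bump_test_functions T Z m) auto
  have "energy V \<mu> unit_disc u = (\<integral>\<^sup>+x. indicator unit_disc x * ennreal ((norm (gradient u x))\<^sup>2 + \<mu> * potential V x * (u x)\<^sup>2) \<partial>lborel)"
    using u_test by (rule test_energy_eq) simp
  also have "\<dots> \<le> (\<integral>\<^sup>+x. hh (norm (x - x\<^sub>0)) \<partial>lborel)"
  proof (rule nn_integral_mono)
    fix x
    show "indicator unit_disc x * ennreal ((norm (gradient u x))\<^sup>2 + \<mu> * potential V x * (u x)\<^sup>2) \<le> hh (norm (x - x\<^sub>0))"
    proof (cases "lo \<le> norm (x - x\<^sub>0) \<and> norm (x - x\<^sub>0) \<le> hi")
      case False
      then have "u x = 0" "gradient u x = 0"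
        unfolding u_def lo_def hi_def by (intro bump_support[OF T Z m(2)]; simp)+
      then show ?thesis by simp
    next
      case True
      define r t where "r = norm (x - x\<^sub>0)" and "t = - ln r"
      have r: "0 < r" "r < 1" using True hi by (auto simp: r_def)
      have t: "t > 0" using r by (simp add: t_def)
      have x: "x \<noteq> x\<^sub>0" using r by (auto simp: r_def)
      have nx: "x \<in> unit_disc - {0}" "\<mu> * V (norm x) \<le> \<nu> * hardy r"
        using near[of x] True r by (auto simp: r_def hi_def)
      have g: "(norm (gradient u x))\<^sup>2 = c\<^sup>2 * ((deriv Z (ln (t / T)) + Z (ln (t / T)) / 2)\<^sup>2 / t) / r\<^sup>2"
        unfolding u_def r_def by (rule bump_gradient[OF T dZ x]) (use r in \<open>auto simp: t_def r_def\<close>)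
      have ux: "(u x)\<^sup>2 = c\<^sup>2 * (t * (Z (ln (t / T)))\<^sup>2)"
        using t by (simp add: u_def bump_def profile_def r_def[symmetric] t_def[symmetric] power_mult_distrib)
      have "\<mu> * potential V x * (u x)\<^sup>2 \<le> \<nu> * hardy r * (u x)\<^sup>2"
        using nx by (intro mult_right_mono) (auto simp: potential_def)
      also have "\<dots> = c\<^sup>2 * (\<nu> * (Z (ln (t / T)))\<^sup>2 / t) / r\<^sup>2"
        unfolding ux hardy_def t_def[symmetric] using t r by (simp add: field_simps power2_eq_square)
      finally have "(norm (gradient u x))\<^sup>2 + \<mu> * potential V x * (u x)\<^sup>2 \<le> c\<^sup>2 * (q (ln (t / T)) / t) / r\<^sup>2"
        unfolding g q_def by (simp add: add_divide_distrib distrib_left)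
      then show ?thesis
        using nx True unfolding hh_def r_def[symmetric] t_def[symmetric]
        by (simp add: ennreal_leI)
    qed
  qed
  also have "\<dots> = (\<integral>\<^sup>+x. hh (norm (x\<^sub>0 + x - x\<^sub>0)) \<partial>lborel)"
    by (rule nn_integral_lborel_translate[symmetric]) measurable
  also have "\<dots> = (\<integral>\<^sup>+x. hh (norm (x::real^2)) \<partial>lborel)" by simp
  also have "\<dots> = ennreal (2 * pi) * (\<integral>\<^sup>+t. hh (exp (-t)) * ennreal (exp (- (2 * t))) \<partial>lborel)"
    by (rule nn_integral_radial) measurable
  also have "(\<integral>\<^sup>+t. hh (exp (-t)) * ennreal (exp (- (2 * t))) \<partial>lborel)
    = (\<integral>\<^sup>+t. ennreal (c\<^sup>2) * (indicator {T * exp (-m)..T * exp m} t * ennreal (q (ln (t / T)) / t)) \<partial>lborel)"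
  proof (rule nn_integral_cong)
    fix t :: real
    have "exp (-t) \<in> {lo..hi} \<longleftrightarrow> t \<in> {T * exp (-m)..T * exp m}"
      by (auto simp: lo_def hi_def)
    moreover have "c\<^sup>2 * (q (ln (t / T)) / t) / (exp (-t))\<^sup>2 * exp (- (2 * t)) = c\<^sup>2 * (q (ln (t / T)) / t)"
    proof -
      have "exp (- (2 * t)) = (exp (-t))\<^sup>2" by (simp add: power2_eq_square flip: exp_add)
      then show ?thesis by simp
    qed
    moreover have "0 < t" if "t \<in> {T * exp (-m)..T * exp m}"
      using that T by (auto intro: less_le_trans[of 0 "T * exp (-m)"])
    ultimately show "hh (exp (-t)) * ennreal (exp (- (2 * t))) = ennreal (c\<^sup>2) * (indicator {T * exp (-m)..T * exp m} t * ennreal (q (ln (t / T)) / t))"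
      unfolding hh_def using q(2) by (auto simp: ennreal_mult[symmetric] ennreal_mult''[symmetric] ennreal_mult'[symmetric] split: split_indicator)
  qed
  also have "\<dots> = ennreal (c\<^sup>2) * (\<integral>\<^sup>+t. indicator {T * exp (-m)..T * exp m} t * ennreal (q (ln (t / T)) / t) \<partial>lborel)"
    by (rule nn_integral_cmult) measurable
  also have "(\<integral>\<^sup>+t. indicator {T * exp (-m)..T * exp m} t * ennreal (q (ln (t / T)) / t) \<partial>lborel)
     = (\<integral>\<^sup>+\<tau>. indicator {-m..m} \<tau> * ennreal (q \<tau>) \<partial>lborel)"
    by (rule nn_integral_log_substitution[OF T m(1) q])
  also have "ennreal (2 * pi) * (ennreal (c\<^sup>2) * (\<integral>\<^sup>+\<tau>. indicator {-m..m} \<tau> * ennreal (q \<tau>) \<partial>lborel))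
    \<le> ennreal (2 * pi) * (ennreal (c\<^sup>2) * ennreal \<kappa>')"
    using int unfolding q_def by (intro mult_left_mono) auto
  also have "\<dots> = ennreal (2 * pi * (c\<^sup>2 * \<kappa>'))"
    using \<kappa>' by (simp flip: ennreal_mult)
  also have "2 * pi * (c\<^sup>2 * \<kappa>') = 1" using \<kappa>' by (simp add: c)
  finally show ?thesis by (simp add: u_def)
qed

text \<open>Only the annulus where ln (t / T) lies in [- \<eta>, 0] is counted. There t \<ge> T exp
  (- \<eta>) and Z \<ge> z, so the exponent is at least a fixed multiple of
  \<open>T\<close>.\<close>

lemma bump_exp_integral_ge:
  assumes T: "T > 0" and \<eta>: "\<eta> > 0" and z: "z \<ge> 0" "\<And>\<tau>. -\<eta> \<le> \<tau> \<Longrightarrow> \<tau> \<le> 0 \<Longrightarrow> z \<le> Z \<tau>" and \<alpha>: "\<alpha> \<ge> 0"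
    and near: "ball x\<^sub>0 (exp (- (T * exp (-\<eta>)))) \<subseteq> unit_disc"
  shows "ennreal (exp (\<alpha> * (c\<^sup>2 * (T * exp (-\<eta>) * z\<^sup>2))) * (pi * (exp (- (T * exp (-\<eta>))))\<^sup>2 - pi * (exp (-T))\<^sup>2))
    \<le> exp_integral \<alpha> (bump Z T c x\<^sub>0)"
proof -
  define a b where "a = exp (-T)" and "b = exp (- (T * exp (-\<eta>)))"
  have ab: "0 < a" "a \<le> b" using T \<eta> by (auto simp: a_def b_def)
  let ?A = "ball x\<^sub>0 b - ball x\<^sub>0 a"
  let ?e = "exp (\<alpha> * (c\<^sup>2 * (T * exp (-\<eta>) * z\<^sup>2)))"
  have "emeasure lborel ?A = emeasure lborel (ball x\<^sub>0 b) - emeasure lborel (ball x\<^sub>0 a)"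
    using ab by (intro emeasure_Diff) (auto simp: emeasure_ball_plane subset_ball)
  also have "\<dots> = ennreal (pi * b\<^sup>2 - pi * a\<^sup>2)"
    using ab by (simp add: emeasure_ball_plane ennreal_minus)
  finally have A: "emeasure lborel ?A = ennreal (pi * b\<^sup>2 - pi * a\<^sup>2)" .
  have "ennreal (?e * (pi * b\<^sup>2 - pi * a\<^sup>2)) = ennreal ?e * ennreal (pi * b\<^sup>2 - pi * a\<^sup>2)"
    by (rule ennreal_mult') simp
  also have "\<dots> = (\<integral>\<^sup>+x. ennreal ?e * indicator ?A x \<partial>lborel)"
    unfolding A[symmetric] by (rule nn_integral_cmult_indicator[symmetric]) simp
  also have "\<dots> \<le> (\<integral>\<^sup>+x. indicator unit_disc x * ennreal (exp (\<alpha> * (bump Z T c x\<^sub>0 x)\<^sup>2)) \<partial>lborel)"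
  proof (rule nn_integral_mono)
    fix x
    show "ennreal ?e * indicator ?A x \<le> indicator unit_disc x * ennreal (exp (\<alpha> * (bump Z T c x\<^sub>0 x)\<^sup>2))"
    proof (cases "x \<in> ?A")
      case True
      define r t where "r = norm (x - x\<^sub>0)" and "t = - ln r"
      have r: "a \<le> r" "r < b" using True by (auto simp: r_def dist_norm norm_minus_commute)
      then have r0: "r > 0" using ab by linarith
      have "ln r \<ge> -T" using r(1) r0 ln_le_cancel_iff[of a r] by (simp add: a_def)
      moreover have "ln r \<le> - (T * exp (-\<eta>))" using r(2) r0 ln_le_cancel_iff[of r b] by (simp add: b_def)
      ultimately have t: "t \<le> T" "t \<ge> T * exp (-\<eta>)" by (auto simp: t_def)
      have tpos: "t > 0" using t(2) T by (auto intro: less_le_trans[of 0 "T * exp (-\<eta>)"])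
      have "ln (t / T) \<le> 0" using t(1) tpos T by simp
      moreover have "-\<eta> \<le> ln (t / T)"
      proof -
        have "exp (-\<eta>) \<le> t / T" using t(2) T by (simp add: field_simps)
        then have "ln (exp (-\<eta>)) \<le> ln (t / T)" using tpos T by (subst ln_le_cancel_iff) auto
        then show ?thesis by simp
      qed
      ultimately have "z \<le> Z (ln (t / T))" by (intro z)
      then have "z\<^sup>2 \<le> (Z (ln (t / T)))\<^sup>2" using z(1) by (intro power_mono)
      then have "T * exp (-\<eta>) * z\<^sup>2 \<le> t * (Z (ln (t / T)))\<^sup>2"
        using t(2) tpos T by (intro mult_mono) auto
      then have "c\<^sup>2 * (T * exp (-\<eta>) * z\<^sup>2) \<le> c\<^sup>2 * (t * (Z (ln (t / T)))\<^sup>2)" by (rule mult_left_mono) simp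
      also have "\<dots> = (bump Z T c x\<^sub>0 x)\<^sup>2"
        using tpos by (simp add: bump_def profile_def r_def[symmetric] t_def[symmetric] power_mult_distrib)
      finally have "?e \<le> exp (\<alpha> * (bump Z T c x\<^sub>0 x)\<^sup>2)" using \<alpha> by (simp add: mult_left_mono)
      moreover have "x \<in> unit_disc" using True near by (auto simp: b_def)
      ultimately show ?thesis using True by (simp add: ennreal_leI)
    qed simp
  qed
  also have "\<dots> = exp_integral \<alpha> (bump Z T c x\<^sub>0)" by (rule exp_integral_eq[symmetric]) simp
  finally show ?thesis by (simp add: a_def b_def)
qed

text \<open>Both optimality statements are instances: for \<open>x\<^sub>0 = 0\<close> the parameter \<open>\<nu>\<close> is slightly larger than
  \<open>\<mu>\<close>, while for \<open>x\<^sub>0 \<noteq> 0\<close> the potential is bounded near \<open>x\<^sub>0\<close> and \<open>\<nu>\<close> can be taken arbitrarily small.\<close>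

lemma concentrating_sequence:
  assumes \<mu>: "\<mu> > 0" and \<nu>: "\<nu> > 0" and r0: "0 < r\<^sub>0" "r\<^sub>0 < 1"
    and near: "\<And>x. 0 < norm (x - x\<^sub>0) \<Longrightarrow> norm (x - x\<^sub>0) < r\<^sub>0 \<Longrightarrow>
      x \<in> unit_disc - {0} \<and> \<mu> * V (norm x) \<le> \<nu> * hardy (norm (x - x\<^sub>0))"
    and x0: "x\<^sub>0 \<in> unit_disc" and \<alpha>: "\<alpha> > 4 * pi * sqrt (1 + 4 * \<nu>)"
  obtains u where "\<And>n::nat. u n \<in> H_space V \<mu>" "\<And>n. H_norm V \<mu> (u n) \<le> 1"
    "\<And>n. \<exists>\<rho>. \<forall>x. u n x = \<rho> (norm (x - x\<^sub>0))" "concentrating V \<mu> u x\<^sub>0"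
    "(\<lambda>n. exp_integral \<alpha> (u n)) \<longlonglongrightarrow> \<infinity>"
proof -
  have "sqrt (1 + 4 * \<nu>) < \<alpha> / (4 * pi)" using \<alpha> by (simp add: field_simps)
  \<comment> \<open>The strict gap lets the profile miss the optimal energy: \<alpha> > 4 pi
    \<kappa>' is the same as \<alpha> c^2 > 2 below.\<close>
  then obtain \<kappa>' where \<kappa>': "sqrt (1 + 4 * \<nu>) < \<kappa>'" "\<kappa>' < \<alpha> / (4 * pi)" using dense by blast
  have "sqrt (1 + 4 * \<nu>) > 0" using \<nu> by simp
  then have \<kappa>'0: "\<kappa>' > 0" using \<kappa>' by linarith
  have "0 < \<alpha> / (4 * pi)" using \<kappa>'0 \<kappa>'(2) by (rule less_trans)
  then have \<alpha>0: "\<alpha> > 0" by (simp add: zero_less_divide_iff)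
  obtain Z m where Z: "\<And>k. Ck_on k Z UNIV" and m: "m > 0" "\<And>\<tau>. \<bar>\<tau>\<bar> \<ge> m \<Longrightarrow> Z \<tau> = 0" and Z0: "Z 0 = 1"
    and int: "(\<integral>\<^sup>+\<tau>. indicator {-m..m} \<tau> * ennreal ((deriv Z \<tau> + Z \<tau> / 2)\<^sup>2 + \<nu> * (Z \<tau>)\<^sup>2) \<partial>lborel) \<le> ennreal \<kappa>'"
    using near_optimal_profile[OF \<nu> \<kappa>'(1)] by blast
  define c where "c = sqrt (1 / (2 * pi * \<kappa>'))"
  have c: "c\<^sup>2 = 1 / (2 * pi * \<kappa>')" using \<kappa>'0 by (simp add: c_def)
  have ac: "\<alpha> * c\<^sup>2 > 2" unfolding c using \<kappa>' \<kappa>'0 by (simp add: field_simps)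
  have "sqrt (2 / (\<alpha> * c\<^sup>2)) < 1" using ac by simp
  \<comment> \<open>A lower bound for \<open>Z\<close> near 0, where \<open>Z\<close> is close to 1,
    large enough to keep \<alpha> c^2 z^2 > 2.\<close>
  then obtain z where z: "sqrt (2 / (\<alpha> * c\<^sup>2)) < z" "z < 1" using dense by blast
  have "sqrt (2 / (\<alpha> * c\<^sup>2)) \<ge> 0" using ac by simp
  then have z0: "z > 0" using z by linarith
  have z2: "\<alpha> * c\<^sup>2 * z\<^sup>2 > 2"
  proof -
    have "2 / (\<alpha> * c\<^sup>2) = (sqrt (2 / (\<alpha> * c\<^sup>2)))\<^sup>2" using ac by simp
    also have "\<dots> < z\<^sup>2" using z ac by (intro power_strict_mono) auto
    finally show ?thesis using ac by (simp add: field_simps)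
  qed
  have "continuous_on UNIV Z" using Ck_on_continuous_on[OF Z[of 0]] .
  then have "isCont Z 0" by (simp add: continuous_on_eq_continuous_at)
  then have "\<forall>\<^sub>F \<tau> in nhds 0. z < Z \<tau>"
    using z(2) Z0 unfolding isCont_def tendsto_at_iff_tendsto_nhds by (intro order_tendstoD(1)[where y = "Z 0"]) auto
  then obtain e where e: "e > 0" "\<And>\<tau>. dist \<tau> 0 < e \<Longrightarrow> z < Z \<tau>"
    by (auto simp: eventually_nhds_metric)
  define \<eta> where "\<eta> = e / 2"
  have \<eta>: "\<eta> > 0" "\<And>\<tau>. -\<eta> \<le> \<tau> \<Longrightarrow> \<tau> \<le> 0 \<Longrightarrow> z < Z \<tau>"
    using e by (auto simp: \<eta>_def dist_real_def)
  \<comment> \<open>\<open>Z\<close> vanishes beyond m and exceeds z on [- \<eta>, 0]. Consequently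
    the ball used for the lower bound has radius below \<open>r\<^sub>0\<close> and stays in the
    disc.\<close>
  have \<eta>m: "\<eta> < m"
  proof (rule ccontr)
    assume "\<not> \<eta> < m"
    then have "Z (-\<eta>) = 0" using \<eta>(1) by (intro m(2)) simp
    moreover have "z < Z (-\<eta>)" using \<eta>(1) by (intro \<eta>(2)) auto
    ultimately show False using z0 by simp
  qed
  \<comment> \<open>T0 exp (- m) exceeds - ln \<open>r\<^sub>0\<close> by 1, so every bump with T
    \<ge> T0 is supported within distance \<open>r\<^sub>0\<close> of the centre.\<close>
  define T0 where "T0 = (1 - ln r\<^sub>0) * exp m"
  have T0: "T0 > 0" "exp (- (T0 * exp (-m))) < r\<^sub>0"
  proof -
    have l: "ln r\<^sub>0 < 0" using r0 by simp
    then show "T0 > 0" by (simp add: T0_def)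
    have "T0 * exp (-m) = 1 - ln r\<^sub>0" by (simp add: T0_def exp_minus)
    then have "exp (- (T0 * exp (-m))) = exp (ln r\<^sub>0 - 1)" by simp
    also have "\<dots> < exp (ln r\<^sub>0)" by simp
    finally show "exp (- (T0 * exp (-m))) < r\<^sub>0" using r0 by simp
  qed
  define T where "T n = T0 + real n" for n :: nat
  have T: "T n > 0" for n using T0 by (simp add: T_def add_pos_nonneg)
  have hi: "exp (- (T n * exp (-m))) < r\<^sub>0" for n
  proof -
    have "exp (- (T n * exp (-m))) \<le> exp (- (T0 * exp (-m)))" by (simp add: T_def)
    then show ?thesis using T0(2) by linarith
  qed
  have Tlim: "filterlim T at_top sequentially"
    unfolding T_def[abs_def] using filterlim_tendsto_add_at_top[OF tendsto_const filterlim_real_sequentially] .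
  define u where "u n = bump Z (T n) c x\<^sub>0" for n
  have near': "x \<in> unit_disc - {0} \<and> \<mu> * V (norm x) \<le> \<nu> * hardy (norm (x - x\<^sub>0))"
    if "0 < norm (x - x\<^sub>0)" "norm (x - x\<^sub>0) \<le> exp (- (T n * exp (-m)))" for x n
    using near[of x] that hi[of n] by linarith
  have test: "u n \<in> test_functions (unit_disc - {0})" for n
    unfolding u_def using near' by (intro bump_test_functions T Z m) auto
  show thesis
  proof (rule that[of u])
    show "u n \<in> H_space V \<mu>" for n by (rule test_functions_in_H_space[OF test])
    show "H_norm V \<mu> (u n) \<le> 1" for n
    proof -
      have "energy V \<mu> unit_disc (u n) \<le> 1"
        unfolding u_def by (rule bump_energy_le_1[OF T Z m less_imp_le[OF \<nu>] less_imp_le[OF \<mu>] \<kappa>'0 int c near'])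
      then have "enn2real (energy V \<mu> unit_disc (u n)) \<le> 1"
        by (metis enn2real_mono enn2real_1 ennreal_one_less_top)
      then show ?thesis unfolding H_norm_def by simp
    qed
    show "\<exists>\<rho>. \<forall>x. u n x = \<rho> (norm (x - x\<^sub>0))" for n
      unfolding u_def bump_def by (intro exI[of _ "\<lambda>r. c * profile Z (T n) (- ln r)"]) simp
    show "concentrating V \<mu> u x\<^sub>0"
      unfolding concentrating_def
    proof (intro ballI allI impI)
      fix r \<epsilon> :: real assume r: "r \<in> {0<..<1}" and \<epsilon>: "\<epsilon> > 0"
      have "filterlim (\<lambda>t. exp (- (t * exp (-m)))) (nhds (0::real)) at_top" by real_asymp
      then have "(\<lambda>n. exp (- (T n * exp (-m)))) \<longlonglongrightarrow> 0" using Tlim by (rule filterlim_compose)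
      then have "\<forall>\<^sub>F n in sequentially. exp (- (T n * exp (-m))) < r"
        using r by (intro order_tendstoD) auto
      then obtain N where N: "\<And>n. n \<ge> N \<Longrightarrow> exp (- (T n * exp (-m))) < r"
        by (auto simp: eventually_sequentially)
      show "\<exists>n\<^sub>0>0. \<forall>n\<ge>n\<^sub>0. energy V \<mu> (unit_disc - ball x\<^sub>0 r) (u n) < ennreal \<epsilon>"
      \<comment> \<open>\<open>Suc\<close> because the definition asks for a positive index. From
        \<open>N\<close> on the support lies in the small ball, so the energy outside is 0 and not
        just small.\<close>
      proof (intro exI[of _ "Suc N"] conjI allI impI)
        fix n assume "Suc N \<le> n"
        then have n: "exp (- (T n * exp (-m))) < r" using N by simp
        have "energy V \<mu> (unit_disc - ball x\<^sub>0 r) (u n) = (\<integral>\<^sup>+x. indicator (unit_disc - ball x\<^sub>0 r) x *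
          ennreal ((norm (gradient (u n) x))\<^sup>2 + \<mu> * potential V x * (u n x)\<^sup>2) \<partial>lborel)"
          by (rule test_energy_eq[OF test]) auto
        also have "\<dots> = (\<integral>\<^sup>+x. 0 \<partial>(lborel :: (real^2) measure))"
        proof (rule nn_integral_cong)
          fix x
          have "u n x = 0 \<and> gradient (u n) x = 0" if "x \<notin> ball x\<^sub>0 r"
          proof -
            have "\<not> norm (x - x\<^sub>0) \<le> exp (- (T n * exp (-m)))"
              using that n by (auto simp: dist_norm norm_minus_commute)
            then show ?thesis unfolding u_def using bump_support[OF T Z m(2)] by blast
          qed
          then show "indicator (unit_disc - ball x\<^sub>0 r) x * ennreal ((norm (gradient (u n) x))\<^sup>2 + \<mu> * potential V x * (u n x)\<^sup>2) = 0"
            by (auto split: split_indicator)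
        qed
        finally show "energy V \<mu> (unit_disc - ball x\<^sub>0 r) (u n) < ennreal \<epsilon>" using \<epsilon> by simp
      qed simp
    qed
    show "(\<lambda>n. exp_integral \<alpha> (u n)) \<longlonglongrightarrow> \<infinity>"
    proof -
      \<comment> \<open>p is the growth rate of the integrand less the decay rate of the area of the
        outer ball; exp (- d T) is the ratio of the areas of the inner and the outer ball.\<close>
      define p d where "p = (\<alpha> * c\<^sup>2 * z\<^sup>2 - 2) * exp (-\<eta>)" and "d = 2 * (1 - exp (-\<eta>))"
      have pd: "p > 0" "d > 0" using z2 \<eta> by (auto simp: p_def d_def)
      have "filterlim (\<lambda>t. pi * (exp (p * t) * (1 - exp (- (d * t))))) at_top at_top"
        using pd by real_asymp
      then have lim: "filterlim (\<lambda>n. pi * (exp (p * T n) * (1 - exp (- (d * T n))))) at_top sequentially"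
        using Tlim by (rule filterlim_compose)
      have le: "ennreal (pi * (exp (p * T n) * (1 - exp (- (d * T n))))) \<le> exp_integral \<alpha> (u n)" for n
      proof -
        have "exp (- (T n * exp (-\<eta>))) < r\<^sub>0"
        proof -
          have "T n * exp (-m) \<le> T n * exp (-\<eta>)" using \<eta>m T[of n] by simp
          then have "exp (- (T n * exp (-\<eta>))) \<le> exp (- (T n * exp (-m)))" by simp
          then show ?thesis using hi[of n] by linarith
        qed
        then have "ball x\<^sub>0 (exp (- (T n * exp (-\<eta>)))) \<subseteq> unit_disc"
        proof (intro subsetI)
          fix x assume "exp (- (T n * exp (-\<eta>))) < r\<^sub>0" "x \<in> ball x\<^sub>0 (exp (- (T n * exp (-\<eta>))))"
          then have "norm (x - x\<^sub>0) < r\<^sub>0" by (auto simp: dist_norm norm_minus_commute)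
          then show "x \<in> unit_disc" using near[of x] x0 by (cases "x = x\<^sub>0") auto
        qed
        from bump_exp_integral_ge[where Z = Z and c = c, OF T \<eta>(1) less_imp_le[OF z0] less_imp_le[OF \<eta>(2)] less_imp_le[OF \<alpha>0] this]
        have "ennreal (exp (\<alpha> * (c\<^sup>2 * (T n * exp (-\<eta>) * z\<^sup>2))) * (pi * (exp (- (T n * exp (-\<eta>))))\<^sup>2 - pi * (exp (- T n))\<^sup>2)) \<le> exp_integral \<alpha> (u n)"
          unfolding u_def by blast
        also have "exp (\<alpha> * (c\<^sup>2 * (T n * exp (-\<eta>) * z\<^sup>2))) * (pi * (exp (- (T n * exp (-\<eta>))))\<^sup>2 - pi * (exp (- T n))\<^sup>2)
          = pi * (exp (p * T n) * (1 - exp (- (d * T n))))"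
        proof -
          have 1: "(exp (- (T n * exp (-\<eta>))))\<^sup>2 = exp (- 2 * (T n * exp (-\<eta>)))" "(exp (- T n))\<^sup>2 = exp (- 2 * T n)"
            by (simp_all add: power2_eq_square flip: exp_add)
          have 2: "exp (\<alpha> * (c\<^sup>2 * (T n * exp (-\<eta>) * z\<^sup>2))) * exp (- 2 * (T n * exp (-\<eta>))) = exp (p * T n)"
            unfolding exp_add[symmetric] p_def by (simp add: algebra_simps)
          have 3: "exp (\<alpha> * (c\<^sup>2 * (T n * exp (-\<eta>) * z\<^sup>2))) * exp (- 2 * T n) = exp (p * T n) * exp (- (d * T n))"
            unfolding exp_add[symmetric] p_def d_def by (simp add: algebra_simps)
          show ?thesis unfolding 1 right_diff_distrib mult.left_commute[of _ pi] 2 3 by simp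
        qed
        finally show ?thesis .
      qed
      have top: "(\<lambda>n. ennreal (pi * (exp (p * T n) * (1 - exp (- (d * T n)))))) \<longlonglongrightarrow> top"
        using lim by (simp add: ennreal_tendsto_top_eq_at_top)
      have "(\<lambda>n. exp_integral \<alpha> (u n)) \<longlonglongrightarrow> top"
        by (rule tendsto_sandwich[OF _ _ top tendsto_const]) (use le in auto)
      then show ?thesis by simp
    qed
  qed
qed

theorem theorem1p6:
  fixes \<mu> :: real and V :: "real \<Rightarrow> real"
  assumes "\<mu> > 0"
    and "continuous_on {0<..<1} V"
    and "\<forall>r\<in>{0<..<1}. V r \<ge> 0"
    and "\<forall>r\<in>{0<..<1}. V r \<ge> 1 / (r\<^sup>2 * (- ln r)\<^sup>2)"
  shows
    "((SUP u\<in>{u \<in> H_space V \<mu>. radial u \<and> H_norm V \<mu> u \<le> 1}. exp_integral (m_crit \<mu>) u) < \<infinity>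
      \<and> (\<forall>\<alpha>>m_crit \<mu>. ((\<lambda>r. V r * r\<^sup>2 * (- ln r)\<^sup>2) \<longlongrightarrow> 1) (at_right 0) \<longrightarrow>
           (\<exists>u::nat \<Rightarrow> real^2 \<Rightarrow> real.
              (\<forall>n. u n \<in> H_space V \<mu> \<and> radial (u n) \<and> H_norm V \<mu> (u n) \<le> 1)
              \<and> concentrating V \<mu> u 0
              \<and> (\<lambda>n. exp_integral \<alpha> (u n)) \<longlonglongrightarrow> \<infinity>)))
     \<and>
     ((SUP u\<in>{u \<in> H_space V \<mu>. H_norm V \<mu> u \<le> 1}. exp_integral (4 * pi) u) < \<infinity>
      \<and> (\<forall>\<alpha>>4 * pi. ((\<lambda>r. V r * r\<^sup>2 * (- ln r)\<^sup>2) \<longlongrightarrow> 1) (at_right 0) \<longrightarrow>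
           (\<exists>(u::nat \<Rightarrow> real^2 \<Rightarrow> real) x\<^sub>0.
              (\<forall>n. u n \<in> H_space V \<mu> \<and> H_norm V \<mu> (u n) \<le> 1)
              \<and> x\<^sub>0 \<in> unit_disc - {0}
              \<and> concentrating V \<mu> u x\<^sub>0
              \<and> (\<lambda>n. exp_integral \<alpha> (u n)) \<longlonglongrightarrow> \<infinity>)))"
proof (intro conjI allI impI)
  have "(SUP u\<in>{u \<in> H_space V \<mu>. radial u \<and> H_norm V \<mu> u \<le> 1}. exp_integral (m_crit \<mu>) u) \<le> ennreal (critical_const 2)"
    using radial_moser_upper[OF assms(1,2,4)] by (intro SUP_least) auto
  then show "(SUP u\<in>{u \<in> H_space V \<mu>. radial u \<and> H_norm V \<mu> u \<le> 1}. exp_integral (m_crit \<mu>) u) < \<infinity>"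
    by (rule le_less_trans) simp
  have "(SUP u\<in>{u \<in> H_space V \<mu>. H_norm V \<mu> u \<le> 1}. exp_integral (4 * pi) u) \<le> ennreal (critical_const (4 + ln 4))"
    using moser_trudinger_upper[OF assms(1,2,4)] by (intro SUP_least) auto
  then show "(SUP u\<in>{u \<in> H_space V \<mu>. H_norm V \<mu> u \<le> 1}. exp_integral (4 * pi) u) < \<infinity>"
    by (rule le_less_trans) simp
next
  fix \<alpha> assume \<alpha>: "m_crit \<mu> < \<alpha>" and lim: "((\<lambda>r. V r * r\<^sup>2 * (- ln r)\<^sup>2) \<longlongrightarrow> 1) (at_right 0)"
  have "sqrt (1 + 4 * \<mu>) < \<alpha> / (4 * pi)" using \<alpha> by (simp add: m_crit_def field_simps)
  then obtain s where s: "sqrt (1 + 4 * \<mu>) < s" "s < \<alpha> / (4 * pi)" using dense by blast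
  \<comment> \<open>The solution of sqrt (1 + 4 \<nu>) = s. It exceeds \<mu> because s exceeds sqrt
    (1 + 4 \<mu>), and the ratio \<nu> / \<mu> is the slack by which \<open>V\<close> may exceed the
    Hardy weight near 0.\<close>
  define \<nu> where "\<nu> = (s\<^sup>2 - 1) / 4"
  have s0: "s > 0" using s(1) \<open>\<mu> > 0\<close> by (smt (verit) real_sqrt_ge_zero)
  have "1 + 4 * \<mu> < s\<^sup>2" using s(1) s0 \<open>\<mu> > 0\<close> real_less_rsqrt real_sqrt_less_iff
    by (metis real_sqrt_abs abs_of_pos)
  moreover have s\<nu>: "1 + 4 * \<nu> = s\<^sup>2" unfolding \<nu>_def by (simp add: field_simps)
  ultimately have \<nu>: "\<mu> < \<nu>" "sqrt (1 + 4 * \<nu>) = s"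
    using s0 unfolding s\<nu> by (auto simp: \<nu>_def)
  have "\<forall>\<^sub>F r in at_right 0. V r * r\<^sup>2 * (- ln r)\<^sup>2 < \<nu> / \<mu>"
    using lim by (rule order_tendstoD) (use \<nu> \<open>\<mu> > 0\<close> in simp)
  then obtain b where b: "b > 0" "\<And>r. 0 < r \<Longrightarrow> r < b \<Longrightarrow> V r * r\<^sup>2 * (- ln r)\<^sup>2 < \<nu> / \<mu>"
    by (auto simp: eventually_at_right_field)
  show "\<exists>u::nat \<Rightarrow> real^2 \<Rightarrow> real. (\<forall>n. u n \<in> H_space V \<mu> \<and> radial (u n) \<and> H_norm V \<mu> (u n) \<le> 1)
      \<and> concentrating V \<mu> u 0 \<and> (\<lambda>n. exp_integral \<alpha> (u n)) \<longlonglongrightarrow> \<infinity>"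
  proof (rule concentrating_sequence[of \<mu> \<nu> "min b (1/2)" 0 V \<alpha>])
    fix x :: "real^2" assume x: "0 < norm (x - 0)" "norm (x - 0) < min b (1/2)"
    define r where "r = norm x"
    have r: "0 < r" "r < b" "r < 1" using x by (auto simp: r_def)
    have "0 < r\<^sup>2 * (- ln r)\<^sup>2" using r by simp
    moreover have "V r * (r\<^sup>2 * (- ln r)\<^sup>2) * \<mu> \<le> \<nu>"
      using b(2)[OF r(1,2)] \<open>\<mu> > 0\<close> by (simp add: field_simps)
    ultimately have "\<mu> * V r \<le> \<nu> * hardy r" by (simp add: hardy_def field_simps)
    then show "x \<in> unit_disc - {0} \<and> \<mu> * V (norm x) \<le> \<nu> * hardy (norm (x - 0))"
      using r by (auto simp: r_def)
  next
    fix u :: "nat \<Rightarrow> real^2 \<Rightarrow> real"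
    assume u: "\<And>n. u n \<in> H_space V \<mu>" "\<And>n. H_norm V \<mu> (u n) \<le> 1"
      "\<And>n. \<exists>\<rho>. \<forall>x. u n x = \<rho> (norm (x - 0))" "concentrating V \<mu> u 0" "(\<lambda>n. exp_integral \<alpha> (u n)) \<longlonglongrightarrow> \<infinity>"
    have "radial (u n)" for n
    proof -
      obtain \<rho> where "\<And>x. u n x = \<rho> (norm x)" using u(3)[of n] by auto
      then show ?thesis unfolding radial_def by (intro exI[of _ \<rho>] AE_I2) simp
    qed
    then show ?thesis using u by blast
  qed (use b \<nu> s \<open>\<mu> > 0\<close> in \<open>auto simp: field_simps\<close>)
next
  fix \<alpha> :: real assume \<alpha>: "4 * pi < \<alpha>"
  have "1 < \<alpha> / (4 * pi)" using \<alpha> by (simp add: field_simps)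
  then obtain s where s: "1 < s" "s < \<alpha> / (4 * pi)" using dense by blast
  define \<nu> where "\<nu> = (s\<^sup>2 - 1) / 4"
  have s\<nu>: "1 + 4 * \<nu> = s\<^sup>2" unfolding \<nu>_def by (simp add: field_simps)
  have \<nu>: "\<nu> > 0" "sqrt (1 + 4 * \<nu>) = s" using s unfolding s\<nu> by (auto simp: \<nu>_def)
  define x\<^sub>0 :: "real^2" where "x\<^sub>0 = (1/2) *\<^sub>R axis 1 1"
  have nx0: "norm x\<^sub>0 = 1/2" by (simp add: x\<^sub>0_def norm_axis_1)
  \<comment> \<open>On the ball of radius 1/4 around \<open>x\<^sub>0\<close> the norm stays between
    1/4 and 3/4, away from both ends of the interval, where \<open>V\<close> may blow up.\<close>
  have "compact (V ` {1/4..3/4})"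
    using assms(2) by (intro compact_continuous_image) (auto intro: continuous_on_subset)
  then obtain B where B: "\<And>r. 1/4 \<le> r \<Longrightarrow> r \<le> 3/4 \<Longrightarrow> V r \<le> B"
    by (metis bdd_above.E atLeastAtMost_iff image_eqI compact_imp_bounded bounded_imp_bdd_above)
  \<comment> \<open>The Hardy weight centred at \<open>x\<^sub>0\<close> blows up there while
    \<open>V\<close> stays bounded. Hence every \<nu> > 0 makes it dominate on a small ball, and the
    threshold 4 pi sqrt (1 + 4 \<nu>) can be brought down to 4 pi.\<close>
  have "filterlim hardy at_top (at_right 0)" unfolding hardy_def by real_asymp
  then have "\<forall>\<^sub>F r in at_right 0. \<mu> * B / \<nu> \<le> hardy r"
    unfolding filterlim_at_top by blast
  then obtain b where b: "b > 0" "\<And>r. 0 < r \<Longrightarrow> r < b \<Longrightarrow> \<mu> * B / \<nu> \<le> hardy r"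
    by (auto simp: eventually_at_right_field)
  have x0: "x\<^sub>0 \<in> unit_disc - {0}" using nx0 by auto
  show "\<exists>(u::nat \<Rightarrow> real^2 \<Rightarrow> real) x\<^sub>0. (\<forall>n. u n \<in> H_space V \<mu> \<and> H_norm V \<mu> (u n) \<le> 1)
      \<and> x\<^sub>0 \<in> unit_disc - {0} \<and> concentrating V \<mu> u x\<^sub>0 \<and> (\<lambda>n. exp_integral \<alpha> (u n)) \<longlonglongrightarrow> \<infinity>"
  proof (rule concentrating_sequence[of \<mu> \<nu> "min b (1/4)" x\<^sub>0 V \<alpha>])
    fix x assume x: "0 < norm (x - x\<^sub>0)" "norm (x - x\<^sub>0) < min b (1/4)"
    have n: "1/4 \<le> norm x" "norm x \<le> 3/4"
      using x(2) nx0 norm_triangle_ineq2[of x x\<^sub>0] norm_triangle_ineq3[of x x\<^sub>0] by auto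
    have "\<mu> * V (norm x) \<le> \<mu> * B" using B[OF n] \<open>\<mu> > 0\<close> by simp
    also have "\<dots> \<le> \<nu> * hardy (norm (x - x\<^sub>0))"
      using b(2)[of "norm (x - x\<^sub>0)"] x \<nu>(1) by (simp add: field_simps)
    finally show "x \<in> unit_disc - {0} \<and> \<mu> * V (norm x) \<le> \<nu> * hardy (norm (x - x\<^sub>0))"
      using n by auto
  next
    fix u :: "nat \<Rightarrow> real^2 \<Rightarrow> real"
    assume "\<And>n. u n \<in> H_space V \<mu>" "\<And>n. H_norm V \<mu> (u n) \<le> 1"
      "concentrating V \<mu> u x\<^sub>0" "(\<lambda>n. exp_integral \<alpha> (u n)) \<longlonglongrightarrow> \<infinity>"
    then show ?thesis using x0 by blast
  qed (use b \<nu> s x0 \<open>\<mu> > 0\<close> in \<open>auto simp: field_simps\<close>)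
qed

end
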